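(* Let $b\in\mathrm{bmo}(\mathbb{R}^n)$ and let $T$ be an inhomogeneous singular integral operator. Then for every approximate $h^1_b$ atom $a$, $[b,T](a)\in L^1(\mathbb{R}^n)$ and $$\|[b,T]a\|_{L^1}\le C\|b\|_{\mathrm{bmo}},$$ with $C$ depending only on $n$ and $T$. Consequently, for every finite linear combination $f=\sum_k\gamma_ka_k$ of approximate $h^1_b$ atoms, $\|[b,T]f\|_{L^1}\le C\|b\|_{\mathrm{bmo}}\inf\sum_k|\gamma_k|$, the infimum over all such finite representations of $f$.
   Context: Let $\Delta=\{(x,x):x\in\mathbb{R}^n\}$. An inhomogeneous singular integral operator (with inhomogeneous $\delta$-kernel, $\delta\in(0,1]$) is an operator $T$ bounded on $L^2(\mathbb{R}^n)$ associated with a locally integrable $K$ on $\mathbb{R}^{2n}\setminus\Delta$ such that for some $\varepsilon>0$, $C>0$: $|K(x,y)|\le C\min\{|x-y|^{-n},|x-y|^{-n-\varepsilon}\}$; $|K(x,y)-K(x,z)|+|K(y,x)-K(z,x)|\le C|y-z|^\delta|x-y|^{-n-\delta}$ whenever $2|y-z|\le|x-y|$; and $Tf(x)=\int K(x,y)f(y)\,dy$ for $f\in C_c^\infty$ and $x\notin\mathrm{supp}\,f$. (Such $T$ is bounded on $L^p$, $1<p<\infty$.) The commutator is $[b,T]f:=bT(f)-T(bf)$. For a ball $B$, $c_B:=b_B=\frac1{|B|}\int_Bb$ if $r(B)<1$ and $c_B:=0$ if $r(B)\ge1$; $\|b\|_{\mathrm{bmo}}:=\sup_B\frac1{|B|}\int_B|b-c_B|$;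 $C_b:=\|b\|_{\mathrm{bmo},2}:=\sup_B(\frac1{|B|}\int_B|b-c_B|^2)^{1/2}$. An approximate $h^1_b$ atom: $a$ supported in $B=B(x_0,r)$ with $\|a\|_{L^2}\le|B|^{-1/2}$, $|\int a|\le[\log(1+r^{-1})]^{-2}$, $|\int a(b-c_B)|\le C_b[\log(1+r^{-1})]^{-1}$. *)

theory Defs
  imports "HOL-Analysis.Analysis"
begin

inductive_set partial_derivs :: "('a::euclidean_space \<Rightarrow> real) \<Rightarrow> ('a \<Rightarrow> real) set"
  for f where
  base: "f \<in> partial_derivs f"
| step: "g \<in> partial_derivs f \<Longrightarrow> (\<forall>x. g differentiable (at x)) \<Longrightarrow> i \<in> Basis \<Longrightarrow>
         (\<lambda>x. frechet_derivative g (at x) i) \<in> partial_derivs f"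

definition smooth_fun :: "('a::euclidean_space \<Rightarrow> real) \<Rightarrow> bool" where
  "smooth_fun f \<longleftrightarrow> (\<forall>g \<in> partial_derivs f. \<forall>x. g differentiable (at x))"

definition fsupp :: "('a::euclidean_space \<Rightarrow> real) \<Rightarrow> 'a set" where
  "fsupp f = closure {x. f x \<noteq> 0}"

definition Cc_inf :: "('a::euclidean_space \<Rightarrow> real) set" where
  "Cc_inf = {f. smooth_fun f \<and> compact (fsupp f)}"

definition Lp :: "real \<Rightarrow> ('a::euclidean_space \<Rightarrow> real) set" where
  "Lp p = {f. f \<in> borel_measurable lborel \<and> integrable lborel (\<lambda>x. \<bar>f x\<bar> powr p)}"

definition Lp_norm :: "real \<Rightarrow> ('a::euclidean_space \<Rightarrow> real) \<Rightarrow> real" where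
  "Lp_norm p f = (\<integral>x. \<bar>f x\<bar> powr p \<partial>lborel) powr (1 / p)"

definition inhom_SIO ::
  "((('a::euclidean_space) \<Rightarrow> real) \<Rightarrow> ('a \<Rightarrow> real)) \<Rightarrow> ('a \<Rightarrow> 'a \<Rightarrow> real) \<Rightarrow> real \<Rightarrow> bool" where
  "inhom_SIO T K \<delta> \<longleftrightarrow>
     0 < \<delta> \<and> \<delta> \<le> 1 \<and>
     \<comment> \<open>boundedness on L^p, 1<p<infinity (including p = 2)\<close>
     (\<forall>p. 1 < p \<longrightarrow> (\<exists>C. \<forall>f \<in> Lp p. T f \<in> Lp p \<and> Lp_norm p (T f) \<le> C * Lp_norm p f)) \<and>
     \<comment> \<open>linearity (almost everywhere)\<close>
     (\<forall>f g c. f \<in> (\<Union>p\<in>{1<..}. Lp p) \<longrightarrow> g \<in> (\<Union>p\<in>{1<..}. Lp p) \<longrightarrow>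
        (AE x in lborel. T (\<lambda>y. c * f y + g y) x = c * T f x + T g x)) \<and>
     \<comment> \<open>local integrability of K on the complement of the diagonal\<close>
     (\<lambda>(x, y). K x y) \<in> borel_measurable (lborel \<Otimes>\<^sub>M lborel) \<and>
     (\<forall>S. compact S \<longrightarrow> S \<inter> {(x, x) | x. True} = {} \<longrightarrow>
        set_integrable (lborel \<Otimes>\<^sub>M lborel) S (\<lambda>(x, y). K x y)) \<and>
     (\<exists>\<epsilon> C. 0 < \<epsilon> \<and> 0 < C \<and>
        (\<forall>x y. x \<noteq> y \<longrightarrow>
           \<bar>K x y\<bar> \<le> C * min (dist x y powr (- real DIM('a)))
                                 (dist x y powr (- real DIM('a) - \<epsilon>))) \<and>
        (\<forall>x y z. x \<noteq> y \<longrightarrow> 2 * dist y z \<le> dist x y \<longrightarrow>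
           \<bar>K x y - K x z\<bar> + \<bar>K y x - K z x\<bar>
             \<le> C * dist y z powr \<delta> * dist x y powr (- real DIM('a) - \<delta>))) \<and>
     \<comment> \<open>kernel representation off the support\<close>
     (\<forall>f \<in> Cc_inf. \<forall>x. x \<notin> fsupp f \<longrightarrow>
        T f x = (\<integral>y. K x y * f y \<partial>lborel))"

definition commutator ::
  "('a \<Rightarrow> real) \<Rightarrow> (('a \<Rightarrow> real) \<Rightarrow> ('a \<Rightarrow> real)) \<Rightarrow> ('a \<Rightarrow> real) \<Rightarrow> 'a \<Rightarrow> real" where
  "commutator b T f = (\<lambda>x. b x * T f x - T (\<lambda>y. b y * f y) x)"

definition ball_avg :: "('a::euclidean_space \<Rightarrow> real) \<Rightarrow> 'a \<Rightarrow> real \<Rightarrow> real" where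
  "ball_avg f x r = (\<integral>y\<in>ball x r. f y \<partial>lborel) / measure lborel (ball x r)"

definition cB :: "('a::euclidean_space \<Rightarrow> real) \<Rightarrow> 'a \<Rightarrow> real \<Rightarrow> real" where
  "cB b x r = (if r < 1 then ball_avg b x r else 0)"

definition bmo :: "('a::euclidean_space \<Rightarrow> real) set" where
  "bmo = {b. b \<in> borel_measurable lborel \<and>
             (\<forall>x r. 0 < r \<longrightarrow> set_integrable lborel (ball x r) b) \<and>
             bdd_above {ball_avg (\<lambda>y. \<bar>b y - cB b x r\<bar>) x r | x r. 0 < r}}"

definition bmo_norm :: "('a::euclidean_space \<Rightarrow> real) \<Rightarrow> real" where
  "bmo_norm b = (SUP (x, r) \<in> UNIV \<times> {0<..}. ball_avg (\<lambda>y. \<bar>b y - cB b x r\<bar>) x r)"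

definition bmo2_norm :: "('a::euclidean_space \<Rightarrow> real) \<Rightarrow> real" where
  "bmo2_norm b = (SUP (x, r) \<in> UNIV \<times> {0<..}. sqrt (ball_avg (\<lambda>y. (b y - cB b x r)\<^sup>2) x r))"

definition approx_atom :: "('a::euclidean_space \<Rightarrow> real) \<Rightarrow> ('a \<Rightarrow> real) \<Rightarrow> bool" where
  "approx_atom b a \<longleftrightarrow> (\<exists>x0 r. 0 < r \<and>
     a \<in> borel_measurable lborel \<and>
     (\<forall>x. x \<notin> ball x0 r \<longrightarrow> a x = 0) \<and>
     integrable lborel (\<lambda>x. (a x)\<^sup>2) \<and>
     sqrt (\<integral>x. (a x)\<^sup>2 \<partial>lborel) \<le> measure lborel (ball x0 r) powr (-1/2) \<and>
     \<bar>\<integral>x. a x \<partial>lborel\<bar> \<le> (ln (1 + 1 / r)) powr (-2) \<and>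
     \<bar>\<integral>x. a x * (b x - cB b x0 r) \<partial>lborel\<bar> \<le> bmo2_norm b * (ln (1 + 1 / r)) powr (-1))"

definition atom_reps :: "('a::euclidean_space \<Rightarrow> real) \<Rightarrow> ('a \<Rightarrow> real) \<Rightarrow> (real \<times> ('a \<Rightarrow> real)) list set" where
  "atom_reps b f = {ps. (\<forall>(\<gamma>, a) \<in> set ps. approx_atom b a) \<and>
                        f = (\<lambda>x. \<Sum>(\<gamma>, a) \<leftarrow> ps. \<gamma> * a x)}"

definition L1_norm :: "('a::euclidean_space \<Rightarrow> real) \<Rightarrow> real" where
  "L1_norm f = (\<integral>x. \<bar>f x\<bar> \<partial>lborel)"

end

theory Submission imports Defs begin

text \<open>By the John--Nirenberg inequality (only its \<open>L\<^sup>4\<close> form is needed), \<open>(b - c\<^sub>B) a\<close> lies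
  in \<open>L\<^sup>p\<close> with \<open>p = 4/3\<close> for every atom \<open>a\<close> on a ball \<open>B\<close>, and linearity gives
  \<open>[b,T]a = (b - c\<^sub>B) T a - T ((b - c\<^sub>B) a)\<close> almost everywhere. Near \<open>B\<close> both terms are
  controlled by the boundedness of \<open>T\<close> on \<open>L\<^sup>2\<close> and \<open>L\<^sup>p\<close>. Away from \<open>B\<close> one subtracts the value
  of the kernel at the centre: the Hoelder condition gives a geometric series over dyadic shells,
  and what remains is the size bound of the kernel times \<open>|\<integral> a|\<close> resp. \<open>|\<integral> (b - c\<^sub>B) a|\<close>. For
  a radius \<open>r < 1\<close> there are about \<open>log (1/r)\<close> shells before the inhomogeneous decay sets in, and
  \<open>b - c\<^sub>B\<close> grows linearly in the index of the shell, which costs \<open>log\<^sup>2\<close> resp. \<open>log\<close>: exactly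
  what the two cancellation conditions of an atom pay for.\<close>

section \<open>Balls and averages\<close>

text \<open>The exponents fit by Hoelder: an \<open>L^2\<close> atom times an \<open>L^4\<close>
  oscillation lies in \<open>L^(4/3)\<close>, and that is the only \<open>L^p\<close> bound used
  besides \<open>L^2\<close>. The main obstacle is that the kernel formula is postulated for smooth
  compactly supported functions, whereas atoms are rough. It is carried over to \<open>L^p\<close>
  functions supported in a ball, almost everywhere at a distance from that ball, by closing the
  class of functions that satisfy it under linear combinations and dominated limits. The
  fourth-moment bound avoids distribution functions: a bound \<open>M\<close> is fed back into
  itself with factor 1/2. This is void for infinite \<open>M\<close>, hence the passage through
  truncations. The mean of a truncated function is not the truncated mean, so the constants attached
  to balls are left arbitrary until the end. Products are split by Young-type inequalities after
  \<open>a\<close> is multiplied by the volume \<open>V\<close> and \<open>b - c_B\<close> is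
  divided by \<open>A\<close>, so that all terms come out as multiples of \<open>A\<close>. Here
  \<open>A\<close> is any positive upper bound of the bmo norm; it tends to the norm only in the
  final step, which also covers norm 0.\<close>

definition vol :: "'a::euclidean_space itself \<Rightarrow> real \<Rightarrow> real" where
  "vol _ r = unit_ball_vol (real DIM('a)) * r ^ DIM('a)"

lemma emeasure_lborel_ball:
  fixes x :: "'a::euclidean_space"
  assumes "0 < r"
  shows "emeasure lborel (ball x r) = ennreal (vol TYPE('a) r)"
  using assms by (simp add: emeasure_ball vol_def)

lemma vol_pos: "0 < r \<Longrightarrow> 0 < vol TYPE('a::euclidean_space) r"
  by (simp add: vol_def unit_ball_vol_pos)

lemma vol_mult: "vol TYPE('a::euclidean_space) (s * r) = s ^ DIM('a) * vol TYPE('a) r"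
  by (simp add: vol_def power_mult_distrib)

lemma vol_mono: "0 \<le> r \<Longrightarrow> r \<le> s \<Longrightarrow> vol TYPE('a::euclidean_space) r \<le> vol TYPE('a) s"
  by (simp add: vol_def mult_left_mono power_mono unit_ball_vol_pos less_imp_le)

lemma measure_lborel_ball:
  fixes x :: "'a::euclidean_space"
  assumes "0 < r"
  shows "measure lborel (ball x r) = vol TYPE('a) r"
  using emeasure_lborel_ball[OF assms, of x] vol_pos[OF assms, where 'a='a] by (simp add: measure_def)

lemma nn_integral_ball_const:
  fixes x :: "'a::euclidean_space"
  assumes "0 < r" "0 \<le> c"
  shows "(\<integral>\<^sup>+y\<in>ball x r. ennreal c \<partial>lborel) = ennreal (c * vol TYPE('a) r)"
  using assms by (simp add: nn_integral_cmult_indicator emeasure_lborel_ball ennreal_mult vol_pos less_imp_le)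

text \<open>Subadditivity in the count-space form that \<open>emeasure_UN_countable\<close> has for
  disjoint families. It is meant for the enlarged Vitali balls, which overlap.\<close>

lemma emeasure_UN_le_count_space:
  assumes "countable I" "\<And>i. i \<in> I \<Longrightarrow> X i \<in> sets M"
  shows "emeasure M (\<Union>i\<in>I. X i) \<le> (\<integral>\<^sup>+i. emeasure M (X i) \<partial>count_space I)"
proof -
  have "emeasure M (\<Union>i\<in>I. X i) = (\<integral>\<^sup>+x. indicator (\<Union>i\<in>I. X i) x \<partial>M)"
    using assms by (intro nn_integral_indicator[symmetric] sets.countable_UN') auto
  also have "\<dots> \<le> (\<integral>\<^sup>+x. (\<integral>\<^sup>+i. indicator (X i) x \<partial>count_space I) \<partial>M)"
  proof (intro nn_integral_mono)
    fix x
    show "indicator (\<Union>i\<in>I. X i) x \<le> (\<integral>\<^sup>+i. indicator (X i) x \<partial>count_space I)"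
    proof (cases "x \<in> (\<Union>i\<in>I. X i)")
      case True
      then obtain i where i: "i \<in> I" "x \<in> X i" by auto
      have "1 = (\<integral>\<^sup>+j. indicator {i} j \<partial>count_space I)"
        using i by simp
      also have "\<dots> \<le> (\<integral>\<^sup>+i. indicator (X i) x \<partial>count_space I)"
        using i by (intro nn_integral_mono) (auto split: split_indicator)
      finally show ?thesis using True by simp
    qed simp
  qed
  also have "\<dots> = (\<integral>\<^sup>+i. (\<integral>\<^sup>+x. indicator (X i) x \<partial>M) \<partial>count_space I)"
    using assms by (subst nn_integral_count_space_nn_integral) auto
  also have "\<dots> = (\<integral>\<^sup>+i. emeasure M (X i) \<partial>count_space I)"
    using assms by (intro nn_integral_cong) auto
  finally show ?thesis .
qed

lemma measurable_ball_integral: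
  fixes f :: "'a::euclidean_space \<Rightarrow> ennreal"
  assumes [measurable]: "f \<in> borel_measurable borel"
  shows "(\<lambda>x. \<integral>\<^sup>+y\<in>ball x r. f y \<partial>lborel) \<in> borel_measurable borel"
proof -
  have [measurable]: "Measurable.pred (borel \<Otimes>\<^sub>M borel) (\<lambda>p::'a\<times>'a. snd p \<in> ball (fst p) r)"
    unfolding mem_ball by measurable
  have "(\<lambda>p::'a\<times>'a. f (snd p) * indicator (ball (fst p) r) (snd p)) \<in> borel_measurable (borel \<Otimes>\<^sub>M lborel)"
    by measurable
  from lborel.borel_measurable_nn_integral_fst[OF this] show ?thesis
    by simp
qed

text \<open>A one-sided substitute for Lebesgue's differentiation theorem, obtained directly from
  Vitali's covering theorem.\<close>

lemma null_set_of_small_averages: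
  fixes f :: "'a::euclidean_space \<Rightarrow> ennreal"
  assumes f [measurable]: "f \<in> borel_measurable borel"
    and E: "E \<in> sets borel" "bounded E" and "0 < s" "0 < l"
    and large: "\<And>x. x \<in> E \<Longrightarrow> ennreal (2 * l) \<le> f x"
    and small: "\<And>x k. x \<in> E \<Longrightarrow> (\<integral>\<^sup>+y\<in>ball x (s / 2 ^ k). f y \<partial>lborel) \<le> ennreal (l * vol TYPE('a) (s / 2 ^ k))"
  shows "E \<in> null_sets lborel"
proof -
  let ?\<nu> = "density lborel f"
  note E(1)[measurable]
  have nu: "emeasure ?\<nu> X = (\<integral>\<^sup>+y\<in>X. f y \<partial>lborel)" if "X \<in> sets borel" for X
    using that by (simp add: emeasure_density)
  have finE: "emeasure lborel E < \<infinity>"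
    by (rule emeasure_bounded_finite) fact
  have key: "ennreal l * emeasure lborel E \<le> ennreal (l * e)" if "0 < e" for e
  proof -
    obtain U where U: "open U" "E \<subseteq> U" "emeasure lborel (U - E) < ennreal e"
      using outer_regular_lborel[of E e] E(1) \<open>0 < e\<close> by auto
    \<comment> \<open>Indices are pairs of a centre and a scale, because Vitali's theorem asks for
      arbitrarily small balls around each point.\<close>
    define Q where "Q = {(x, k::nat). x \<in> E \<and> ball x (s / 2 ^ k) \<subseteq> U}"
    have "\<exists>i. i \<in> Q \<and> x \<in> ball (fst i) (s / 2 ^ snd i) \<and> s / 2 ^ snd i < d"
      if x: "x \<in> E" and "0 < d" for x d
    proof -
      obtain e' where e': "0 < e'" "ball x e' \<subseteq> U"
        using U x by (meson open_contains_ball subsetD)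
      define m where "m = min d e'"
      have "m > 0" using e' \<open>0 < d\<close> by (simp add: m_def)
      obtain k where k: "(1/2) ^ k < m / s"
        using real_arch_pow_inv[of "m / s" "1/2"] \<open>0 < m\<close> \<open>0 < s\<close> by auto
      then have "s / 2 ^ k < m"
        using \<open>0 < s\<close> by (simp add: field_simps power_one_over)
      moreover have "0 < s / 2 ^ k" using \<open>0 < s\<close> by simp
      ultimately show ?thesis
        using e' x by (intro exI[of _ "(x, k)"]) (auto simp: Q_def m_def)
    qed
    then obtain C where C: "countable C" "C \<subseteq> Q"
      "pairwise (\<lambda>i j. disjnt (ball (fst i) (s / 2 ^ snd i)) (ball (fst j) (s / 2 ^ snd j))) C"
      "negligible (E - (\<Union>i\<in>C. ball (fst i) (s / 2 ^ snd i)))"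
      by (rule Vitali_covering_theorem_balls)
    define X where "X i = ball (fst i) (s / 2 ^ snd i)" for i :: "'a \<times> nat"
    have [measurable]: "X i \<in> sets borel" for i by (simp add: X_def)
    have XU [measurable]: "(\<Union>i\<in>C. X i) \<in> sets borel"
      using C(1) by (intro sets.countable_UN') auto
    have dis: "disjoint_family_on X C"
      using C(3) by (auto simp: disjoint_family_on_def pairwise_def disjnt_def X_def)
    have "E - (\<Union>i\<in>C. X i) \<in> null_sets lebesgue"
      using C(4) by (simp add: X_def negligible_iff_null_sets)
    then have null: "E - (\<Union>i\<in>C. X i) \<in> null_sets lborel"
      using null_sets_completion_iff[of "E - (\<Union>i\<in>C. X i)" lborel] by simp
    \<comment> \<open>\<open>2 * l\<close> times the measure of \<open>E\<close> is at most the mass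
      of \<open>f\<close> on the disjoint balls; the small averages bound that mass by
      \<open>l\<close> times the measure of \<open>U\<close>, hence by \<open>l\<close> times that
      of \<open>E\<close> plus \<open>l * e\<close>. One copy cancels because \<open>E\<close> has
      finite measure.\<close>
    have "ennreal (2 * l) * emeasure lborel E = (\<integral>\<^sup>+y\<in>E. ennreal (2 * l) \<partial>lborel)"
      by (simp add: nn_integral_cmult_indicator)
    also have "\<dots> \<le> (\<integral>\<^sup>+y\<in>(\<Union>i\<in>C. X i). f y \<partial>lborel)"
    proof (rule nn_integral_mono_AE)
      from AE_not_in[OF null]
      show "AE x in lborel. ennreal (2 * l) * indicator E x \<le> f x * indicator (\<Union>i\<in>C. X i) x"
        by eventually_elim (use large in \<open>auto split: split_indicator\<close>)
    qed
    also have "\<dots> = emeasure ?\<nu> (\<Union>i\<in>C. X i)"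
      by (simp add: nu)
    also have "\<dots> = (\<integral>\<^sup>+i. emeasure ?\<nu> (X i) \<partial>count_space C)"
      using C(1) dis by (intro emeasure_UN_countable) auto
    also have "\<dots> \<le> (\<integral>\<^sup>+i. ennreal l * emeasure lborel (X i) \<partial>count_space C)"
    proof (intro nn_integral_mono)
      fix i assume "i \<in> space (count_space C)"
      then have "fst i \<in> E" using C(2) by (auto simp: Q_def)
      then show "emeasure ?\<nu> (X i) \<le> ennreal l * emeasure lborel (X i)"
        using small[of "fst i" "snd i"] \<open>0 < s\<close> \<open>0 < l\<close>
        by (simp add: nu X_def emeasure_lborel_ball ennreal_mult less_imp_le vol_pos)
    qed
    also have "\<dots> = ennreal l * (\<integral>\<^sup>+i. emeasure lborel (X i) \<partial>count_space C)"
      by (intro nn_integral_cmult) auto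
    also have "(\<integral>\<^sup>+i. emeasure lborel (X i) \<partial>count_space C) = emeasure lborel (\<Union>i\<in>C. X i)"
      using C(1) dis by (intro emeasure_UN_countable[symmetric]) auto
    also have "emeasure lborel (\<Union>i\<in>C. X i) \<le> emeasure lborel U"
    proof (intro emeasure_mono UN_least)
      show "X i \<subseteq> U" if "i \<in> C" for i
        using subsetD[OF C(2) that] by (auto simp: Q_def X_def case_prod_beta simp del: mem_ball)
    qed (use U(1) in auto)
    also have "emeasure lborel U = emeasure lborel E + emeasure lborel (U - E)"
      using U(1,2) by (subst plus_emeasure) (auto simp: Un_absorb1)
    also have "\<dots> \<le> emeasure lborel E + ennreal e"
      using U(3) by (intro add_left_mono) auto
    finally have *: "ennreal (2 * l) * emeasure lborel E \<le> ennreal l * (emeasure lborel E + ennreal e)"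
      by (simp add: mult_left_mono)
    obtain v where v: "emeasure lborel E = ennreal v" "0 \<le> v"
      using finE by (cases "emeasure lborel E") auto
    from * v \<open>0 < l\<close> \<open>0 < e\<close> show ?thesis
      by (simp add: distrib_left flip: ennreal_mult ennreal_plus)
  qed
  obtain v where v: "emeasure lborel E = ennreal v" "0 \<le> v"
    using finE by (cases "emeasure lborel E") auto
  have "v \<le> e" if "0 < e" for e
    using key[OF that] v \<open>0 < l\<close> that by (simp flip: ennreal_mult)
  then have "v = 0"
    using v(2) field_le_epsilon[of v 0] by simp
  with v E show ?thesis by (auto simp: null_sets_def)
qed

section \<open>The John--Nirenberg inequality in \<open>L\<^sup>4\<close>\<close>

text \<open>The constants \<open>c x r\<close> are not tied to averages of \<open>b\<close>, so that
  rescaling and truncating \<open>b\<close> and \<open>c\<close> together stays inside the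
  notion.\<close>

definition osc_bound :: "('a::euclidean_space \<Rightarrow> real) \<Rightarrow> ('a \<Rightarrow> real \<Rightarrow> real) \<Rightarrow> real \<Rightarrow> bool" where
  "osc_bound b c A \<longleftrightarrow> b \<in> borel_measurable borel \<and>
     (\<forall>x r. 0 < r \<longrightarrow> (\<integral>\<^sup>+y\<in>ball x r. ennreal \<bar>b y - c x r\<bar> \<partial>lborel) \<le> ennreal (A * vol TYPE('a) r))"

lemma osc_boundD:
  fixes b :: "'a::euclidean_space \<Rightarrow> real"
  assumes "osc_bound b c A"
  shows "b \<in> borel_measurable borel"
    and "0 < r \<Longrightarrow> (\<integral>\<^sup>+y\<in>ball x r. ennreal \<bar>b y - c x r\<bar> \<partial>lborel) \<le> ennreal (A * vol TYPE('a) r)"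
  using assms by (auto simp: osc_bound_def)

lemma pred_ball [measurable]: "Measurable.pred borel (\<lambda>y::'a::euclidean_space. y \<in> ball x r)"
  unfolding mem_ball by measurable

lemma ball_subset_ball_of_dist: "dist x z + r \<le> s \<Longrightarrow> ball x r \<subseteq> ball z s"
  for x z :: "'a::metric_space"
proof
  fix y assume "dist x z + r \<le> s" "y \<in> ball x r"
  then show "y \<in> ball z s"
    using dist_triangle[of z y x] by (simp add: dist_commute)
qed

lemma ball_const_diff_le:
  fixes b :: "'a::euclidean_space \<Rightarrow> real"
  assumes [measurable]: "b \<in> borel_measurable borel" and "0 < r" "0 \<le> P" "0 \<le> Q"
    and p: "(\<integral>\<^sup>+y\<in>ball x r. ennreal \<bar>b y - p\<bar> \<partial>lborel) \<le> ennreal (P * vol TYPE('a) r)"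
    and q: "(\<integral>\<^sup>+y\<in>ball x r. ennreal \<bar>b y - q\<bar> \<partial>lborel) \<le> ennreal (Q * vol TYPE('a) r)"
  shows "\<bar>p - q\<bar> \<le> P + Q"
proof -
  have v: "0 < vol TYPE('a) r" using \<open>0 < r\<close> by (rule vol_pos)
  have "ennreal (\<bar>p - q\<bar> * vol TYPE('a) r) = (\<integral>\<^sup>+y\<in>ball x r. ennreal \<bar>p - q\<bar> \<partial>lborel)"
    using \<open>0 < r\<close> by (simp add: nn_integral_ball_const)
  also have "\<dots> \<le> (\<integral>\<^sup>+y. ennreal \<bar>b y - p\<bar> * indicator (ball x r) y + ennreal \<bar>b y - q\<bar> * indicator (ball x r) y \<partial>lborel)"
    by (intro nn_integral_mono) (auto split: split_indicator simp flip: ennreal_plus)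
  also have "\<dots> = (\<integral>\<^sup>+y\<in>ball x r. ennreal \<bar>b y - p\<bar> \<partial>lborel) + (\<integral>\<^sup>+y\<in>ball x r. ennreal \<bar>b y - q\<bar> \<partial>lborel)"
    by (intro nn_integral_add; measurable)
  also have "\<dots> \<le> ennreal (P * vol TYPE('a) r) + ennreal (Q * vol TYPE('a) r)"
    using p q by (rule add_mono)
  also have "\<dots> = ennreal ((P + Q) * vol TYPE('a) r)"
    using v assms by (simp add: distrib_right flip: ennreal_plus)
  finally show ?thesis
    using v assms by (simp add: mult_le_cancel_right)
qed

lemma power4_add_le: "\<bar>x + y\<bar> ^ 4 \<le> 8 * \<bar>x\<bar> ^ 4 + 8 * \<bar>y\<bar> ^ 4" for x y :: real
proof -
  have "(x + y)\<^sup>2 \<le> 2 * (x\<^sup>2 + y\<^sup>2)"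
    using zero_le_power2[of "x - y"] by (simp add: power2_sum power2_diff)
  then have "((x + y)\<^sup>2)\<^sup>2 \<le> (2 * (x\<^sup>2 + y\<^sup>2))\<^sup>2"
    by (intro power_mono) auto
  also have "\<dots> \<le> 8 * (x\<^sup>2)\<^sup>2 + 8 * (y\<^sup>2)\<^sup>2"
    using zero_le_power2[of "x\<^sup>2 - y\<^sup>2"] by (simp add: power2_sum power2_diff power_mult_distrib)
  finally show ?thesis by simp
qed

lemma ball_power4_const_change:
  fixes b :: "'a::euclidean_space \<Rightarrow> real"
  assumes [measurable]: "b \<in> borel_measurable borel" and "0 < r" "0 \<le> Q"
    and q: "(\<integral>\<^sup>+y\<in>ball x r. ennreal (\<bar>b y - q\<bar> ^ 4) \<partial>lborel) \<le> ennreal (Q * vol TYPE('a) r)"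
    and d: "\<bar>p - q\<bar> \<le> d"
  shows "(\<integral>\<^sup>+y\<in>ball x r. ennreal (\<bar>b y - p\<bar> ^ 4) \<partial>lborel) \<le> ennreal ((8 * Q + 8 * d ^ 4) * vol TYPE('a) r)"
proof -
  have v: "0 < vol TYPE('a) r" using \<open>0 < r\<close> by (rule vol_pos)
  have d4: "\<bar>p - q\<bar> ^ 4 \<le> d ^ 4" using d by (intro power_mono) auto
  have pt: "\<bar>b y - p\<bar> ^ 4 \<le> 8 * \<bar>b y - q\<bar> ^ 4 + 8 * d ^ 4" for y
    using power4_add_le[of "b y - q" "q - p"] d4 by (simp add: abs_minus_commute)
  have "0 \<le> d" using d by linarith
  have "(\<integral>\<^sup>+y\<in>ball x r. ennreal (\<bar>b y - p\<bar> ^ 4) \<partial>lborel)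
      \<le> (\<integral>\<^sup>+y. ennreal 8 * (ennreal (\<bar>b y - q\<bar> ^ 4) * indicator (ball x r) y) + ennreal (8 * d ^ 4) * indicator (ball x r) y \<partial>lborel)"
  proof (intro nn_integral_mono)
    fix y
    have "ennreal (8 * \<bar>b y - q\<bar> ^ 4 + 8 * d ^ 4) = ennreal 8 * ennreal (\<bar>b y - q\<bar> ^ 4) + ennreal (8 * d ^ 4)"
      using \<open>0 \<le> d\<close> by (subst ennreal_plus) (auto simp: ennreal_mult)
    with ennreal_leI[OF pt[of y]]
    show "ennreal (\<bar>b y - p\<bar> ^ 4) * indicator (ball x r) y
        \<le> ennreal 8 * (ennreal (\<bar>b y - q\<bar> ^ 4) * indicator (ball x r) y) + ennreal (8 * d ^ 4) * indicator (ball x r) y"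
      by (simp split: split_indicator)
  qed
  also have "\<dots> = ennreal 8 * (\<integral>\<^sup>+y\<in>ball x r. ennreal (\<bar>b y - q\<bar> ^ 4) \<partial>lborel) + (\<integral>\<^sup>+y\<in>ball x r. ennreal (8 * d ^ 4) \<partial>lborel)"
    by (subst nn_integral_add) (auto simp: nn_integral_cmult)
  also have "\<dots> \<le> ennreal 8 * ennreal (Q * vol TYPE('a) r) + ennreal (8 * d ^ 4 * vol TYPE('a) r)"
    using q \<open>0 < r\<close> \<open>0 \<le> d\<close> by (intro add_mono mult_left_mono) (auto simp: nn_integral_ball_const)
  also have "\<dots> = ennreal ((8 * Q + 8 * d ^ 4) * vol TYPE('a) r)"
    unfolding distrib_right using v assms(3) \<open>0 \<le> d\<close>
    by (subst ennreal_plus) (auto simp: ennreal_mult mult.assoc)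
  finally show ?thesis .
qed

text \<open>A self-improvement: any finite bound \<open>M\<close> on the fourth moments improves to \<open>C0 + M / 2\<close>.
  Each point of \<open>ball z R\<close> at which some average of \<open>|b - e|\<close> exceeds the level \<open>l\<close> is given the largest
  such dyadic radius, and Vitali's lemma selects disjoint balls; \<open>M\<close> is used only on their
  enlargements, whose total volume is at most a multiple of \<open>1 / l\<close>.\<close>

lemma john_nirenberg_step:
  fixes b :: "'a::euclidean_space \<Rightarrow> real"
  defines "n \<equiv> DIM('a)"
  defines "l \<equiv> 128 * (80::real) ^ n"
  defines "\<tau> \<equiv> 1 + 2 ^ n * l"
  defines "C0 \<equiv> 8 * (16 * l ^ 4 + 8 * \<tau> ^ 4 * 80 ^ n / l) + 8 * (1 + 16 ^ n) ^ 4"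
  assumes osc: "osc_bound b c 1" and "0 \<le> M" "0 < R"
    and M: "\<And>x r. 0 < r \<Longrightarrow> (\<integral>\<^sup>+y\<in>ball x r. ennreal (\<bar>b y - c x r\<bar> ^ 4) \<partial>lborel) \<le> ennreal (M * vol TYPE('a) r)"
  shows "(\<integral>\<^sup>+y\<in>ball z R. ennreal (\<bar>b y - c z R\<bar> ^ 4) \<partial>lborel) \<le> ennreal ((C0 + M / 2) * vol TYPE('a) R)"
proof -
  note [measurable] = osc_boundD(1)[OF osc]
  \<comment> \<open>One common reference constant: candidate radii are at most \<open>8 * R\<close>
    and centres lie in \<open>ball z R\<close>, so every candidate ball sits in
    \<open>ball z (16 * R)\<close>.\<close>
  define e where "e = c z (16 * R)"
  define f where "f y = \<bar>b y - e\<bar>" for y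
  define V where "V = vol TYPE('a) R"
  have f0: "0 \<le> f y" for y by (simp add: f_def)
  have [measurable]: "f \<in> borel_measurable borel" unfolding f_def by measurable
  have V0: "0 < V" using \<open>0 < R\<close> by (simp add: V_def vol_pos)
  \<comment> \<open>In \<open>l\<close>, \<open>80 = 5 * 16\<close>: the Vitali enlargement costs
    \<open>5 ^ n\<close> and the comparison with \<open>ball z (16 * R)\<close> costs
    \<open>16 ^ n\<close>. The factor \<open>128 = 8 * 8 * 2\<close> absorbs two changes of
    constant, each costing 8, and leaves \<open>M / 2\<close>.\<close>
  have l: "0 < l" "16 ^ n \<le> l"
  proof -
    have "(16::real) ^ n \<le> 80 ^ n" by (intro power_mono) auto
    moreover have "(80::real) ^ n > 0" by simp
    ultimately show "0 < l" "16 ^ n \<le> l" unfolding l_def by linarith+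
  qed
  have \<tau>0: "0 \<le> \<tau>" using l by (simp add: \<tau>_def)
  have F16: "(\<integral>\<^sup>+y\<in>ball z (16 * R). ennreal (f y) \<partial>lborel) \<le> ennreal (16 ^ n * V)"
    using osc_boundD(2)[OF osc, of "16 * R" z] \<open>0 < R\<close> by (simp add: f_def e_def V_def vol_mult n_def)
  define av where "av x k \<longleftrightarrow> (\<integral>\<^sup>+y\<in>ball x (8 * R / 2 ^ k). ennreal (f y) \<partial>lborel) > ennreal (l * vol TYPE('a) (8 * R / 2 ^ k))" for x k
  define G where "G = {x \<in> ball z R. \<exists>k. av x k}"
  \<comment> \<open>At scales 0 to 3 the radius is at least \<open>R\<close>, so the volume is at
    least \<open>V\<close> while the mass is at most \<open>16 ^ n * V\<close>. Stopping thus
    happens only from scale 4 on, which leaves room to go back three scales.\<close>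
  have init: "\<not> av x k" if "x \<in> ball z R" "k \<le> 3" for x k
  proof -
    have k: "(2::real) ^ k \<le> 2 ^ 3" using that by (intro power_increasing) auto
    have "R \<le> 8 * R / 2 ^ k" using k \<open>0 < R\<close> by (simp add: field_simps)
    then have "V \<le> vol TYPE('a) (8 * R / 2 ^ k)"
      unfolding V_def using \<open>0 < R\<close> by (intro vol_mono) auto
    have "1 \<le> (2::real) ^ k" by simp
    then have "8 * R / 2 ^ k \<le> 8 * R" using \<open>0 < R\<close> by (simp add: field_simps)
    then have sub: "ball x (8 * R / 2 ^ k) \<subseteq> ball z (16 * R)"
      using that(1) \<open>0 < R\<close> by (intro ball_subset_ball_of_dist) (auto simp: dist_commute)
    have "(\<integral>\<^sup>+y\<in>ball x (8 * R / 2 ^ k). ennreal (f y) \<partial>lborel) \<le> (\<integral>\<^sup>+y\<in>ball z (16 * R). ennreal (f y) \<partial>lborel)"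
      using sub by (intro nn_integral_mono) (auto split: split_indicator)
    also have "\<dots> \<le> ennreal (16 ^ n * V)" by (rule F16)
    also have "\<dots> \<le> ennreal (l * vol TYPE('a) (8 * R / 2 ^ k))"
      using l V0 \<open>V \<le> _\<close> by (intro ennreal_leI mult_mono) auto
    finally show ?thesis by (simp add: av_def not_less)
  qed
  define \<kappa> where "\<kappa> x = (LEAST k. av x k)" for x
  define \<rho> where "\<rho> x = 8 * R / 2 ^ \<kappa> x" for x
  have avk: "av x (\<kappa> x)" if "x \<in> G" for x
    using that unfolding G_def \<kappa>_def by (auto intro: LeastI)
  have k4: "4 \<le> \<kappa> x" if "x \<in> G" for x
    using init[of x "\<kappa> x"] avk[OF that] that by (force simp: G_def)
  have \<rho>0: "0 < \<rho> x" for x using \<open>0 < R\<close> by (simp add: \<rho>_def)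
  have \<rho>1: "\<rho> x \<le> R" if "x \<in> G" for x
  proof -
    have "(2::real) ^ 4 \<le> 2 ^ \<kappa> x" using k4[OF that] by (intro power_increasing) auto
    then show ?thesis using \<open>0 < R\<close> by (simp add: \<rho>_def field_simps)
  qed
  \<comment> \<open>Three scales back multiplies the radius by 8, the first power of two above the
    Vitali factor 5. By minimality of \<open>\<kappa> x\<close> the average there is at most
    \<open>l\<close>.\<close>
  have stop: "(\<integral>\<^sup>+y\<in>ball x (8 * \<rho> x). ennreal (f y) \<partial>lborel) \<le> ennreal (l * vol TYPE('a) (8 * \<rho> x))"
    if "x \<in> G" for x
  proof -
    have "\<not> av x (\<kappa> x - 3)"
      using k4[OF that] not_less_Least[of "\<kappa> x - 3" "av x"] by (simp add: \<kappa>_def)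
    moreover have "8 * R / 2 ^ (\<kappa> x - 3) = 8 * \<rho> x"
      using k4[OF that] by (simp add: \<rho>_def power_diff)
    ultimately show ?thesis by (simp add: av_def not_less)
  qed
  obtain C where C: "countable C" "C \<subseteq> G"
    "pairwise (\<lambda>i j. disjnt (cball i (\<rho> i)) (cball j (\<rho> j))) C"
    "\<And>i. i \<in> G \<Longrightarrow> \<exists>j. j \<in> C \<and> \<not> disjnt (cball i (\<rho> i)) (cball j (\<rho> j)) \<and> cball i (\<rho> i) \<subseteq> ball j (5 * \<rho> j)"
    by (rule Vitali_covering_lemma_cballs_balls[of G \<rho> R "\<lambda>x. x"]) (use \<rho>0 \<rho>1 in auto)
  \<comment> \<open>The selected balls are disjoint, each carries more than \<open>l\<close> times
    its volume of the mass of \<open>f\<close>, and the total mass is at most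
    \<open>16 ^ n * V\<close>. This is the source of the gain \<open>1 / l\<close>.\<close>
  have sum_vol: "(\<integral>\<^sup>+i. ennreal (vol TYPE('a) (\<rho> i)) \<partial>count_space C) \<le> ennreal (16 ^ n * V / l)" (is "?S \<le> _")
  proof -
    let ?\<nu> = "density lborel (\<lambda>y. ennreal (f y))"
    have dis: "disjoint_family_on (\<lambda>i. ball i (\<rho> i)) C"
      unfolding disjoint_family_on_def
    proof (intro ballI impI)
      fix i j assume "i \<in> C" "j \<in> C" "i \<noteq> j"
      then have "disjnt (cball i (\<rho> i)) (cball j (\<rho> j))" using C(3) by (auto simp: pairwise_def)
      then show "ball i (\<rho> i) \<inter> ball j (\<rho> j) = {}"
        using ball_subset_cball unfolding disjnt_def by blast
    qed
    have U [measurable]: "(\<Union>i\<in>C. ball i (\<rho> i)) \<in> sets borel"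
      using C(1) by (intro sets.countable_UN') auto
    have sub: "(\<Union>i\<in>C. ball i (\<rho> i)) \<subseteq> ball z (16 * R)"
    proof (intro UN_least)
      fix i assume "i \<in> C"
      then have "i \<in> G" using C by auto
      then show "ball i (\<rho> i) \<subseteq> ball z (16 * R)"
        using \<rho>1[of i] \<open>0 < R\<close> by (intro ball_subset_ball_of_dist) (auto simp: G_def dist_commute)
    qed
    have "ennreal l * ?S = (\<integral>\<^sup>+i. ennreal l * ennreal (vol TYPE('a) (\<rho> i)) \<partial>count_space C)"
      by (intro nn_integral_cmult[symmetric]) auto
    also have "\<dots> \<le> (\<integral>\<^sup>+i. emeasure ?\<nu> (ball i (\<rho> i)) \<partial>count_space C)"
    proof (intro nn_integral_mono)
      fix i assume "i \<in> space (count_space C)"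
      then have "i \<in> G" using C by auto
      from avk[OF this] show "ennreal l * ennreal (vol TYPE('a) (\<rho> i)) \<le> emeasure ?\<nu> (ball i (\<rho> i))"
        using \<rho>0[of i] l by (simp add: emeasure_density av_def \<rho>_def[symmetric] ennreal_mult vol_pos less_imp_le)
    qed
    also have "\<dots> = emeasure ?\<nu> (\<Union>i\<in>C. ball i (\<rho> i))"
      using C(1) dis by (intro emeasure_UN_countable[symmetric]) auto
    also have "\<dots> \<le> emeasure ?\<nu> (ball z (16 * R))"
      using sub by (intro emeasure_mono) auto
    also have "\<dots> \<le> ennreal (16 ^ n * V)"
      using F16 by (simp add: emeasure_density)
    finally have *: "ennreal l * ?S \<le> ennreal (16 ^ n * V)" .
    then have "ennreal (1 / l) * (ennreal l * ?S) \<le> ennreal (1 / l) * ennreal (16 ^ n * V)"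
      by (rule mult_left_mono) auto
    moreover have "ennreal (1 / l) * (ennreal l * ?S) = ?S"
      using l by (simp add: mult.assoc[symmetric] flip: ennreal_mult)
    moreover have "ennreal (1 / l) * ennreal (16 ^ n * V) = ennreal (16 ^ n * V / l)"
      using l V0 by (simp flip: ennreal_mult)
    ultimately show ?thesis by simp
  qed
  \<comment> \<open>Exceptional points, where \<open>f\<close> is large although no dyadic average
    exceeds \<open>l\<close>. The factor 2 is the gap that the differentiation substitute
    requires.\<close>
  define E where "E = {x \<in> ball z R. 2 * l \<le> f x \<and> (\<forall>k. \<not> av x k)}"
  have E_null: "E \<in> null_sets lborel"
  proof (rule null_set_of_small_averages[where f = "\<lambda>y. ennreal (f y)" and s = "8 * R" and l = l])
    have [measurable]: "(\<lambda>x. \<integral>\<^sup>+y\<in>ball x (8 * R / 2 ^ k). ennreal (f y) \<partial>lborel) \<in> borel_measurable borel" for k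
      by (rule measurable_ball_integral) auto
    show "E \<in> sets borel"
      unfolding E_def av_def mem_ball by measurable
    show "bounded E" by (rule bounded_subset[OF bounded_ball[of z R]]) (auto simp: E_def)
  qed (use \<open>0 < R\<close> l in \<open>auto simp: E_def av_def not_less intro: ennreal_leI\<close>)
  let ?\<mu> = "density lborel (\<lambda>y. ennreal (f y ^ 4))"
  define U where "U = (\<Union>i\<in>C. ball i (5 * \<rho> i))"
  have U [measurable]: "U \<in> sets borel"
    unfolding U_def using C(1) by (intro sets.countable_UN') auto
  have GU: "G \<subseteq> U"
  proof
    fix x assume "x \<in> G"
    then obtain j where "j \<in> C" "cball x (\<rho> x) \<subseteq> ball j (5 * \<rho> j)" using C(4) by blast
    moreover have "x \<in> cball x (\<rho> x)" using \<rho>0[of x] by (simp add: less_imp_le)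
    ultimately show "x \<in> U" unfolding U_def by blast
  qed
  \<comment> \<open>\<open>M\<close> applies with the constant \<open>c i (5 * \<rho> i)\<close>;
    changing it to \<open>e\<close> costs \<open>\<tau>\<close>. The gap between the two constants
    is controlled by \<open>stop\<close> on the ball of radius \<open>8 * \<rho> i\<close>, whose
    volume is at most \<open>2 ^ n\<close> times that of
    \<open>ball i (5 * \<rho> i)\<close>.\<close>
  have piece: "emeasure ?\<mu> (ball i (5 * \<rho> i)) \<le> ennreal ((8 * M + 8 * \<tau> ^ 4) * 5 ^ n) * ennreal (vol TYPE('a) (\<rho> i))"
    if "i \<in> G" for i
  proof -
    have r5: "0 < 5 * \<rho> i" using \<rho>0[of i] by simp
    have "(\<integral>\<^sup>+y\<in>ball i (5 * \<rho> i). ennreal \<bar>b y - e\<bar> \<partial>lborel) \<le> (\<integral>\<^sup>+y\<in>ball i (8 * \<rho> i). ennreal (f y) \<partial>lborel)"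
      unfolding f_def using \<rho>0[of i] by (intro nn_integral_mono) (auto split: split_indicator)
    also have "\<dots> \<le> ennreal (l * vol TYPE('a) (8 * \<rho> i))" by (rule stop) fact
    also have "\<dots> \<le> ennreal (2 ^ n * l * vol TYPE('a) (5 * \<rho> i))"
    proof -
      have "vol TYPE('a) (8 * \<rho> i) \<le> vol TYPE('a) (2 * (5 * \<rho> i))"
        using \<rho>0[of i] by (intro vol_mono) auto
      also have "\<dots> = 2 ^ n * vol TYPE('a) (5 * \<rho> i)" by (simp only: vol_mult n_def)
      finally show ?thesis using l by (intro ennreal_leI) (simp add: mult.assoc mult.left_commute)
    qed
    finally have "\<bar>c i (5 * \<rho> i) - e\<bar> \<le> 1 + 2 ^ n * l"
      using r5 l osc_boundD(2)[OF osc r5, of i] by (intro ball_const_diff_le) auto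
    then have "\<bar>e - c i (5 * \<rho> i)\<bar> \<le> \<tau>" by (simp add: \<tau>_def abs_minus_commute)
    from ball_power4_const_change[OF _ r5 \<open>0 \<le> M\<close> M[OF r5] this]
    show ?thesis
      using \<rho>0[of i] \<open>0 \<le> M\<close> \<tau>0
      by (simp add: emeasure_density f_def vol_mult n_def vol_pos less_imp_le mult.assoc flip: ennreal_mult)
  qed
  have "(\<integral>\<^sup>+y\<in>ball z R. ennreal (f y ^ 4) \<partial>lborel)
      \<le> (\<integral>\<^sup>+y. ennreal (16 * l ^ 4) * indicator (ball z R) y + ennreal (f y ^ 4) * indicator U y \<partial>lborel)"
  proof (rule nn_integral_mono_AE)
    from AE_not_in[OF E_null]
    show "AE y in lborel. ennreal (f y ^ 4) * indicator (ball z R) y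
        \<le> ennreal (16 * l ^ 4) * indicator (ball z R) y + ennreal (f y ^ 4) * indicator U y"
    proof eventually_elim
      case (elim y)
      have "f y ^ 4 \<le> 16 * l ^ 4" if "y \<in> ball z R" "y \<notin> U"
      proof -
        have "y \<notin> G" using that GU by auto
        then have "f y \<le> 2 * l" using elim that by (auto simp: E_def G_def)
        then have "f y ^ 4 \<le> (2 * l) ^ 4" using f0 by (intro power_mono) auto
        then show ?thesis by (simp add: power_mult_distrib)
      qed
      then show ?case by (auto split: split_indicator intro: ennreal_leI)
    qed
  qed
  also have "\<dots> = (\<integral>\<^sup>+y\<in>ball z R. ennreal (16 * l ^ 4) \<partial>lborel) + emeasure ?\<mu> U"
    by (subst nn_integral_add) (auto simp: emeasure_density)
  also have "(\<integral>\<^sup>+y\<in>ball z R. ennreal (16 * l ^ 4) \<partial>lborel) = ennreal (16 * l ^ 4 * V)"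
    using \<open>0 < R\<close> by (simp add: nn_integral_ball_const V_def)
  also have "emeasure ?\<mu> U \<le> (\<integral>\<^sup>+i. emeasure ?\<mu> (ball i (5 * \<rho> i)) \<partial>count_space C)"
    unfolding U_def using C(1) by (intro emeasure_UN_le_count_space) auto
  also have "\<dots> \<le> (\<integral>\<^sup>+i. ennreal ((8 * M + 8 * \<tau> ^ 4) * 5 ^ n) * ennreal (vol TYPE('a) (\<rho> i)) \<partial>count_space C)"
    using piece C(2) by (intro nn_integral_mono) auto
  also have "\<dots> = ennreal ((8 * M + 8 * \<tau> ^ 4) * 5 ^ n) * (\<integral>\<^sup>+i. ennreal (vol TYPE('a) (\<rho> i)) \<partial>count_space C)"
    by (intro nn_integral_cmult) auto
  also have "\<dots> \<le> ennreal ((8 * M + 8 * \<tau> ^ 4) * 5 ^ n) * ennreal (16 ^ n * V / l)"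
    by (intro mult_left_mono sum_vol) auto
  also have "ennreal (16 * l ^ 4 * V) + ennreal ((8 * M + 8 * \<tau> ^ 4) * 5 ^ n) * ennreal (16 ^ n * V / l)
      = ennreal ((16 * l ^ 4 + (8 * M + 8 * \<tau> ^ 4) * 80 ^ n / l) * V)"
  proof -
    have "(5::real) ^ n * 16 ^ n = 80 ^ n" by (simp flip: power_mult_distrib)
    then have "(8 * M + 8 * \<tau> ^ 4) * 5 ^ n * (16 ^ n * V / l) = (8 * M + 8 * \<tau> ^ 4) * 80 ^ n / l * V"
      by (simp add: field_simps)
    then show ?thesis
      using l V0 \<open>0 \<le> M\<close> \<tau>0 by (simp add: distrib_right flip: ennreal_mult ennreal_plus)
  qed
  finally have main: "(\<integral>\<^sup>+y\<in>ball z R. ennreal (\<bar>b y - e\<bar> ^ 4) \<partial>lborel)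
      \<le> ennreal ((16 * l ^ 4 + (8 * M + 8 * \<tau> ^ 4) * 80 ^ n / l) * vol TYPE('a) R)"
    by (simp add: f_def V_def add_left_mono)
  \<comment> \<open>Return from \<open>e\<close> to the constant of \<open>ball z R\<close>. The two
    differ by at most \<open>1 + 16 ^ n\<close>, which gives the last summand of \<open>C0\<close>
    and the second factor 8.\<close>
  have "(\<integral>\<^sup>+y\<in>ball z R. ennreal \<bar>b y - e\<bar> \<partial>lborel) \<le> (\<integral>\<^sup>+y\<in>ball z (16 * R). ennreal (f y) \<partial>lborel)"
    unfolding f_def using \<open>0 < R\<close> by (intro nn_integral_mono) (auto split: split_indicator)
  also note F16
  finally have "\<bar>c z R - e\<bar> \<le> 1 + 16 ^ n"
    using \<open>0 < R\<close> osc_boundD(2)[OF osc \<open>0 < R\<close>, of z] by (intro ball_const_diff_le) (auto simp: V_def)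
  note ball_power4_const_change[OF _ \<open>0 < R\<close> _ main this]
  moreover have "8 * (16 * l ^ 4 + (8 * M + 8 * \<tau> ^ 4) * 80 ^ n / l) + 8 * (1 + 16 ^ n) ^ 4 = C0 + M / 2"
  proof -
    have "80 ^ n / l = 1 / 128" by (simp add: l_def)
    then have "(8 * M + 8 * \<tau> ^ 4) * 80 ^ n / l = M / 16 + 8 * \<tau> ^ 4 * 80 ^ n / l"
      by (simp add: distrib_right add_divide_distrib)
    then show ?thesis unfolding C0_def by simp
  qed
  ultimately show ?thesis using l \<tau>0 \<open>0 \<le> M\<close> by simp
qed

text \<open>Boundedness makes the trivial value \<open>(2 * N) ^ 4\<close> an admissible
  \<open>M\<close>. Each round of self-improvement halves the excess over \<open>2 * C0\<close>, the
  fixed point of \<open>C0 + M / 2\<close>, so in the limit \<open>N\<close> disappears from the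
  bound.\<close>

lemma john_nirenberg_bounded:
  obtains C :: real where "0 \<le> C"
    "\<And>(b::'a::euclidean_space \<Rightarrow> real) c N x r. osc_bound b c 1 \<Longrightarrow> (\<And>x. \<bar>b x\<bar> \<le> N) \<Longrightarrow>
        (\<And>x r. \<bar>c x r\<bar> \<le> N) \<Longrightarrow> 0 < r \<Longrightarrow>
        (\<integral>\<^sup>+y\<in>ball x r. ennreal (\<bar>b y - c x r\<bar> ^ 4) \<partial>lborel) \<le> ennreal (C * vol TYPE('a) r)"
proof -
  define l where "l = 128 * (80::real) ^ DIM('a)"
  define C0 where "C0 = 8 * (16 * l ^ 4 + 8 * (1 + 2 ^ DIM('a) * l) ^ 4 * 80 ^ DIM('a) / l) + 8 * (1 + 16 ^ DIM('a)) ^ 4"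
  have "0 < l" by (simp add: l_def)
  then have C0: "0 \<le> C0" by (simp add: C0_def)
  have step: "(\<integral>\<^sup>+y\<in>ball z R. ennreal (\<bar>b y - c z R\<bar> ^ 4) \<partial>lborel) \<le> ennreal ((C0 + M / 2) * vol TYPE('a) R)"
    if "osc_bound b c 1" "0 \<le> M" "0 < R"
      "\<And>x r. 0 < r \<Longrightarrow> (\<integral>\<^sup>+y\<in>ball x r. ennreal (\<bar>b y - c x r\<bar> ^ 4) \<partial>lborel) \<le> ennreal (M * vol TYPE('a) r)"
    for b :: "'a \<Rightarrow> real" and c M R z
    unfolding C0_def l_def by (rule john_nirenberg_step[of b c M R z]) (rule that; assumption?)+
  show thesis
  proof (rule that[of "2 * C0"])
    fix b :: "'a \<Rightarrow> real" and c :: "'a \<Rightarrow> real \<Rightarrow> real" and N :: real and x :: 'a and r :: real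
    assume osc: "osc_bound b c 1" and bN: "\<And>x. \<bar>b x\<bar> \<le> N" and cN: "\<And>x r. \<bar>c x r\<bar> \<le> N" and r: "0 < r"
    have "0 \<le> N" using bN[of x] by simp
    have iter: "(\<integral>\<^sup>+y\<in>ball x r. ennreal (\<bar>b y - c x r\<bar> ^ 4) \<partial>lborel)
        \<le> ennreal ((2 * C0 + (2 * N) ^ 4 / 2 ^ k) * vol TYPE('a) r)" if "0 < r" for k x r
      using that
    proof (induction k arbitrary: x r)
      case 0
      have "\<bar>b y - c x r\<bar> ^ 4 \<le> (2 * N) ^ 4" for y
        using bN[of y] cN[of x r] by (intro power_mono) auto
      then have "(\<integral>\<^sup>+y\<in>ball x r. ennreal (\<bar>b y - c x r\<bar> ^ 4) \<partial>lborel) \<le> (\<integral>\<^sup>+y\<in>ball x r. ennreal ((2 * N) ^ 4) \<partial>lborel)"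
        by (intro nn_integral_mono) (auto split: split_indicator intro: ennreal_leI)
      also have "\<dots> = ennreal ((2 * N) ^ 4 * vol TYPE('a) r)"
        using 0 by (intro nn_integral_ball_const) auto
      also have "\<dots> \<le> ennreal ((2 * C0 + (2 * N) ^ 4 / 2 ^ 0) * vol TYPE('a) r)"
        using C0 vol_pos[OF 0, where 'a='a] by (intro ennreal_leI mult_right_mono) auto
      finally show ?case .
    next
      case (Suc k)
      have nonneg: "0 \<le> 2 * C0 + (2 * N) ^ 4 / 2 ^ k" using C0 by simp
      have "(\<integral>\<^sup>+y\<in>ball x r. ennreal (\<bar>b y - c x r\<bar> ^ 4) \<partial>lborel)
          \<le> ennreal ((C0 + (2 * C0 + (2 * N) ^ 4 / 2 ^ k) / 2) * vol TYPE('a) r)"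
        by (rule step[of b c _ r x, OF osc nonneg Suc.prems Suc.IH])
      also have "C0 + (2 * C0 + (2 * N) ^ 4 / 2 ^ k) / 2 = 2 * C0 + (2 * N) ^ 4 / 2 ^ Suc k"
        by (simp add: add_divide_distrib)
      finally show ?case .
    qed
    have "(\<lambda>k. ennreal ((2 * C0 + (2 * N) ^ 4 / 2 ^ k) * vol TYPE('a) r)) \<longlonglongrightarrow> ennreal ((2 * C0 + 0) * vol TYPE('a) r)"
    proof (intro tendsto_intros)
      have "(\<lambda>k. (2 * N) ^ 4 * (1 / 2) ^ k) \<longlonglongrightarrow> (2 * N) ^ 4 * 0"
        by (intro tendsto_mult tendsto_const LIMSEQ_power_zero) auto
      then show "(\<lambda>k. (2 * N) ^ 4 / 2 ^ k) \<longlonglongrightarrow> 0" by (simp add: power_divide)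
    qed
    then have "(\<integral>\<^sup>+y\<in>ball x r. ennreal (\<bar>b y - c x r\<bar> ^ 4) \<partial>lborel) \<le> ennreal ((2 * C0 + 0) * vol TYPE('a) r)"
      by (rule LIMSEQ_le_const) (use iter[OF r, of x] in blast)
    then show "(\<integral>\<^sup>+y\<in>ball x r. ennreal (\<bar>b y - c x r\<bar> ^ 4) \<partial>lborel) \<le> ennreal (2 * C0 * vol TYPE('a) r)"
      by simp
  qed (use C0 in simp)
qed

lemma osc_bound_mult:
  fixes b :: "'a::euclidean_space \<Rightarrow> real"
  assumes "osc_bound b c A" "0 \<le> s"
  shows "osc_bound (\<lambda>y. s * b y) (\<lambda>x r. s * c x r) (s * A)"
  unfolding osc_bound_def
proof (intro conjI allI impI)
  note [measurable] = osc_boundD(1)[OF assms(1)]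
  show "(\<lambda>y. s * b y) \<in> borel_measurable borel" by measurable
  fix x :: 'a and r :: real assume r: "0 < r"
  have "(\<integral>\<^sup>+y\<in>ball x r. ennreal \<bar>s * b y - s * c x r\<bar> \<partial>lborel) = (\<integral>\<^sup>+y. ennreal s * (ennreal \<bar>b y - c x r\<bar> * indicator (ball x r) y) \<partial>lborel)"
    using assms(2)
    by (intro nn_integral_cong) (auto simp: abs_mult ennreal_mult right_diff_distrib[symmetric] mult.assoc)
  also have "\<dots> = ennreal s * (\<integral>\<^sup>+y\<in>ball x r. ennreal \<bar>b y - c x r\<bar> \<partial>lborel)"
    by (intro nn_integral_cmult) auto
  also have "\<dots> \<le> ennreal s * ennreal (A * vol TYPE('a) r)"
    using osc_boundD(2)[OF assms(1) r] by (intro mult_left_mono) auto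
  also have "\<dots> = ennreal (s * A * vol TYPE('a) r)"
    using assms(2) by (simp add: ennreal_mult' mult.assoc)
  finally show "(\<integral>\<^sup>+y\<in>ball x r. ennreal \<bar>s * b y - s * c x r\<bar> \<partial>lborel) \<le> ennreal (s * A * vol TYPE('a) r)" .
qed

text \<open>Clamping to the interval from \<open>-k\<close> to \<open>k\<close> is 1-Lipschitz, so
  applied to the function and its constants alike it preserves \<open>osc_bound\<close>. The bounded
  case is uniform in \<open>k\<close>, and Fatou's lemma removes the clamp.\<close>

lemma john_nirenberg:
  obtains C :: real where "0 \<le> C"
    "\<And>(b::'a::euclidean_space \<Rightarrow> real) c A x r. osc_bound b c A \<Longrightarrow> 0 < A \<Longrightarrow> 0 < r \<Longrightarrow>
        (\<integral>\<^sup>+y\<in>ball x r. ennreal ((\<bar>b y - c x r\<bar> / A) ^ 4) \<partial>lborel) \<le> ennreal (C * vol TYPE('a) r)"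
proof -
  obtain C :: real where C: "0 \<le> C"
    "\<And>(b::'a \<Rightarrow> real) c N x r. osc_bound b c 1 \<Longrightarrow> (\<And>x. \<bar>b x\<bar> \<le> N) \<Longrightarrow>
        (\<And>x r. \<bar>c x r\<bar> \<le> N) \<Longrightarrow> 0 < r \<Longrightarrow>
        (\<integral>\<^sup>+y\<in>ball x r. ennreal (\<bar>b y - c x r\<bar> ^ 4) \<partial>lborel) \<le> ennreal (C * vol TYPE('a) r)"
    using john_nirenberg_bounded[where 'a='a] by blast
  show thesis
  proof (rule that[OF C(1)])
    fix b :: "'a \<Rightarrow> real" and c :: "'a \<Rightarrow> real \<Rightarrow> real" and A :: real and x :: 'a and r :: real
    assume osc: "osc_bound b c A" and A: "0 < A" and r: "0 < r"
    define b' where "b' y = b y / A" for y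
    define c' where "c' x r = c x r / A" for x r
    have "b' = (\<lambda>y. 1 / A * b y)" "c' = (\<lambda>x r. 1 / A * c x r)" "1 / A * A = 1"
      using A by (auto simp: b'_def c'_def fun_eq_iff)
    then have osc': "osc_bound b' c' 1"
      using osc_bound_mult[OF osc, of "1 / A"] A by (metis divide_nonneg_pos zero_le_one)
    note [measurable] = osc_boundD(1)[OF osc']
    define tr where "tr k s = max (- real k) (min (real k) s)" for k :: nat and s :: real
    have tr1: "\<bar>tr k s - tr k t\<bar> \<le> \<bar>s - t\<bar>" for k s t
      by (simp add: tr_def)
    have tr_bd: "\<bar>tr k s\<bar> \<le> real k" for k s
      by (simp add: tr_def)
    have tr_meas [measurable]: "tr k \<in> borel_measurable borel" for k
      unfolding tr_def by measurable
    have osck: "osc_bound (\<lambda>y. tr k (b' y)) (\<lambda>x r. tr k (c' x r)) 1" for k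
      unfolding osc_bound_def
    proof (intro conjI allI impI)
      fix x :: 'a and r :: real assume r: "0 < r"
      have "(\<integral>\<^sup>+y\<in>ball x r. ennreal \<bar>tr k (b' y) - tr k (c' x r)\<bar> \<partial>lborel) \<le> (\<integral>\<^sup>+y\<in>ball x r. ennreal \<bar>b' y - c' x r\<bar> \<partial>lborel)"
        using tr1 by (intro nn_integral_mono) (auto split: split_indicator intro!: ennreal_leI)
      also have "\<dots> \<le> ennreal (1 * vol TYPE('a) r)"
        by (rule osc_boundD(2)[OF osc' r])
      finally show "(\<integral>\<^sup>+y\<in>ball x r. ennreal \<bar>tr k (b' y) - tr k (c' x r)\<bar> \<partial>lborel) \<le> ennreal (1 * vol TYPE('a) r)" .
    qed measurable
    have lim: "(\<lambda>k. ennreal (\<bar>tr k s - tr k t\<bar> ^ 4)) \<longlonglongrightarrow> ennreal (\<bar>s - t\<bar> ^ 4)" for s t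
    proof (rule tendsto_eventually)
      have "\<forall>\<^sub>F k in sequentially. real k \<ge> max \<bar>s\<bar> \<bar>t\<bar>"
        using filterlim_real_sequentially by (simp only: filterlim_at_top)
      then show "\<forall>\<^sub>F k in sequentially. ennreal (\<bar>tr k s - tr k t\<bar> ^ 4) = ennreal (\<bar>s - t\<bar> ^ 4)"
      proof eventually_elim
        case (elim k)
        then have "tr k s = s" "tr k t = t" by (auto simp: tr_def)
        then show ?case by simp
      qed
    qed
    have "(\<integral>\<^sup>+y\<in>ball x r. ennreal ((\<bar>b y - c x r\<bar> / A) ^ 4) \<partial>lborel) = (\<integral>\<^sup>+y\<in>ball x r. ennreal (\<bar>b' y - c' x r\<bar> ^ 4) \<partial>lborel)"
      using A by (simp add: b'_def c'_def diff_divide_distrib[symmetric])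
    also have "\<dots> = (\<integral>\<^sup>+y. liminf (\<lambda>k. ennreal (\<bar>tr k (b' y) - tr k (c' x r)\<bar> ^ 4) * indicator (ball x r) y) \<partial>lborel)"
    proof (intro nn_integral_cong)
      fix y
      have "(\<lambda>k. ennreal (\<bar>tr k (b' y) - tr k (c' x r)\<bar> ^ 4) * indicator (ball x r) y) \<longlonglongrightarrow> ennreal (\<bar>b' y - c' x r\<bar> ^ 4) * indicator (ball x r) y"
        using lim[of "b' y" "c' x r"] by (auto split: split_indicator)
      from lim_imp_Liminf[OF sequentially_bot this]
      show "ennreal (\<bar>b' y - c' x r\<bar> ^ 4) * indicator (ball x r) y = liminf (\<lambda>k. ennreal (\<bar>tr k (b' y) - tr k (c' x r)\<bar> ^ 4) * indicator (ball x r) y)"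
        by simp
    qed
    also have "\<dots> \<le> liminf (\<lambda>k. \<integral>\<^sup>+y\<in>ball x r. ennreal (\<bar>tr k (b' y) - tr k (c' x r)\<bar> ^ 4) \<partial>lborel)"
      by (intro nn_integral_liminf) measurable
    also have "\<dots> \<le> liminf (\<lambda>k::nat. ennreal (C * vol TYPE('a) r))"
      using C(2)[OF osck tr_bd tr_bd r, of _ x] by (intro Liminf_mono always_eventually allI) auto
    also have "\<dots> = ennreal (C * vol TYPE('a) r)"
      by (simp add: Liminf_const)
    finally show "(\<integral>\<^sup>+y\<in>ball x r. ennreal ((\<bar>b y - c x r\<bar> / A) ^ 4) \<partial>lborel) \<le> ennreal (C * vol TYPE('a) r)" .
  qed
qed

section \<open>Smooth bumps on boxes\<close>

text \<open>The iterated derivatives of \<open>flat 0\<close>, which is \<open>exp (-1/t)\<close> for \<open>t > 0\<close>, are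
  linear combinations of the functions \<open>flat m\<close>.\<close>

definition flat :: "nat \<Rightarrow> real \<Rightarrow> real" where
  "flat m t = (if 0 < t then exp (- 1 / t) / t ^ m else 0)"

text \<open>This is \<open>(1 + x / k) ^ k \<le> exp x\<close> at \<open>x = 1 / t\<close> with
  \<open>k = m + 2\<close>: two powers of \<open>t\<close> survive division by \<open>t ^ m\<close>,
  enough for the difference quotient at 0 to vanish in the limit.\<close>

lemma flat_le_square: "\<bar>flat m t\<bar> \<le> real (m + 2) ^ (m + 2) * t\<^sup>2"
proof (cases "0 < t")
  case True
  define k where "k = m + 2"
  have k: "0 < k" by (simp add: k_def)
  have "(1 / t / k) ^ k \<le> (1 + 1 / t / k) ^ k"
    using True by (intro power_mono) auto
  also have "\<dots> \<le> exp (1 / t)"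
    using True k by (intro exp_ge_one_plus_x_over_n_power_n) (auto intro: order_trans[of _ 0])
  finally have "exp (- 1 / t) \<le> (k * t) ^ k"
    using True k by (simp add: exp_minus field_simps)
  then have "exp (- 1 / t) / t ^ m \<le> (k * t) ^ k / t ^ m"
    using True by (intro divide_right_mono) auto
  also have "\<dots> = real k ^ k * t\<^sup>2"
    using True by (simp add: power_mult_distrib k_def power_add power2_eq_square)
  finally show ?thesis using True by (simp add: flat_def k_def)
qed (simp add: flat_def)

lemma flat_has_real_derivative:
  "(flat m has_real_derivative flat (m + 2) t - real m * flat (m + 1) t) (at t)"
proof -
  consider "0 < t" | "t < 0" | "t = 0" by linarith
  then show ?thesis
  proof cases
    case 1
    have "((\<lambda>t. exp (- 1 / t) / t ^ m) has_real_derivative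
        (exp (- 1 / t) * (1 / t\<^sup>2) * t ^ m - exp (- 1 / t) * (real m * t ^ (m - 1))) / (t ^ m * t ^ m)) (at t)"
      using 1 by (auto intro!: derivative_eq_intros simp: power2_eq_square)
    moreover have "(exp (- 1 / t) * (1 / t\<^sup>2) * t ^ m - exp (- 1 / t) * (real m * t ^ (m - 1))) / (t ^ m * t ^ m)
        = flat (m + 2) t - real m * flat (m + 1) t"
      using 1 by (cases m) (auto simp: flat_def field_simps power2_eq_square)
    ultimately have "((\<lambda>t. exp (- 1 / t) / t ^ m) has_real_derivative flat (m + 2) t - real m * flat (m + 1) t) (at t)"
      by simp
    then show ?thesis
      by (rule has_field_derivative_transform_within_open[where S = "{0<..}"]) (use 1 in \<open>auto simp: flat_def\<close>)
  next
    case 2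
    have "((\<lambda>t. 0) has_real_derivative 0) (at t)" by simp
    then have "(flat m has_real_derivative 0) (at t)"
      by (rule has_field_derivative_transform_within_open[where S = "{..<0}"]) (use 2 in \<open>auto simp: flat_def\<close>)
    then show ?thesis using 2 by (simp add: flat_def)
  next
    case 3
    have "((\<lambda>h. flat m h / h) \<longlongrightarrow> 0) (at 0)"
    proof (rule Lim_null_comparison)
      show "\<forall>\<^sub>F h in at 0. norm (flat m h / h) \<le> real (m + 2) ^ (m + 2) * \<bar>h\<bar>"
        unfolding eventually_at_filter
      proof (intro always_eventually allI impI)
        fix h :: real assume "h \<noteq> 0"
        then have "\<bar>flat m h\<bar> / \<bar>h\<bar> \<le> real (m + 2) ^ (m + 2) * h\<^sup>2 / \<bar>h\<bar>"
          by (intro divide_right_mono flat_le_square) auto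
        also have "\<dots> = real (m + 2) ^ (m + 2) * \<bar>h\<bar>"
          using \<open>h \<noteq> 0\<close> by (simp add: power2_eq_square field_simps flip: abs_mult)
        finally show "norm (flat m h / h) \<le> real (m + 2) ^ (m + 2) * \<bar>h\<bar>" by simp
      qed
      show "((\<lambda>h::real. real (m + 2) ^ (m + 2) * \<bar>h\<bar>) \<longlongrightarrow> 0) (at 0)"
        by (auto intro!: tendsto_eq_intros)
    qed
    then have "(flat m has_real_derivative 0) (at 0)"
      by (simp add: DERIV_def flat_def)
    then show ?thesis using 3 by (simp add: flat_def)
  qed
qed

text \<open>Smoothness quantifies over all iterated partial derivatives. A class that contains the
  bumps and is closed under first partial derivatives reduces this to a single
  differentiation.\<close>

inductive_set flat_algebra :: "('a::euclidean_space \<Rightarrow> real) set" where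
  const: "(\<lambda>x. c) \<in> flat_algebra"
| flat: "(\<lambda>x. flat m (u \<bullet> x + c)) \<in> flat_algebra"
| add: "f \<in> flat_algebra \<Longrightarrow> g \<in> flat_algebra \<Longrightarrow> (\<lambda>x. f x + g x) \<in> flat_algebra"
| mult: "f \<in> flat_algebra \<Longrightarrow> g \<in> flat_algebra \<Longrightarrow> (\<lambda>x. f x * g x) \<in> flat_algebra"

lemma flat_algebra_derivative:
  assumes "f \<in> flat_algebra"
  shows "\<exists>f'. (\<forall>x. (f has_derivative f' x) (at x)) \<and> (\<forall>i. (\<lambda>x. f' x i) \<in> flat_algebra)"
  using assms
proof induction
  case (const c)
  show ?case by (intro exI[of _ "\<lambda>x i. 0"]) (auto intro: flat_algebra.const)
next
  case (flat m u c)
  let ?f' = "\<lambda>x i. (flat (m + 2) (u \<bullet> x + c) + (- real m) * flat (m + 1) (u \<bullet> x + c)) * (u \<bullet> i)"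
  have "((\<lambda>x. flat m (u \<bullet> x + c)) has_derivative ?f' x) (at x)" for x
  proof -
    have 1: "((\<lambda>x. u \<bullet> x + c) has_derivative (\<lambda>i. u \<bullet> i)) (at x)"
      by (auto intro!: derivative_eq_intros)
    have 2: "(flat m has_derivative (\<lambda>h. (flat (m + 2) (u \<bullet> x + c) - real m * flat (m + 1) (u \<bullet> x + c)) * h)) (at (u \<bullet> x + c))"
      using flat_has_real_derivative[of m "u \<bullet> x + c"] by (simp add: has_field_derivative_def)
    from has_derivative_compose[OF 1 2] show ?thesis by (simp add: mult.commute)
  qed
  then show ?case
    by (intro exI[of _ ?f'] conjI allI flat_algebra.mult flat_algebra.add flat_algebra.flat flat_algebra.const)
next
  case (add f g)
  then obtain f' g' where d: "\<And>x. (f has_derivative f' x) (at x)" "\<And>i. (\<lambda>x. f' x i) \<in> flat_algebra"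
    "\<And>x. (g has_derivative g' x) (at x)" "\<And>i. (\<lambda>x. g' x i) \<in> flat_algebra" by blast
  show ?case
    by (intro exI[of _ "\<lambda>x i. f' x i + g' x i"] conjI allI has_derivative_add flat_algebra.add d)
next
  case (mult f g)
  then obtain f' g' where d: "\<And>x. (f has_derivative f' x) (at x)" "\<And>i. (\<lambda>x. f' x i) \<in> flat_algebra"
    "\<And>x. (g has_derivative g' x) (at x)" "\<And>i. (\<lambda>x. g' x i) \<in> flat_algebra" by blast
  show ?case
    by (intro exI[of _ "\<lambda>x i. f x * g' x i + f' x i * g x"] conjI allI has_derivative_mult
        flat_algebra.add flat_algebra.mult d mult.hyps)
qed

lemma flat_algebra_smooth:
  assumes "f \<in> flat_algebra"
  shows "smooth_fun f"
proof -
  have "g \<in> flat_algebra" if "g \<in> partial_derivs f" for g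
    using that
  proof induction
    case base
    show ?case by fact
  next
    case (step g i)
    from flat_algebra_derivative[OF step.IH] obtain g' where
      g': "\<And>x. (g has_derivative g' x) (at x)" "\<And>i. (\<lambda>x. g' x i) \<in> flat_algebra" by blast
    from g'(1) have "frechet_derivative g (at x) = g' x" for x
      by (rule frechet_derivative_at[symmetric])
    with g'(2)[of i] show ?case by simp
  qed
  then show ?thesis
    unfolding smooth_fun_def differentiable_def using flat_algebra_derivative by blast
qed

text \<open>The parameter \<open>k\<close> sharpens the bump: \<open>exp (- 1 / (k * s))\<close>
  tends to 1 for every \<open>s > 0\<close>, so the bumps converge pointwise to the indicator of the
  open box while staying between 0 and 1.\<close>

definition box_bump :: "'a::euclidean_space \<Rightarrow> 'a \<Rightarrow> nat \<Rightarrow> 'a \<Rightarrow> real" where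
  "box_bump a b k x = (\<Prod>i\<in>Basis. flat 0 (real k * (x \<bullet> i - a \<bullet> i)) * flat 0 (real k * (b \<bullet> i - x \<bullet> i)))"

lemma box_bump_smooth: "smooth_fun (box_bump a b k)"
proof (rule flat_algebra_smooth)
  have 1: "(\<lambda>x. flat 0 (real k * (x \<bullet> i - a \<bullet> i)) * flat 0 (real k * (b \<bullet> i - x \<bullet> i))) \<in> flat_algebra" for i
  proof -
    have "(\<lambda>x. flat 0 ((real k *\<^sub>R i) \<bullet> x + (- real k * (a \<bullet> i))) * flat 0 ((- real k *\<^sub>R i) \<bullet> x + real k * (b \<bullet> i))) \<in> flat_algebra"
      by (intro flat_algebra.intros)
    then show ?thesis by (simp add: algebra_simps inner_commute)
  qed
  have "(\<lambda>x. \<Prod>i\<in>I. flat 0 (real k * (x \<bullet> i - a \<bullet> i)) * flat 0 (real k * (b \<bullet> i - x \<bullet> i))) \<in> flat_algebra"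
    if "finite I" for I
    using that
  proof induction
    case empty
    then show ?case by (simp add: flat_algebra.const)
  next
    case (insert i I)
    then show ?case using flat_algebra.mult[OF 1 insert.IH] by simp
  qed
  then show "box_bump a b k \<in> flat_algebra"
    unfolding box_bump_def[abs_def] by simp
qed

lemma flat_0_bounds: "0 \<le> flat 0 t" "flat 0 t \<le> 1"
  by (auto simp: flat_def)

lemma box_bump_bounds: "0 \<le> box_bump a b k x" "box_bump a b k x \<le> 1"
  unfolding box_bump_def using flat_0_bounds
  by (auto intro!: prod_nonneg prod_le_1 mult_le_one mult_nonneg_nonneg)

lemma box_bump_outside: "x \<notin> box a b \<Longrightarrow> box_bump a b k x = 0"
proof -
  assume "x \<notin> box a b"
  then obtain i where i: "i \<in> Basis" "x \<bullet> i \<le> a \<bullet> i \<or> b \<bullet> i \<le> x \<bullet> i"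
    by (auto simp: mem_box not_less)
  then have "flat 0 (real k * (x \<bullet> i - a \<bullet> i)) * flat 0 (real k * (b \<bullet> i - x \<bullet> i)) = 0"
    by (auto simp: flat_def zero_less_mult_iff)
  with i(1) show ?thesis unfolding box_bump_def by (intro prod_zero) auto
qed

lemma box_bump_fsupp: "fsupp (box_bump a b k) \<subseteq> cbox a b"
  unfolding fsupp_def
  by (rule closure_minimal) (use box_bump_outside[of _ a b k] box_subset_cbox[of a b] in \<open>auto simp: \<close>)

lemma box_bump_Cc_inf: "box_bump a b k \<in> Cc_inf"
proof -
  have "compact (fsupp (box_bump a b k))"
    by (metis box_bump_fsupp closed_closure compact_cbox closed_Int_compact fsupp_def inf.absorb1)
  then show ?thesis by (simp add: Cc_inf_def box_bump_smooth)
qed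

lemma box_bump_tendsto: "(\<lambda>k. box_bump a b k x) \<longlonglongrightarrow> indicator (box a b) x"
proof (cases "x \<in> box a b")
  case True
  have lim: "(\<lambda>k. flat 0 (real k * s)) \<longlonglongrightarrow> 1" if "0 < s" for s
  proof -
    have "(\<lambda>k. exp (- (inverse (real k) / s))) \<longlonglongrightarrow> exp (- (0 / s))"
      by (intro tendsto_intros lim_inverse_n) (use that in auto)
    moreover have "\<forall>\<^sub>F k in sequentially. exp (- (inverse (real k) / s)) = flat 0 (real k * s)"
      using eventually_gt_at_top[of 0]
      by eventually_elim (use that in \<open>simp add: flat_def field_simps\<close>)
    ultimately show ?thesis by (simp add: tendsto_cong)
  qed
  have "(\<lambda>k. box_bump a b k x) \<longlonglongrightarrow> (\<Prod>i\<in>(Basis::'a set). 1 * 1)"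
    unfolding box_bump_def by (intro tendsto_prod tendsto_mult lim) (use True in \<open>auto simp: mem_box\<close>)
  then show ?thesis using True by simp
qed (simp add: box_bump_outside)

section \<open>The kernel representation on \<open>L\<^sup>p\<close>\<close>

lemma Lp_iff:
  "f \<in> Lp p \<longleftrightarrow> f \<in> borel_measurable borel \<and> (\<integral>\<^sup>+x. ennreal (\<bar>f x\<bar> powr p) \<partial>lborel) < \<infinity>"
proof -
  have "integrable lborel (\<lambda>x. \<bar>f x\<bar> powr p) \<longleftrightarrow> (\<integral>\<^sup>+x. ennreal (\<bar>f x\<bar> powr p) \<partial>lborel) < \<infinity>"
    if [measurable]: "f \<in> borel_measurable borel"
    by (simp add: integrable_iff_bounded)
  then show ?thesis by (auto simp: Lp_def)
qed

lemma Lp_measurable: "f \<in> Lp p \<Longrightarrow> f \<in> borel_measurable borel"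
  by (simp add: Lp_iff)

lemma Lp_mono:
  assumes "g \<in> Lp p" "f \<in> borel_measurable borel" "\<And>x. \<bar>f x\<bar> \<le> \<bar>g x\<bar>" "0 \<le> p"
  shows "f \<in> Lp p"
proof -
  have "(\<integral>\<^sup>+x. ennreal (\<bar>f x\<bar> powr p) \<partial>lborel) \<le> (\<integral>\<^sup>+x. ennreal (\<bar>g x\<bar> powr p) \<partial>lborel)"
    using assms by (intro nn_integral_mono ennreal_leI powr_mono2) auto
  then show ?thesis using assms by (auto simp: Lp_iff)
qed

lemma powr_add_le: "\<bar>s + t\<bar> powr p \<le> 2 powr p * (\<bar>s\<bar> powr p + \<bar>t\<bar> powr p)" if "0 \<le> p" for s t :: real
proof -
  have "\<bar>s + t\<bar> powr p \<le> (2 * max \<bar>s\<bar> \<bar>t\<bar>) powr p"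
    using that by (intro powr_mono2) auto
  also have "\<dots> = 2 powr p * max \<bar>s\<bar> \<bar>t\<bar> powr p" by (simp add: powr_mult)
  also have "\<dots> \<le> 2 powr p * (\<bar>s\<bar> powr p + \<bar>t\<bar> powr p)"
    by (intro mult_left_mono) (auto simp: max_def)
  finally show ?thesis .
qed

lemma Lp_add:
  assumes "f \<in> Lp p" "g \<in> Lp p" "0 \<le> p"
  shows "(\<lambda>x. f x + g x) \<in> Lp p"
proof -
  note [measurable] = Lp_measurable[OF assms(1)] Lp_measurable[OF assms(2)]
  have "(\<integral>\<^sup>+x. ennreal (\<bar>f x + g x\<bar> powr p) \<partial>lborel)
      \<le> (\<integral>\<^sup>+x. ennreal (2 powr p) * (ennreal (\<bar>f x\<bar> powr p) + ennreal (\<bar>g x\<bar> powr p)) \<partial>lborel)"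
    using powr_add_le[OF assms(3)]
    by (intro nn_integral_mono) (simp add: ennreal_leI flip: ennreal_mult ennreal_plus)
  also have "\<dots> = ennreal (2 powr p) * ((\<integral>\<^sup>+x. ennreal (\<bar>f x\<bar> powr p) \<partial>lborel) + (\<integral>\<^sup>+x. ennreal (\<bar>g x\<bar> powr p) \<partial>lborel))"
    by (simp add: nn_integral_cmult nn_integral_add)
  also have "\<dots> < \<infinity>"
    using assms by (auto simp: Lp_iff ennreal_mult_less_top)
  finally show ?thesis by (simp add: Lp_iff)
qed

lemma Lp_cmult:
  assumes "f \<in> Lp p"
  shows "(\<lambda>x. c * f x) \<in> Lp p"
proof -
  note [measurable] = Lp_measurable[OF assms(1)]
  have "(\<integral>\<^sup>+x. ennreal (\<bar>c * f x\<bar> powr p) \<partial>lborel) = (\<integral>\<^sup>+x. ennreal (\<bar>c\<bar> powr p) * ennreal (\<bar>f x\<bar> powr p) \<partial>lborel)"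
    by (simp add: abs_mult powr_mult ennreal_mult)
  also have "\<dots> = ennreal (\<bar>c\<bar> powr p) * (\<integral>\<^sup>+x. ennreal (\<bar>f x\<bar> powr p) \<partial>lborel)"
    by (intro nn_integral_cmult) simp
  also have "\<dots> < \<infinity>"
    using assms by (auto simp: Lp_iff ennreal_mult_less_top)
  finally show ?thesis by (simp add: Lp_iff)
qed

lemma Lp_indicator:
  assumes "A \<in> sets borel" "bounded A"
  shows "indicator A \<in> Lp p"
proof -
  have "(\<integral>\<^sup>+x. ennreal (\<bar>indicator A x\<bar> powr p) \<partial>lborel) = (\<integral>\<^sup>+x. indicator A x \<partial>lborel)"
    by (intro nn_integral_cong) (auto split: split_indicator)
  also have "\<dots> < \<infinity>"
    using assms emeasure_bounded_finite[of A] by simp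
  finally show ?thesis using assms by (simp add: Lp_iff)
qed

lemma Lp_bounded_support_integrable:
  assumes f: "f \<in> Lp p" and p: "1 \<le> p" and Q: "Q \<in> sets borel" "bounded Q" "\<And>x. x \<notin> Q \<Longrightarrow> f x = 0"
  shows "integrable lborel f"
proof -
  note [measurable] = Lp_measurable[OF f] Q(1)
  have "\<bar>t\<bar> \<le> 1 + \<bar>t\<bar> powr p" for t :: real
  proof (cases "\<bar>t\<bar> \<le> 1")
    case False
    then have "\<bar>t\<bar> powr 1 \<le> \<bar>t\<bar> powr p" using p by (intro powr_mono) auto
    then show ?thesis using False by simp
  qed (simp add: add_increasing2)
  then have "(\<integral>\<^sup>+x. ennreal (norm (f x)) \<partial>lborel) \<le> (\<integral>\<^sup>+x. indicator Q x + ennreal (\<bar>f x\<bar> powr p) \<partial>lborel)"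
    using Q(3) by (intro nn_integral_mono) (force split: split_indicator intro!: ennreal_leI simp flip: ennreal_plus ennreal_1)
  also have "\<dots> = (\<integral>\<^sup>+x. indicator Q x \<partial>lborel) + (\<integral>\<^sup>+x. ennreal (\<bar>f x\<bar> powr p) \<partial>lborel)"
    by (intro nn_integral_add) auto
  also have "\<dots> < \<infinity>"
    using f emeasure_bounded_finite[OF Q(2)] by (simp add: Lp_iff)
  finally show ?thesis by (intro integrableI_bounded) auto
qed

section \<open>Extension of the kernel formula by linearity and dominated limits\<close>

locale kernel_operator =
  fixes T :: "('a::euclidean_space \<Rightarrow> real) \<Rightarrow> 'a \<Rightarrow> real" and K :: "'a \<Rightarrow> 'a \<Rightarrow> real" and p D C0 :: real
  assumes p: "1 < p"
    and T_Lp: "f \<in> Lp p \<Longrightarrow> T f \<in> Lp p"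
    and T_bound: "f \<in> Lp p \<Longrightarrow>
      (\<integral>\<^sup>+x. ennreal (\<bar>T f x\<bar> powr p) \<partial>lborel) \<le> ennreal D * (\<integral>\<^sup>+x. ennreal (\<bar>f x\<bar> powr p) \<partial>lborel)"
    and T_linear: "f \<in> Lp p \<Longrightarrow> g \<in> Lp p \<Longrightarrow> AE x in lborel. T (\<lambda>y. c * f y + g y) x = c * T f x + T g x"
    and K_measurable: "(\<lambda>(x, y). K x y) \<in> borel_measurable (lborel \<Otimes>\<^sub>M lborel)"
    and C0: "0 \<le> C0"
    and K_size: "x \<noteq> y \<Longrightarrow> \<bar>K x y\<bar> \<le> C0 * dist x y powr (- real DIM('a))"
    and T_smooth: "f \<in> Cc_inf \<Longrightarrow> x \<notin> fsupp f \<Longrightarrow> T f x = (\<integral>y. K x y * f y \<partial>lborel)"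
begin

lemma K_section_measurable [measurable]: "K x \<in> borel_measurable borel"
  using measurable_compose[OF measurable_Pair1' K_measurable, of x] by simp

end

text \<open>On \<open>F\<close> the kernel is bounded as its second variable runs through the box.
  The kernel integral therefore converges absolutely for every \<open>L^p\<close> function supported
  there, and it passes to dominated limits.\<close>

locale kernel_operator_far = kernel_operator T K p D C0
  for T :: "('a::euclidean_space \<Rightarrow> real) \<Rightarrow> 'a \<Rightarrow> real" and K :: "'a \<Rightarrow> 'a \<Rightarrow> real" and p D C0 :: real +
  fixes q1 q2 :: 'a and F :: "'a set" and d :: real
  assumes d: "0 < d" and far: "x \<in> F \<Longrightarrow> y \<in> cbox q1 q2 \<Longrightarrow> d \<le> dist x y"
begin

text \<open>The identity is demanded only almost everywhere, since linearity of \<open>T\<close> and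
  limits in \<open>L^p\<close> determine \<open>T f\<close> only up to null sets.\<close>

definition represented :: "('a \<Rightarrow> real) \<Rightarrow> bool" where
  "represented f \<longleftrightarrow> f \<in> Lp p \<and> (\<forall>x. x \<notin> cbox q1 q2 \<longrightarrow> f x = 0) \<and>
     (AE x in lborel. x \<in> F \<longrightarrow> T f x = (\<integral>y. K x y * f y \<partial>lborel))"

lemma K_bound_far:
  assumes "x \<in> F" "y \<in> cbox q1 q2"
  shows "\<bar>K x y\<bar> \<le> C0 * d powr (- real DIM('a))"
proof -
  have "d \<le> dist x y" using far assms by blast
  then have "x \<noteq> y" using d by auto
  then have "\<bar>K x y\<bar> \<le> C0 * dist x y powr (- real DIM('a))" by (rule K_size)
  also have "\<dots> \<le> C0 * d powr (- real DIM('a))"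
    using \<open>d \<le> dist x y\<close> d C0 by (intro mult_left_mono powr_mono2') auto
  finally show ?thesis .
qed

lemma integrable_support: "f \<in> Lp p \<Longrightarrow> \<forall>x. x \<notin> cbox q1 q2 \<longrightarrow> f x = 0 \<Longrightarrow> integrable lborel f"
  using p by (intro Lp_bounded_support_integrable[of f p "cbox q1 q2"]) auto

lemma integrable_K:
  assumes "f \<in> Lp p" "\<forall>x. x \<notin> cbox q1 q2 \<longrightarrow> f x = 0" "x \<in> F"
  shows "integrable lborel (\<lambda>y. K x y * f y)"
proof (rule Bochner_Integration.integrable_bound)
  note [measurable] = Lp_measurable[OF assms(1)]
  show "integrable lborel (\<lambda>y. (C0 * d powr (- real DIM('a))) * f y)"
    using integrable_support[OF assms(1,2)] by simp
  show "AE y in lborel. norm (K x y * f y) \<le> norm (C0 * d powr (- real DIM('a)) * f y)"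
  proof (intro AE_I2)
    fix y
    show "norm (K x y * f y) \<le> norm (C0 * d powr (- real DIM('a)) * f y)"
      using K_bound_far[OF assms(3), of y] assms(2) C0
      by (cases "y \<in> cbox q1 q2") (auto simp: abs_mult intro: mult_right_mono)
  qed
  show "(\<lambda>y. K x y * f y) \<in> borel_measurable lborel" by measurable
qed

lemma represented_lincomb:
  assumes "represented f" "represented g"
  shows "represented (\<lambda>x. c * f x + g x)"
proof -
  have f: "f \<in> Lp p" "\<forall>x. x \<notin> cbox q1 q2 \<longrightarrow> f x = 0"
    "AE x in lborel. x \<in> F \<longrightarrow> T f x = (\<integral>y. K x y * f y \<partial>lborel)"
    and g: "g \<in> Lp p" "\<forall>x. x \<notin> cbox q1 q2 \<longrightarrow> g x = 0"
    "AE x in lborel. x \<in> F \<longrightarrow> T g x = (\<integral>y. K x y * g y \<partial>lborel)"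
    using assms by (auto simp: represented_def)
  have "AE x in lborel. x \<in> F \<longrightarrow> T (\<lambda>x. c * f x + g x) x = (\<integral>y. K x y * (c * f y + g y) \<partial>lborel)"
    using T_linear[OF f(1) g(1), of c] f(3) g(3)
  proof eventually_elim
    case (elim x)
    show ?case
    proof
      assume x: "x \<in> F"
      have "(\<integral>y. K x y * (c * f y + g y) \<partial>lborel) = (\<integral>y. c * (K x y * f y) + K x y * g y \<partial>lborel)"
        by (intro Bochner_Integration.integral_cong) (auto simp: algebra_simps)
      also have "\<dots> = c * (\<integral>y. K x y * f y \<partial>lborel) + (\<integral>y. K x y * g y \<partial>lborel)"
        using integrable_K[OF f(1,2) x] integrable_K[OF g(1,2) x] by simp
      finally show "T (\<lambda>x. c * f x + g x) x = (\<integral>y. K x y * (c * f y + g y) \<partial>lborel)"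
        using elim x by simp
    qed
  qed
  then show ?thesis
    using f g p by (auto simp: represented_def intro!: Lp_add Lp_cmult)
qed

text \<open>Fatou's lemma for the \<open>p\<close>-th powers of \<open>T (f k) - T h\<close> replaces the passage to an almost
  everywhere convergent subsequence.\<close>

lemma represented_limit:
  assumes fk: "\<And>k. represented (f k)" and lim: "\<And>x. (\<lambda>k. f k x) \<longlonglongrightarrow> h x"
    and dom: "\<And>k x. \<bar>f k x\<bar> \<le> g x" and g: "g \<in> Lp p" "\<forall>x. x \<notin> cbox q1 q2 \<longrightarrow> g x = 0"
  shows "represented h"
proof -
  have fL: "f k \<in> Lp p" and f0: "\<forall>x. x \<notin> cbox q1 q2 \<longrightarrow> f k x = 0" for k
    using fk by (auto simp: represented_def)
  note [measurable] = Lp_measurable[OF fL] Lp_measurable[OF g(1)]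
  have g0: "0 \<le> g x" for x using dom[of 0 x] by linarith
  have h [measurable]: "h \<in> borel_measurable borel"
    by (rule borel_measurable_LIMSEQ_metric[OF _ lim]) simp
  have hg: "\<bar>h x\<bar> \<le> g x" for x
    by (rule LIMSEQ_le_const2[OF tendsto_rabs[OF lim[of x]]]) (use dom in auto)
  have hL: "h \<in> Lp p"
    by (rule Lp_mono[OF g(1)]) (use hg g0 p in auto)
  have h0: "\<forall>x. x \<notin> cbox q1 q2 \<longrightarrow> h x = 0"
    using hg g(2) by (metis abs_le_zero_iff)
  \<comment> \<open>Linearity comes only in the combined shape \<open>c * f + g\<close>. Negation is
    obtained by taking \<open>g\<close> to be the zero function, and \<open>T\<close> of that
    function vanishes almost everywhere because it equals twice itself.\<close>
  have "AE x in lborel. T (f k) x - T h x = T (\<lambda>y. 1 * f k y + (- 1) * h y) x" for k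
  proof -
    have "(\<lambda>y. (- 1) * h y) \<in> Lp p" by (rule Lp_cmult[OF hL])
    note l1 = T_linear[OF fL[of k] this, of 1]
    have "(\<lambda>y. 0 * h y) \<in> Lp p" by (rule Lp_cmult[OF hL])
    note l2 = T_linear[OF hL this, of "- 1"] and l3 = T_linear[OF this this, of 1]
    from l1 l2 l3 show ?thesis by eventually_elim simp
  qed
  then have diff: "(\<integral>\<^sup>+x. ennreal (\<bar>T (f k) x - T h x\<bar> powr p) \<partial>lborel)
      \<le> ennreal D * (\<integral>\<^sup>+x. ennreal (\<bar>f k x - h x\<bar> powr p) \<partial>lborel)" for k
  proof -
    have L: "(\<lambda>y. 1 * f k y + (- 1) * h y) \<in> Lp p"
      using Lp_add[OF fL[of k] Lp_cmult[OF hL, of "- 1"]] p by simp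
    have "(\<integral>\<^sup>+x. ennreal (\<bar>T (f k) x - T h x\<bar> powr p) \<partial>lborel)
        = (\<integral>\<^sup>+x. ennreal (\<bar>T (\<lambda>y. 1 * f k y + (- 1) * h y) x\<bar> powr p) \<partial>lborel)"
      by (rule nn_integral_cong_AE) (use \<open>AE x in lborel. T (f k) x - T h x = _ x\<close> in \<open>eventually_elim, simp\<close>)
    also note T_bound[OF L]
    finally show ?thesis by simp
  qed
  have "(\<lambda>k. \<integral>\<^sup>+x. ennreal (\<bar>f k x - h x\<bar> powr p) \<partial>lborel) \<longlonglongrightarrow> (\<integral>\<^sup>+x. 0 \<partial>(lborel :: 'a measure))"
  proof (rule nn_integral_dominated_convergence)
    show "AE x in lborel. ennreal (\<bar>f k x - h x\<bar> powr p) \<le> ennreal ((2 * g x) powr p)" for k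
    proof (intro AE_I2 ennreal_leI powr_mono2)
      show "\<bar>f k x - h x\<bar> \<le> 2 * g x" for x
        using dom[of k x] hg[of x] by linarith
    qed (use p in auto)
    show "(\<integral>\<^sup>+x. ennreal ((2 * g x) powr p) \<partial>lborel) < \<infinity>"
      using Lp_cmult[OF g(1), of 2] g0 by (simp add: Lp_iff abs_mult)
    show "AE x in lborel. (\<lambda>k. ennreal (\<bar>f k x - h x\<bar> powr p)) \<longlonglongrightarrow> 0"
    proof (intro AE_I2)
      fix x
      have "(\<lambda>k. \<bar>f k x - h x\<bar> powr p) \<longlonglongrightarrow> \<bar>h x - h x\<bar> powr p"
        using lim[of x] p by (intro tendsto_intros tendsto_powr') auto
      then show "(\<lambda>k. ennreal (\<bar>f k x - h x\<bar> powr p)) \<longlonglongrightarrow> 0"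
        using tendsto_ennrealI by fastforce
    qed
  qed auto
  then have "(\<lambda>k. ennreal D * (\<integral>\<^sup>+x. ennreal (\<bar>f k x - h x\<bar> powr p) \<partial>lborel)) \<longlonglongrightarrow> ennreal D * 0"
    by (intro ennreal_tendsto_cmult) auto
  then have up: "(\<lambda>k. ennreal D * (\<integral>\<^sup>+x. ennreal (\<bar>f k x - h x\<bar> powr p) \<partial>lborel)) \<longlonglongrightarrow> 0"
    by simp
  have "(\<lambda>k. \<integral>\<^sup>+x. ennreal (\<bar>T (f k) x - T h x\<bar> powr p) \<partial>lborel) \<longlonglongrightarrow> 0"
  proof (rule tendsto_sandwich[OF _ _ tendsto_const up])
    show "\<forall>\<^sub>F k in sequentially. (\<integral>\<^sup>+x. ennreal (\<bar>T (f k) x - T h x\<bar> powr p) \<partial>lborel)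
        \<le> ennreal D * (\<integral>\<^sup>+x. ennreal (\<bar>f k x - h x\<bar> powr p) \<partial>lborel)"
      by (intro always_eventually allI diff)
  qed simp
  \<comment> \<open>The \<open>p\<close>-th power integrals tend to 0, so by Fatou the pointwise
    liminf of \<open>\<bar>T (f k) x - T h x\<bar> powr p\<close> is 0 for almost every
    \<open>x\<close>.\<close>
  then have "liminf (\<lambda>k. \<integral>\<^sup>+x. ennreal (\<bar>T (f k) x - T h x\<bar> powr p) \<partial>lborel) = 0"
    by (rule lim_imp_Liminf[OF sequentially_bot])
  moreover have [measurable]: "T (f k) \<in> borel_measurable borel" "T h \<in> borel_measurable borel" for k
    using T_Lp[OF fL] T_Lp[OF hL] by (auto simp: Lp_iff)
  ultimately have "(\<integral>\<^sup>+x. liminf (\<lambda>k. ennreal (\<bar>T (f k) x - T h x\<bar> powr p)) \<partial>lborel) = 0"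
    using nn_integral_liminf[of "\<lambda>k x. ennreal (\<bar>T (f k) x - T h x\<bar> powr p)" lborel] by simp
  then have "AE x in lborel. liminf (\<lambda>k. ennreal (\<bar>T (f k) x - T h x\<bar> powr p)) = 0"
    by (subst (asm) nn_integral_0_iff_AE) auto
  moreover have "AE x in lborel. \<forall>k. x \<in> F \<longrightarrow> T (f k) x = (\<integral>y. K x y * f k y \<partial>lborel)"
    unfolding AE_all_countable using fk by (auto simp: represented_def)
  ultimately have "AE x in lborel. x \<in> F \<longrightarrow> T h x = (\<integral>y. K x y * h y \<partial>lborel)"
  proof eventually_elim
    case (elim x)
    show ?case
    proof
      assume x: "x \<in> F"
      have "(\<lambda>k. \<integral>y. K x y * f k y \<partial>lborel) \<longlonglongrightarrow> (\<integral>y. K x y * h y \<partial>lborel)"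
      proof (rule integral_dominated_convergence[where w = "\<lambda>y. \<bar>K x y * g y\<bar>"])
        show "AE y in lborel. (\<lambda>k. K x y * f k y) \<longlonglongrightarrow> K x y * h y"
          by (intro AE_I2 tendsto_intros lim)
        show "AE y in lborel. norm (K x y * f k y) \<le> \<bar>K x y * g y\<bar>" for k
          using dom[of k] g0 by (intro AE_I2) (auto simp: abs_mult intro: mult_left_mono)
      qed (use integrable_K[OF g x] in auto)
      then have "(\<lambda>k. T (f k) x) \<longlonglongrightarrow> (\<integral>y. K x y * h y \<partial>lborel)"
        using elim(2) x by simp
      \<comment> \<open>At a fixed \<open>x\<close> in \<open>F\<close> this sequence converges, by
        dominated convergence under the kernel integral. Its limit equals its liminf, which is 0,
        and this identifies \<open>T h x\<close>.\<close>
      then have "(\<lambda>k. \<bar>T (f k) x - T h x\<bar> powr p) \<longlonglongrightarrow> \<bar>(\<integral>y. K x y * h y \<partial>lborel) - T h x\<bar> powr p"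
        using p by (intro tendsto_intros tendsto_powr') auto
      from lim_imp_Liminf[OF sequentially_bot tendsto_ennrealI[OF this]] elim(1)
      show "T h x = (\<integral>y. K x y * h y \<partial>lborel)" by simp
    qed
  qed
  then show ?thesis using hL h0 by (simp add: represented_def)
qed

text \<open>The only place where the formula for smooth functions enters: the bumps are dominated by
  the indicator of their box, and points of \<open>F\<close> lie off their supports.\<close>

lemma represented_box:
  assumes "box a b \<subseteq> cbox q1 q2"
  shows "represented (indicator (box a b))"
proof (rule represented_limit)
  show "represented (box_bump a b k)" for k
    unfolding represented_def
  proof (intro conjI allI impI AE_I2)
    have "continuous_on UNIV (box_bump a b k)"
      using box_bump_smooth[of a b k] partial_derivs.base[of "box_bump a b k"]
      by (auto simp: smooth_fun_def intro!: continuous_at_imp_continuous_on differentiable_imp_continuous_within)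
    then have "box_bump a b k \<in> borel_measurable borel" by (rule borel_measurable_continuous_onI)
    then show "box_bump a b k \<in> Lp p"
      using box_bump_bounds[of a b k] box_bump_outside[of _ a b k] p
      by (intro Lp_mono[OF Lp_indicator[of "box a b"]]) (auto split: split_indicator)
    show "box_bump a b k x = 0" if "x \<notin> cbox q1 q2" for x
      using that assms box_bump_outside by blast
    fix x assume "x \<in> F"
    then have "x \<notin> cbox q1 q2" using far[of x x] d by auto
    moreover have "fsupp (box_bump a b k) \<subseteq> cbox q1 q2"
      unfolding fsupp_def
    proof (rule closure_minimal)
      show "{x. box_bump a b k x \<noteq> 0} \<subseteq> cbox q1 q2" using assms box_bump_outside by blast
    qed (rule closed_cbox)
    ultimately show "T (box_bump a b k) x = (\<integral>y. K x y * box_bump a b k y \<partial>lborel)"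
      by (intro T_smooth box_bump_Cc_inf) auto
  qed
  show "\<bar>box_bump a b k x\<bar> \<le> indicator (box a b) x" for k x
    using box_bump_bounds[of a b k x] box_bump_outside[of x a b k] by (auto split: split_indicator)
  show "\<forall>x. x \<notin> cbox q1 q2 \<longrightarrow> indicator (box a b) x = (0::real)"
    using assms by (auto split: split_indicator)
qed (use box_bump_tendsto Lp_indicator[of "box a b"] in auto)

text \<open>Dynkin's argument: open boxes form an intersection-stable generator of the Borel sets,
  complements are handled by linear combinations and disjoint unions by dominated limits. Cutting
  with \<open>box q1 q2\<close> keeps the supports bounded.\<close>

lemma represented_indicator:
  assumes "A \<in> sets borel"
  shows "represented (indicator (A \<inter> box q1 q2))"
proof -
  have Q: "represented (indicator (box q1 q2))"
    using box_subset_cbox by (intro represented_box)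
  have zero: "represented (\<lambda>x. 0)"
    using represented_lincomb[OF Q Q, of "- 1"] by simp
  have A: "A \<in> sigma_sets UNIV (range (\<lambda>(a, b). box a b))"
    using assms unfolding borel_eq_box by simp
  have stable: "Int_stable (range (\<lambda>(a, b). box a b :: 'a set))"
  proof (rule Int_stableI)
    fix A B :: "'a set" assume "A \<in> range (\<lambda>(a, b). box a b)" "B \<in> range (\<lambda>(a, b). box a b)"
    then obtain a b c e where "A = box a b" "B = box c e" by auto
    then show "A \<inter> B \<in> range (\<lambda>(a, b). box a b)"
      by (auto simp: box_Int_box)
  qed
  have sub: "range (\<lambda>(a, b). box a b) \<subseteq> Pow (UNIV :: 'a set)" by simp
  from stable sub A show ?thesis
  proof (induction rule: sigma_sets_induct_disjoint)
    fix B assume "B \<in> range (\<lambda>(a, b). box a b :: 'a set)"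
    then obtain a b where "B = box a b" by auto
    then obtain a' b' where B: "B \<inter> box q1 q2 = box a' b'" using box_Int_box by blast
    then show "represented (indicator (B \<inter> box q1 q2))"
      unfolding B using box_subset_cbox[of q1 q2] by (intro represented_box) (use B in blast)
  next
    show "represented (indicator ({} \<inter> box q1 q2))"
      using zero by (simp add: indicator_def[abs_def])
  next
    fix B assume "represented (indicator (B \<inter> box q1 q2))"
    from represented_lincomb[OF this Q, of "- 1"]
    have "represented (\<lambda>x. - 1 * indicator (B \<inter> box q1 q2) x + indicator (box q1 q2) x)" .
    also have "(\<lambda>x. - 1 * indicator (B \<inter> box q1 q2) x + indicator (box q1 q2) x) = (indicator ((UNIV - B) \<inter> box q1 q2) :: 'a \<Rightarrow> real)"
      by (auto split: split_indicator)
    finally show "represented (indicator ((UNIV - B) \<inter> box q1 q2))" .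
  next
    fix B :: "nat \<Rightarrow> 'a set"
    assume B: "disjoint_family B" "range B \<subseteq> sigma_sets UNIV (range (\<lambda>(a, b). box a b))"
      and IH: "\<And>i. represented (indicator (B i \<inter> box q1 q2))"
    have ind: "indicator ((\<Union>i<k. B i) \<inter> box q1 q2) x = (\<Sum>i<k. indicator (B i \<inter> box q1 q2) x :: real)" for k x
    proof -
      have "disjoint_family_on (\<lambda>i. B i \<inter> box q1 q2) {..<k}"
        using B(1) by (auto simp: disjoint_family_on_def)
      from indicator_UN_disjoint[OF _ this, of x] show ?thesis
        by (simp add: Int_UN_distrib2)
    qed
    show "represented (indicator ((\<Union>i. B i) \<inter> box q1 q2))"
    proof (rule represented_limit[where g = "indicator (box q1 q2)"])
      show "represented (\<lambda>x. indicator ((\<Union>i<k. B i) \<inter> box q1 q2) x)" for k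
        unfolding ind
      proof (induction k)
        case 0 show ?case using zero by simp
      next
        case (Suc k)
        from represented_lincomb[OF IH[of k] Suc, of 1] show ?case by (simp add: add.commute)
      qed
      show "(\<lambda>k. indicator ((\<Union>i<k. B i) \<inter> box q1 q2) x) \<longlonglongrightarrow> (indicator ((\<Union>i. B i) \<inter> box q1 q2) x :: real)" for x
      proof (rule tendsto_eventually)
        show "\<forall>\<^sub>F k in sequentially. indicator ((\<Union>i<k. B i) \<inter> box q1 q2) x = (indicator ((\<Union>i. B i) \<inter> box q1 q2) x :: real)"
        proof (cases "\<exists>i. x \<in> B i")
          case True
          then obtain i where i: "x \<in> B i" by auto
          show ?thesis
            using eventually_gt_at_top[of i] by eventually_elim (use i in \<open>auto split: split_indicator\<close>)
        qed (auto split: split_indicator)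
      qed
      show "indicator (box q1 q2) \<in> Lp p" by (rule Lp_indicator) auto
      show "\<forall>x. x \<notin> cbox q1 q2 \<longrightarrow> indicator (box q1 q2) x = (0::real)"
        using box_subset_cbox[of q1 q2] by (auto split: split_indicator)
    qed (auto split: split_indicator)
  qed
qed

text \<open>Induction from indicators through simple functions to increasing limits. Every function
  met on the way is dominated by a multiple of \<open>u\<close>, so membership in
  \<open>Lp p\<close> passes down to it.\<close>

lemma represented_nonneg:
  assumes "u \<in> borel_measurable borel" "\<And>x. 0 \<le> u x" "u \<in> Lp p"
  shows "represented (\<lambda>x. u x * indicator (box q1 q2) x)"
  using assms
proof (induction rule: borel_measurable_induct_real)
  case (set A)
  then show ?case
    using represented_indicator[of A] by (simp add: indicator_inter_arith[symmetric])
next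
  case (mult u c)
  \<comment> \<open>For \<open>c = 0\<close>, membership of \<open>c * u\<close> in
    \<open>Lp p\<close> says nothing about \<open>u\<close>, so the induction hypothesis is out of
    reach; the function is then the zero function anyway.\<close>
  show ?case
  proof (cases "c = 0")
    case True
    then show ?thesis using represented_indicator[of "{}"] by (simp add: indicator_def[abs_def])
  next
    case False
    have "u \<in> Lp p" using Lp_cmult[OF mult.prems, of "1 / c"] False by simp
    then have "represented (\<lambda>x. u x * indicator (box q1 q2) x)" by (rule mult.IH)
    from represented_lincomb[OF this represented_indicator[of "{}"], of c] show ?thesis
      by (simp add: mult.assoc)
  qed
next
  case (add u v)
  have "u \<in> Lp p" "v \<in> Lp p"
    using add p by (auto intro!: Lp_mono[OF add.prems])
  then have "represented (\<lambda>x. u x * indicator (box q1 q2) x)" "represented (\<lambda>x. v x * indicator (box q1 q2) x)"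
    using add.IH by auto
  from represented_lincomb[OF this(2,1), of 1] show ?case by (simp add: distrib_right)
next
  case (seq U)
  have le: "U k x \<le> u x" for k x
    by (rule incseq_le) (use seq in \<open>auto simp: incseq_def le_fun_def\<close>)
  have u0: "0 \<le> u x" for x using seq(2)[of 0 x] le[of 0 x] by linarith
  show ?case
  proof (rule represented_limit)
    show "represented (\<lambda>x. U k x * indicator (box q1 q2) x)" for k
    proof (rule seq.IH)
      show "U k \<in> Lp p" by (rule Lp_mono[OF seq.prems]) (use seq le u0 p in auto)
    qed
    show "(\<lambda>k. U k x * indicator (box q1 q2) x) \<longlonglongrightarrow> u x * indicator (box q1 q2) x" for x
      using seq by (intro tendsto_intros) auto
    show "\<bar>U k x * indicator (box q1 q2) x\<bar> \<le> u x * indicator (box q1 q2) x" for k x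
      using seq(2)[of k x] le[of k x] by (auto split: split_indicator)
    show "\<forall>x. x \<notin> cbox q1 q2 \<longrightarrow> u x * indicator (box q1 q2) x = 0"
      using box_subset_cbox[of q1 q2] by (auto split: split_indicator)
    show "(\<lambda>x. u x * indicator (box q1 q2) x) \<in> Lp p"
      by (rule Lp_mono[OF seq.prems]) (use Lp_measurable[OF seq.prems] p in \<open>auto split: split_indicator\<close>)
  qed
qed

lemma represented_Lp:
  assumes f: "f \<in> Lp p" and supp: "\<And>x. x \<notin> box q1 q2 \<Longrightarrow> f x = 0"
  shows "represented f"
proof -
  note [measurable] = Lp_measurable[OF f]
  have "represented (\<lambda>x. max 0 (f x) * indicator (box q1 q2) x)"
    by (intro represented_nonneg Lp_mono[OF f]) (use p in auto)
  moreover have "represented (\<lambda>x. max 0 (- f x) * indicator (box q1 q2) x)"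
    by (intro represented_nonneg Lp_mono[OF f]) (use p in auto)
  ultimately have "represented (\<lambda>x. - 1 * (max 0 (- f x) * indicator (box q1 q2) x) + max 0 (f x) * indicator (box q1 q2) x)"
    by (intro represented_lincomb)
  also have "(\<lambda>x. - 1 * (max 0 (- f x) * indicator (box q1 q2) x) + max 0 (f x) * indicator (box q1 q2) x) = f"
    using supp by (auto split: split_indicator simp: fun_eq_iff max_def)
  finally show ?thesis .
qed

end

text \<open>The factor \<open>2 * DIM('a)\<close> keeps \<open>x\<close> away from the cube circumscribed about the ball.\<close>

lemma (in kernel_operator) kernel_representation:
  assumes f: "f \<in> Lp p" and supp: "\<And>x. x \<notin> ball x0 r \<Longrightarrow> f x = 0" and r: "0 < r"
  shows "AE x in lborel. 2 * real DIM('a) * r \<le> dist x x0 \<longrightarrow> T f x = (\<integral>y. K x y * f y \<partial>lborel)"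
proof -
  let ?q1 = "x0 - r *\<^sub>R One" and ?q2 = "x0 + r *\<^sub>R One"
  let ?F = "{x. 2 * real DIM('a) * r \<le> dist x x0}"
  \<comment> \<open>Bounding the norm by the sum of coordinates puts the cube within
    \<open>DIM('a) * r\<close> of the centre, so at least half of the distance
    \<open>2 * DIM('a) * r\<close> remains.\<close>
  interpret kernel_operator_far T K p D C0 ?q1 ?q2 ?F "real DIM('a) * r"
  proof unfold_locales
    show "0 < real DIM('a) * r" using r by simp
    fix x y assume x: "x \<in> ?F" and y: "y \<in> cbox ?q1 ?q2"
    have "norm (y - x0) \<le> (\<Sum>i\<in>Basis. \<bar>(y - x0) \<bullet> i\<bar>)" by (rule norm_le_l1)
    also have "\<dots> \<le> (\<Sum>i\<in>(Basis::'a set). r)"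
      using y by (intro sum_mono) (auto simp: mem_box inner_simps abs_le_iff algebra_simps)
    finally have "dist y x0 \<le> real DIM('a) * r" by (simp add: dist_norm)
    then show "real DIM('a) * r \<le> dist x y"
      using x dist_triangle[of x x0 y] by (simp add: algebra_simps)
  qed
  have "ball x0 r \<subseteq> box ?q1 ?q2"
  proof
    fix x assume x: "x \<in> ball x0 r"
    have "\<bar>(x - x0) \<bullet> i\<bar> < r" if "i \<in> Basis" for i
      using Basis_le_norm[OF that, of "x - x0"] x by (simp add: dist_norm norm_minus_commute)
    then show "x \<in> box ?q1 ?q2" by (force simp: mem_box inner_simps abs_less_iff)
  qed
  then have "represented f" using supp by (intro represented_Lp f) blast
  then show ?thesis by (auto simp: represented_def)
qed

section \<open>Dyadic shells\<close>

lemma ball_const_change: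
  fixes b :: "'a::euclidean_space \<Rightarrow> real"
  assumes [measurable]: "b \<in> borel_measurable borel" and "0 < r" "0 \<le> Q"
    and q: "(\<integral>\<^sup>+y\<in>ball x r. ennreal \<bar>b y - q\<bar> \<partial>lborel) \<le> ennreal (Q * vol TYPE('a) r)"
    and d: "\<bar>p - q\<bar> \<le> d"
  shows "(\<integral>\<^sup>+y\<in>ball x r. ennreal \<bar>b y - p\<bar> \<partial>lborel) \<le> ennreal ((Q + d) * vol TYPE('a) r)"
proof -
  have v: "0 < vol TYPE('a) r" using \<open>0 < r\<close> by (rule vol_pos)
  have "0 \<le> d" using d by linarith
  have "(\<integral>\<^sup>+y\<in>ball x r. ennreal \<bar>b y - p\<bar> \<partial>lborel)
      \<le> (\<integral>\<^sup>+y. ennreal \<bar>b y - q\<bar> * indicator (ball x r) y + ennreal d * indicator (ball x r) y \<partial>lborel)"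
    using \<open>0 \<le> d\<close> d by (intro nn_integral_mono) (auto split: split_indicator simp flip: ennreal_plus intro!: ennreal_leI)
  also have "\<dots> = (\<integral>\<^sup>+y\<in>ball x r. ennreal \<bar>b y - q\<bar> \<partial>lborel) + (\<integral>\<^sup>+y\<in>ball x r. ennreal d \<partial>lborel)"
    by (intro nn_integral_add) auto
  also have "\<dots> \<le> ennreal (Q * vol TYPE('a) r) + ennreal (d * vol TYPE('a) r)"
    using q \<open>0 < r\<close> \<open>0 \<le> d\<close> by (intro add_mono) (auto simp: nn_integral_ball_const)
  also have "\<dots> = ennreal ((Q + d) * vol TYPE('a) r)"
    using v assms(3) \<open>0 \<le> d\<close> by (simp add: distrib_right)
  finally show ?thesis .
qed

text \<open>Restricting the oscillation of the large ball to the small one costs the volume ratio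
  \<open>s ^ DIM('a)\<close>; after that both constants approximate \<open>b\<close> on the same
  ball.\<close>

lemma osc_bound_scale:
  fixes b :: "'a::euclidean_space \<Rightarrow> real"
  assumes osc: "osc_bound b c A" and "0 \<le> A" "0 < r" "1 \<le> s"
  shows "\<bar>c x (s * r) - c x r\<bar> \<le> (1 + s ^ DIM('a)) * A"
proof -
  have r: "0 < r" "0 < s * r" using assms by auto
  have "(\<integral>\<^sup>+y\<in>ball x r. ennreal \<bar>b y - c x (s * r)\<bar> \<partial>lborel) \<le> (\<integral>\<^sup>+y\<in>ball x (s * r). ennreal \<bar>b y - c x (s * r)\<bar> \<partial>lborel)"
  proof -
    have "ball x r \<subseteq> ball x (s * r)" using assms by (intro subset_ball) simp
    then show ?thesis by (intro nn_integral_mono) (auto split: split_indicator)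
  qed
  also have "\<dots> \<le> ennreal (A * vol TYPE('a) (s * r))"
    by (rule osc_boundD(2)[OF osc r(2)])
  finally have "(\<integral>\<^sup>+y\<in>ball x r. ennreal \<bar>b y - c x (s * r)\<bar> \<partial>lborel) \<le> ennreal (s ^ DIM('a) * A * vol TYPE('a) r)"
    by (simp add: vol_mult mult.assoc mult.left_commute)
  from ball_const_diff_le[OF osc_boundD(1)[OF osc] r(1) _ _ this osc_boundD(2)[OF osc r(1)]]
  show ?thesis using assms by (simp add: algebra_simps)
qed

text \<open>Telescoping over doublings, each of which moves the constant by at most
  \<open>(1 + 2 ^ DIM('a)) * A\<close>. For \<open>cB\<close> this includes the jump to 0 at radius
  1, since only the oscillation bounds are used.\<close>

lemma osc_bound_dyadic:
  fixes b :: "'a::euclidean_space \<Rightarrow> real"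
  assumes osc: "osc_bound b c A" and "0 \<le> A" "0 < r"
  shows "(\<integral>\<^sup>+y\<in>ball x (2 ^ j * r). ennreal \<bar>b y - c x r\<bar> \<partial>lborel)
      \<le> ennreal ((real j + 1) * ((1 + 2 ^ DIM('a)) * A) * vol TYPE('a) (2 ^ j * r))"
proof -
  define B where "B = (1 + 2 ^ DIM('a)) * A"
  have "A \<le> B" "0 \<le> B" using \<open>0 \<le> A\<close> by (auto simp: B_def distrib_right)
  have "\<bar>c x (2 ^ j * r) - c x r\<bar> \<le> real j * B"
  proof (induction j)
    case (Suc j)
    have "\<bar>c x (2 * (2 ^ j * r)) - c x (2 ^ j * r)\<bar> \<le> B"
      unfolding B_def using assms by (intro osc_bound_scale) auto
    with Suc show ?case by (simp add: algebra_simps)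
  qed simp
  then have "\<bar>c x r - c x (2 ^ j * r)\<bar> \<le> real j * B" by (simp add: abs_minus_commute)
  from ball_const_change[OF osc_boundD(1)[OF osc] _ \<open>0 \<le> A\<close> osc_boundD(2)[OF osc] this] \<open>0 < r\<close>
  have "(\<integral>\<^sup>+y\<in>ball x (2 ^ j * r). ennreal \<bar>b y - c x r\<bar> \<partial>lborel) \<le> ennreal ((A + real j * B) * vol TYPE('a) (2 ^ j * r))"
    by simp
  also have "\<dots> \<le> ennreal ((real j + 1) * B * vol TYPE('a) (2 ^ j * r))"
    using \<open>A \<le> B\<close> vol_pos[of "2 ^ j * r", where 'a='a] \<open>0 < r\<close>
    by (intro ennreal_leI mult_right_mono) (auto simp: algebra_simps)
  finally show ?thesis by (simp add: B_def)
qed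

section \<open>Integrals of radial weights over dyadic shells\<close>

lemma dyadic_shell_exists:
  assumes "0 < r" "r \<le> (t::real)"
  obtains j where "2 ^ j * r \<le> t" "t < 2 ^ (j + 1) * r"
proof -
  define P where "P j \<longleftrightarrow> t < 2 ^ (j + 1) * r" for j
  obtain k where k: "t / r < 2 ^ k" using real_arch_pow[of 2 "t / r"] by auto
  then have "t < 2 ^ k * r" using assms by (simp add: field_simps)
  also have "\<dots> \<le> 2 ^ (k + 1) * r" using assms by simp
  finally have "P k" by (simp add: P_def)
  then have L: "P (Least P)" by (rule LeastI)
  moreover have "2 ^ Least P * r \<le> t"
  proof (cases "Least P")
    case (Suc i)
    then have "\<not> P i" using not_less_Least[of i P] by simp
    then show ?thesis using Suc by (simp add: P_def)
  qed (use assms in simp)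
  ultimately show thesis using that by (simp add: P_def)
qed

text \<open>On the shell between \<open>2 ^ j * r\<close> and \<open>2 ^ (j + 1) * r\<close> the
  decreasing weight is at most its value at the inner radius, and \<open>F\<close> is integrated
  over the whole outer ball.\<close>

lemma outside_ball_le_series:
  fixes F :: "'a::euclidean_space \<Rightarrow> ennreal"
  assumes [measurable]: "F \<in> borel_measurable borel" and r: "0 < r"
    and w: "\<And>s t. 0 < s \<Longrightarrow> s \<le> t \<Longrightarrow> w t \<le> w s" "\<And>t. 0 < t \<Longrightarrow> 0 \<le> w t"
    and V: "\<And>j. 0 \<le> V j" "\<And>j. (\<integral>\<^sup>+x\<in>ball x0 (2 ^ (j + 1) * r). F x \<partial>lborel) \<le> ennreal (V j)"
    and h: "\<And>j. w (2 ^ j * r) * V j \<le> h j" "summable h"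
  shows "(\<integral>\<^sup>+x\<in>- ball x0 r. ennreal (w (dist x x0)) * F x \<partial>lborel) \<le> ennreal (suminf h)"
proof -
  have h0: "0 \<le> h j" for j
    using h(1)[of j] V(1)[of j] w(2)[of "2 ^ j * r"] r
    by (metis mult_nonneg_nonneg order_trans zero_less_mult_iff zero_less_numeral zero_less_power)
  have "(\<integral>\<^sup>+x\<in>- ball x0 r. ennreal (w (dist x x0)) * F x \<partial>lborel)
      \<le> (\<integral>\<^sup>+x. (\<Sum>j. ennreal (w (2 ^ j * r)) * (F x * indicator (ball x0 (2 ^ (j + 1) * r)) x)) \<partial>lborel)"
  proof (intro nn_integral_mono)
    fix x
    let ?t = "\<lambda>j. ennreal (w (2 ^ j * r)) * (F x * indicator (ball x0 (2 ^ (j + 1) * r)) x)"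
    show "ennreal (w (dist x x0)) * F x * indicator (- ball x0 r) x \<le> (\<Sum>j. ?t j)"
    proof (cases "r \<le> dist x x0")
      case True
      obtain j where j: "2 ^ j * r \<le> dist x x0" "dist x x0 < 2 ^ (j + 1) * r"
        using dyadic_shell_exists[OF r True] by blast
      have "ennreal (w (dist x x0)) * F x * indicator (- ball x0 r) x \<le> ennreal (w (2 ^ j * r)) * F x"
        using w(1)[of "2 ^ j * r" "dist x x0"] j r
        by (auto split: split_indicator intro!: mult_right_mono ennreal_leI)
      also have "\<dots> = sum ?t {j}" using j by (simp add: dist_commute)
      also have "\<dots> \<le> (\<Sum>j. ?t j)" by (intro sum_le_suminf) auto
      finally show ?thesis .
    qed (simp add: dist_commute)
  qed
  also have "\<dots> = (\<Sum>j. \<integral>\<^sup>+x. ennreal (w (2 ^ j * r)) * (F x * indicator (ball x0 (2 ^ (j + 1) * r)) x) \<partial>lborel)"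
    by (intro nn_integral_suminf) measurable
  also have "\<dots> = (\<Sum>j. ennreal (w (2 ^ j * r)) * (\<integral>\<^sup>+x\<in>ball x0 (2 ^ (j + 1) * r). F x \<partial>lborel))"
    by (intro suminf_cong nn_integral_cmult) measurable
  also have "\<dots> \<le> (\<Sum>j. ennreal (h j))"
  proof (intro suminf_le allI)
    fix j
    have w0: "0 \<le> w (2 ^ j * r)" using r by (intro w) auto
    have "ennreal (w (2 ^ j * r)) * (\<integral>\<^sup>+x\<in>ball x0 (2 ^ (j + 1) * r). F x \<partial>lborel) \<le> ennreal (w (2 ^ j * r)) * ennreal (V j)"
      by (intro mult_left_mono V) auto
    also have "\<dots> = ennreal (w (2 ^ j * r) * V j)" using w0 V(1) by (simp add: ennreal_mult)
    also have "\<dots> \<le> ennreal (h j)" by (intro ennreal_leI h)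
    finally show "ennreal (w (2 ^ j * r)) * (\<integral>\<^sup>+x\<in>ball x0 (2 ^ (j + 1) * r). F x \<partial>lborel) \<le> ennreal (h j)" .
  qed auto
  also have "\<dots> = ennreal (suminf h)" using h0 h(2) by (rule suminf_ennreal2)
  finally show ?thesis .
qed

text \<open>The factor \<open>j + 2\<close> is the growth that \<open>osc_bound_dyadic\<close> gives
  on the outer ball of shell \<open>j\<close>, whose index is \<open>j + 1\<close>.\<close>

definition dyadic_tail :: "real \<Rightarrow> real" where
  "dyadic_tail s = (\<Sum>j. (real j + 2) * (2 powr - s) ^ j)"

lemma dyadic_tail_summable:
  assumes "0 < s"
  shows "summable (\<lambda>j. (real j + 2) * (2 powr - s) ^ j)"
proof -
  have q: "norm (2 powr - s) < 1" using assms by (simp add: powr_less_one)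
  have "summable (\<lambda>j. of_nat (Suc j) * (2 powr - s) ^ j + (2 powr - s) ^ j)"
    by (intro summable_add sums_summable[OF geometric_deriv_sums[OF q]] summable_geometric q)
  then show ?thesis by (simp add: algebra_simps)
qed

lemma dyadic_tail_nonneg: "0 < s \<Longrightarrow> 0 \<le> dyadic_tail s"
  unfolding dyadic_tail_def by (intro suminf_nonneg dyadic_tail_summable) auto

lemma dyadic_powr: "(2 ^ j) powr s = (2 powr s) ^ j" for s :: real
proof -
  have "(2 ^ j) powr s = (2 powr real j) powr s" by (simp add: powr_realpow)
  also have "\<dots> = (2 powr s) powr real j" by (simp add: powr_powr mult.commute)
  also have "\<dots> = (2 powr s) ^ j" by (simp add: powr_realpow)
  finally show ?thesis .
qed

text \<open>Here \<open>t\<close> is the inner and \<open>2 * t\<close> the outer radius of a shell: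
  the dimensional powers cancel and only \<open>t powr - s\<close> is left.\<close>

lemma powr_vol_scale:
  assumes "0 < t"
  shows "t powr (- real DIM('a) - s) * vol TYPE('a::euclidean_space) (2 * t) = 2 ^ DIM('a) * unit_ball_vol (real DIM('a)) * t powr - s"
proof -
  have "t powr (- real DIM('a) - s) * t ^ DIM('a) = t powr - s"
    using assms by (simp add: powr_realpow[symmetric] powr_add[symmetric])
  then show ?thesis
    by (simp add: vol_def power_mult_distrib)
qed

text \<open>The factor \<open>r powr \<delta>\<close> makes the sum scale invariant: at inner radius
  \<open>2 ^ j * r\<close> it leaves exactly \<open>(2 powr - \<delta>) ^ j\<close>.\<close>

lemma outside_ball_hoelder_weight:
  fixes F :: "'a::euclidean_space \<Rightarrow> ennreal"
  assumes F: "F \<in> borel_measurable borel" and r: "0 < r" and L: "0 \<le> L" and \<delta>: "0 < \<delta>"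
    and V: "\<And>j. (\<integral>\<^sup>+x\<in>ball x0 (2 ^ (j + 1) * r). F x \<partial>lborel) \<le> ennreal ((real j + 2) * L * vol TYPE('a) (2 ^ (j + 1) * r))"
  shows "(\<integral>\<^sup>+x\<in>- ball x0 r. ennreal (r powr \<delta> * dist x x0 powr (- real DIM('a) - \<delta>)) * F x \<partial>lborel)
    \<le> ennreal (L * (2 ^ DIM('a) * unit_ball_vol (real DIM('a)) * dyadic_tail \<delta>))"
proof -
  define M where "M = L * (2 ^ DIM('a) * unit_ball_vol (real DIM('a)))"
  let ?h = "\<lambda>j. M * ((real j + 2) * (2 powr - \<delta>) ^ j)"
  have "(\<integral>\<^sup>+x\<in>- ball x0 r. ennreal (r powr \<delta> * dist x x0 powr (- real DIM('a) - \<delta>)) * F x \<partial>lborel) \<le> ennreal (suminf ?h)"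
  proof (rule outside_ball_le_series[OF F r _ _ _ V])
    fix s t :: real assume "0 < s" "s \<le> t"
    then show "r powr \<delta> * t powr (- real DIM('a) - \<delta>) \<le> r powr \<delta> * s powr (- real DIM('a) - \<delta>)"
      using \<delta> by (intro mult_left_mono powr_mono2') auto
  next
    fix j
    have t: "0 < 2 ^ j * r" using r by simp
    show "0 \<le> (real j + 2) * L * vol TYPE('a) (2 ^ (j + 1) * r)"
      using L r by (intro mult_nonneg_nonneg less_imp_le[OF vol_pos]) auto
    have "r powr \<delta> * (2 ^ j * r) powr - \<delta> = (2 powr - \<delta>) ^ j"
      using r by (simp add: powr_mult powr_minus) (simp add: dyadic_powr power_inverse)
    moreover have "vol TYPE('a) (2 ^ (j + 1) * r) = vol TYPE('a) (2 * (2 ^ j * r))" by (simp add: mult.assoc)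
    moreover have "r powr \<delta> * w * ((real j + 2) * L * u) = (real j + 2) * L * (r powr \<delta> * (w * u))" for w u
      by (simp only: mult_ac)
    ultimately have "r powr \<delta> * (2 ^ j * r) powr (- real DIM('a) - \<delta>) * ((real j + 2) * L * vol TYPE('a) (2 ^ (j + 1) * r)) = ?h j"
      using powr_vol_scale[OF t, where 'a='a, of \<delta>] by (simp add: M_def mult_ac)
    then show "r powr \<delta> * (2 ^ j * r) powr (- real DIM('a) - \<delta>) * ((real j + 2) * L * vol TYPE('a) (2 ^ (j + 1) * r)) \<le> ?h j"
      by simp
  qed (use dyadic_tail_summable[OF \<delta>] in \<open>auto intro: summable_mult\<close>)
  also have "suminf ?h = M * dyadic_tail \<delta>"
    unfolding dyadic_tail_def by (rule suminf_mult[OF dyadic_tail_summable[OF \<delta>]])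
  finally show ?thesis by (simp add: M_def mult.assoc)
qed

text \<open>After \<open>m\<close> doublings the radius has reached 1. Each of the first
  \<open>m\<close> shells contributes at most a constant times \<open>(m + 2) ^ e\<close>, whence
  the exponent \<open>e + 1\<close>; later shells decay like
  \<open>(2 powr - \<epsilon>) ^ i\<close> with \<open>i = j - m\<close>. The lemma serves
  \<open>e = 1\<close> for the weight \<open>\<bar>b - c\<bar>\<close> and \<open>e = 0\<close> for
  plain volume.\<close>

lemma outside_ball_decay_weight:
  fixes F :: "'a::euclidean_space \<Rightarrow> ennreal"
  assumes F: "F \<in> borel_measurable borel" and r: "0 < r" and L: "0 \<le> L" and \<epsilon>: "0 < \<epsilon>" and e: "e \<le> 1"
    and m: "1 \<le> 2 ^ m * r"
    and V: "\<And>j. (\<integral>\<^sup>+x\<in>ball x0 (2 ^ (j + 1) * r). F x \<partial>lborel) \<le> ennreal ((real j + 2) ^ e * L * vol TYPE('a) (2 ^ (j + 1) * r))"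
  shows "(\<integral>\<^sup>+x\<in>- ball x0 r. ennreal (min (dist x x0 powr - real DIM('a)) (dist x x0 powr (- real DIM('a) - \<epsilon>))) * F x \<partial>lborel)
    \<le> ennreal (L * (2 ^ DIM('a) * unit_ball_vol (real DIM('a)) * (1 + dyadic_tail \<epsilon>)) * (real m + 2) ^ (e + 1))"
proof -
  define M where "M = L * (2 ^ DIM('a) * unit_ball_vol (real DIM('a)))"
  have M0: "0 \<le> M" using L by (simp add: M_def unit_ball_vol_nonneg)
  define g where "g i = (real i + 2) * (2 powr - \<epsilon>) ^ i" for i :: nat
  define h where "h j = M * (real m + 2) ^ e * (if j < m then 1 else g (j - m))" for j
  have g: "summable g" unfolding g_def by (rule dyadic_tail_summable[OF \<epsilon>])
  have "summable (\<lambda>i. M * (real m + 2) ^ e * g i)" by (intro summable_mult g)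
  then have h: "summable h"
    by (subst summable_iff_shift[of h m, symmetric]) (simp add: h_def)
  have "(\<integral>\<^sup>+x\<in>- ball x0 r. ennreal (min (dist x x0 powr - real DIM('a)) (dist x x0 powr (- real DIM('a) - \<epsilon>))) * F x \<partial>lborel) \<le> ennreal (suminf h)"
  proof (rule outside_ball_le_series[OF F r _ _ _ V _ h])
    fix s t :: real assume "0 < s" "s \<le> t"
    then show "min (t powr - real DIM('a)) (t powr (- real DIM('a) - \<epsilon>)) \<le> min (s powr - real DIM('a)) (s powr (- real DIM('a) - \<epsilon>))"
      using \<epsilon> by (intro min.mono powr_mono2') auto
  next
    fix j
    define t where "t = 2 ^ j * r"
    have t: "0 < t" using r by (simp add: t_def)
    have v: "0 < vol TYPE('a) (2 * t)" using t by (intro vol_pos) simp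
    show "0 \<le> (real j + 2) ^ e * L * vol TYPE('a) (2 ^ (j + 1) * r)"
      using L r by (intro mult_nonneg_nonneg less_imp_le[OF vol_pos]) auto
    have "min (t powr - real DIM('a)) (t powr (- real DIM('a) - \<epsilon>)) * vol TYPE('a) (2 * t)
        = min (t powr (- real DIM('a) - 0) * vol TYPE('a) (2 * t)) (t powr (- real DIM('a) - \<epsilon>) * vol TYPE('a) (2 * t))"
      using v by (simp add: min_mult_distrib_right)
    also have "\<dots> = 2 ^ DIM('a) * unit_ball_vol (real DIM('a)) * min 1 (t powr - \<epsilon>)"
      unfolding powr_vol_scale[OF t] using t by (simp add: min_mult_distrib_left unit_ball_vol_nonneg)
    finally have "min (t powr - real DIM('a)) (t powr (- real DIM('a) - \<epsilon>)) * ((real j + 2) ^ e * L * vol TYPE('a) (2 * t))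
        = M * ((real j + 2) ^ e * min 1 (t powr - \<epsilon>))"
      unfolding M_def by (metis (no_types, lifting) mult.assoc mult.commute mult.left_commute)
    also have "\<dots> \<le> M * ((real m + 2) ^ e * (if j < m then 1 else g (j - m)))"
    proof (intro mult_left_mono M0)
      show "(real j + 2) ^ e * min 1 (t powr - \<epsilon>) \<le> (real m + 2) ^ e * (if j < m then 1 else g (j - m))"
      proof (cases "j < m")
        case True
        then have "(real j + 2) ^ e * min 1 (t powr - \<epsilon>) \<le> (real m + 2) ^ e * 1"
          by (intro mult_mono power_mono) auto
        then show ?thesis using True by simp
      next
        case False
        define i where "i = j - m"
        have j: "j = m + i" using False by (simp add: i_def)
        have "2 ^ i \<le> t"
          using m mult_left_mono[OF m, of "2 ^ i"] by (simp add: t_def j power_add mult_ac)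
        then have "t powr - \<epsilon> \<le> (2 ^ i) powr - \<epsilon>" using \<epsilon> by (intro powr_mono2') auto
        then have 1: "min 1 (t powr - \<epsilon>) \<le> (2 powr - \<epsilon>) ^ i" by (simp add: dyadic_powr)
        \<comment> \<open>With \<open>j = m + i\<close> this is
          \<open>m + i + 2 \<le> (m + 2) * (i + 2)\<close> when \<open>e = 1\<close>; it separates
          the dependence on \<open>m\<close> from the convergent sum over \<open>i\<close>.\<close>
        have "(real j + 2) ^ e \<le> (real m + 2) ^ e * (real i + 2)"
          using e by (cases "e = 0") (auto simp: j algebra_simps le_Suc_eq)
        from mult_mono[OF this 1] show ?thesis
          using False by (simp add: g_def i_def mult.assoc)
      qed
    qed
    finally show "min ((2 ^ j * r) powr - real DIM('a)) ((2 ^ j * r) powr (- real DIM('a) - \<epsilon>)) * ((real j + 2) ^ e * L * vol TYPE('a) (2 ^ (j + 1) * r)) \<le> h j"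
      by (simp add: h_def t_def mult.assoc)
  qed auto
  also have "suminf h = (\<Sum>i. h (i + m)) + sum h {..<m}"
    by (rule suminf_split_initial_segment[OF h])
  also have "(\<Sum>i. h (i + m)) = M * (real m + 2) ^ e * dyadic_tail \<epsilon>"
    by (simp add: h_def suminf_mult[OF g] dyadic_tail_def g_def[symmetric])
  also have "sum h {..<m} = M * (real m + 2) ^ e * real m"
    by (simp add: h_def)
  also have "ennreal (M * (real m + 2) ^ e * dyadic_tail \<epsilon> + M * (real m + 2) ^ e * real m)
      \<le> ennreal (M * (1 + dyadic_tail \<epsilon>) * (real m + 2) ^ (e + 1))"
  proof (rule ennreal_leI)
    have "dyadic_tail \<epsilon> + real m \<le> (1 + dyadic_tail \<epsilon>) * (real m + 2)"
      using dyadic_tail_nonneg[OF \<epsilon>] by (simp add: algebra_simps)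
    from mult_left_mono[OF this, of "M * (real m + 2) ^ e"] M0
    show "M * (real m + 2) ^ e * dyadic_tail \<epsilon> + M * (real m + 2) ^ e * real m \<le> M * (1 + dyadic_tail \<epsilon>) * (real m + 2) ^ (e + 1)"
      by (simp add: distrib_left[symmetric] distrib_right[symmetric] mult_ac)
  qed
  finally show ?thesis by (simp add: M_def mult.assoc)
qed

section \<open>The commutator on an atom\<close>

lemma nn_integral_ball_split:
  fixes h :: "'a::euclidean_space \<Rightarrow> ennreal"
  assumes [measurable]: "h \<in> borel_measurable borel"
  shows "(\<integral>\<^sup>+x. h x \<partial>lborel) = (\<integral>\<^sup>+x\<in>ball x0 r. h x \<partial>lborel) + (\<integral>\<^sup>+x\<in>- ball x0 r. h x \<partial>lborel)"
proof -
  have "(\<integral>\<^sup>+x. h x \<partial>lborel) = (\<integral>\<^sup>+x. h x * indicator (ball x0 r) x + h x * indicator (- ball x0 r) x \<partial>lborel)"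
    by (intro nn_integral_cong) (auto split: split_indicator)
  also have "\<dots> = (\<integral>\<^sup>+x\<in>ball x0 r. h x \<partial>lborel) + (\<integral>\<^sup>+x\<in>- ball x0 r. h x \<partial>lborel)"
    by (intro nn_integral_add) measurable
  finally show ?thesis .
qed

text \<open>Young's inequality with exponents 3 and 3/2, up to constants. Comparing
  \<open>s ^ 2\<close> with \<open>t\<close> decides which of the two summands dominates.\<close>

lemma powr_four_thirds_mult_le:
  fixes s t :: real
  assumes "0 \<le> s" "0 \<le> t"
  shows "(s * t) powr (4 / 3) \<le> s ^ 4 + t\<^sup>2"
proof (cases "s = 0 \<or> t = 0")
  case False
  then have st: "0 < s" "0 < t" using assms by auto
  show ?thesis
  proof (cases "s\<^sup>2 \<le> t")
    case True
    have "s powr (4 / 3) = (s\<^sup>2) powr (2 / 3)" using st by (simp add: powr_powr flip: powr_numeral)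
    also have "\<dots> \<le> t powr (2 / 3)" using True by (intro powr_mono2) auto
    finally have "(s * t) powr (4 / 3) \<le> t powr (2 / 3) * t powr (4 / 3)"
      using st by (simp add: powr_mult mult_right_mono)
    also have "\<dots> = t\<^sup>2" using st by (simp flip: powr_add powr_numeral)
    finally show ?thesis by (simp add: add_increasing)
  next
    case False
    have "t powr (4 / 3) \<le> (s\<^sup>2) powr (4 / 3)" using False st by (intro powr_mono2) auto
    also have "\<dots> = s powr (8 / 3)" using st by (simp add: powr_powr flip: powr_numeral)
    finally have "(s * t) powr (4 / 3) \<le> s powr (4 / 3) * s powr (8 / 3)"
      using st by (simp add: powr_mult mult_left_mono)
    also have "\<dots> = s ^ 4" using st by (simp flip: powr_add powr_numeral)
    finally show ?thesis by (simp add: add_increasing2)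
  qed
qed auto

lemma le_one_plus_power: "t \<le> 1 + t ^ Suc n" if "0 \<le> t" for t :: real
proof (cases "t \<le> 1")
  case False
  then have "t ^ 1 \<le> t ^ Suc n" by (intro power_increasing) auto
  then show ?thesis by simp
qed (use that in \<open>simp add: add_increasing2\<close>)

lemma le_one_plus_powr: "t \<le> 1 + t powr q" if "0 \<le> t" "1 \<le> q" for t q :: real
proof (cases "t \<le> 1")
  case False
  then have "t powr 1 \<le> t powr q" using that by (intro powr_mono) auto
  then show ?thesis using False by simp
qed (use that in \<open>simp add: add_increasing2\<close>)

text \<open>Only size and support of the atom are recorded. The two cancellation conditions enter
  later, in the far estimates, multiplied by powers of the number of shells.\<close>

locale ball_atom =
  fixes a b :: "'a::euclidean_space \<Rightarrow> real" and x0 :: 'a and r A c0 C4 V :: real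
  assumes r: "0 < r" and A: "0 < A" and C4: "0 \<le> C4" and V: "V = vol TYPE('a) r"
    and a_meas [measurable]: "a \<in> borel_measurable borel"
    and b_meas [measurable]: "b \<in> borel_measurable borel"
    and supp: "x \<notin> ball x0 r \<Longrightarrow> a x = 0"
    and L2: "(\<integral>\<^sup>+x. ennreal ((a x)\<^sup>2) \<partial>lborel) \<le> ennreal (1 / V)"
    and L4: "(\<integral>\<^sup>+x\<in>ball x0 r. ennreal ((\<bar>b x - c0\<bar> / A) ^ 4) \<partial>lborel) \<le> ennreal (C4 * V)"
begin

lemma V_pos: "0 < V"
  using r by (simp add: V vol_pos)

lemma ball_volume: "(\<integral>\<^sup>+x. ennreal s * indicator (ball x0 r) x \<partial>lborel) = ennreal (s * V)" if "0 \<le> s" for s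
  using nn_integral_ball_const[OF r that, of x0] by (simp add: V)

lemma weighted_L2: "(\<integral>\<^sup>+x. ennreal s * ennreal ((a x)\<^sup>2) \<partial>lborel) \<le> ennreal (s / V)" if "0 \<le> s" for s
proof -
  have "(\<integral>\<^sup>+x. ennreal s * ennreal ((a x)\<^sup>2) \<partial>lborel) = ennreal s * (\<integral>\<^sup>+x. ennreal ((a x)\<^sup>2) \<partial>lborel)"
    by (intro nn_integral_cmult) measurable
  also have "\<dots> \<le> ennreal s * ennreal (1 / V)" by (intro mult_left_mono L2) auto
  also have "\<dots> = ennreal (s / V)" using that V_pos by (simp flip: ennreal_mult)
  finally show ?thesis .
qed

lemma weighted_L4:
  "(\<integral>\<^sup>+x. ennreal s * (ennreal ((\<bar>b x - c0\<bar> / A) ^ 4) * indicator (ball x0 r) x) \<partial>lborel) \<le> ennreal (s * (C4 * V))" if "0 \<le> s" for s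
proof -
  have "(\<integral>\<^sup>+x. ennreal s * (ennreal ((\<bar>b x - c0\<bar> / A) ^ 4) * indicator (ball x0 r) x) \<partial>lborel)
      = ennreal s * (\<integral>\<^sup>+x\<in>ball x0 r. ennreal ((\<bar>b x - c0\<bar> / A) ^ 4) \<partial>lborel)"
    by (intro nn_integral_cmult) measurable
  also have "\<dots> \<le> ennreal s * ennreal (C4 * V)" by (intro mult_left_mono L4) auto
  also have "\<dots> = ennreal (s * (C4 * V))" using that V_pos C4 by (simp flip: ennreal_mult)
  finally show ?thesis .
qed

text \<open>Instead of Cauchy-Schwarz, \<open>t \<le> 1 + t ^ 2\<close> with
  \<open>t = \<bar>a x\<bar> * V\<close>: after division by \<open>V\<close>, each of the two terms
  integrates to at most 1.\<close>

lemma atom_L1: "(\<integral>\<^sup>+x. ennreal \<bar>a x\<bar> \<partial>lborel) \<le> ennreal 2"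
proof -
  have "(\<integral>\<^sup>+x. ennreal \<bar>a x\<bar> \<partial>lborel)
      \<le> (\<integral>\<^sup>+x. ennreal (1 / V) * indicator (ball x0 r) x + ennreal V * ennreal ((a x)\<^sup>2) \<partial>lborel)"
  proof (intro nn_integral_mono)
    fix x
    show "ennreal \<bar>a x\<bar> \<le> ennreal (1 / V) * indicator (ball x0 r) x + ennreal V * ennreal ((a x)\<^sup>2)"
    proof (cases "x \<in> ball x0 r")
      case True
      have "\<bar>a x\<bar> * V \<le> 1 + (\<bar>a x\<bar> * V) ^ Suc 1"
        using V_pos by (intro le_one_plus_power) auto
      then have "\<bar>a x\<bar> \<le> 1 / V + V * (a x)\<^sup>2"
        using V_pos by (simp add: field_simps power2_eq_square)
      then show ?thesis using True V_pos by (simp add: ennreal_leI flip: ennreal_plus ennreal_mult)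
    qed (simp add: supp)
  qed
  also have "\<dots> = (\<integral>\<^sup>+x. ennreal (1 / V) * indicator (ball x0 r) x \<partial>lborel) + (\<integral>\<^sup>+x. ennreal V * ennreal ((a x)\<^sup>2) \<partial>lborel)"
    by (intro nn_integral_add) measurable
  also have "\<dots> \<le> ennreal 1 + ennreal 1"
    using V_pos ball_volume[of "1 / V"] weighted_L2[of V] by (intro add_mono) auto
  also have "\<dots> = ennreal 2" by (simp flip: ennreal_plus)
  finally show ?thesis .
qed

text \<open>With \<open>s = \<bar>b x - c0\<bar> / A\<close> and
  \<open>t = \<bar>a x\<bar> * V\<close> one has \<open>s * t \<le> 1 + s ^ 4 + t ^ 2\<close>;
  multiplied by \<open>A / V\<close>, the terms integrate to at most \<open>A\<close>,
  \<open>C4 * A\<close> and \<open>A\<close>.\<close>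

lemma product_L1: "(\<integral>\<^sup>+x. ennreal \<bar>(b x - c0) * a x\<bar> \<partial>lborel) \<le> ennreal ((2 + C4) * A)"
proof -
  have "(\<integral>\<^sup>+x. ennreal \<bar>(b x - c0) * a x\<bar> \<partial>lborel)
      \<le> (\<integral>\<^sup>+x. (ennreal (A / V) * indicator (ball x0 r) x
          + ennreal (A / V) * (ennreal ((\<bar>b x - c0\<bar> / A) ^ 4) * indicator (ball x0 r) x))
          + ennreal (A * V) * ennreal ((a x)\<^sup>2) \<partial>lborel)"
  proof (intro nn_integral_mono)
    fix x
    show "ennreal \<bar>(b x - c0) * a x\<bar> \<le> (ennreal (A / V) * indicator (ball x0 r) x
          + ennreal (A / V) * (ennreal ((\<bar>b x - c0\<bar> / A) ^ 4) * indicator (ball x0 r) x))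
          + ennreal (A * V) * ennreal ((a x)\<^sup>2)"
    proof (cases "x \<in> ball x0 r")
      case True
      define s where "s = \<bar>b x - c0\<bar> / A"
      define t where "t = \<bar>a x\<bar> * V"
      have st: "0 \<le> s" "0 \<le> t" using A V_pos by (auto simp: s_def t_def)
      have "s * t \<le> s\<^sup>2 + t\<^sup>2" using zero_le_power2[of "s - t"] st
          mult_nonneg_nonneg[OF st] unfolding power2_diff by linarith
      also have "s\<^sup>2 \<le> 1 + (s\<^sup>2) ^ Suc 1" by (intro le_one_plus_power) auto
      finally have "A / V * (s * t) \<le> A / V * (1 + s ^ 4 + t\<^sup>2)"
        using A V_pos by (intro mult_left_mono) auto
      also have "A / V * (s * t) = \<bar>(b x - c0) * a x\<bar>"
        using A V_pos by (simp add: s_def t_def abs_mult)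
      also have "A / V * (1 + s ^ 4 + t\<^sup>2) = A / V + A / V * s ^ 4 + A * V * (a x)\<^sup>2"
        using A V_pos by (simp add: t_def power_mult_distrib field_simps power2_eq_square)
      finally show ?thesis
        using True V_pos A by (simp add: ennreal_leI s_def flip: ennreal_plus ennreal_mult)
    qed (simp add: supp)
  qed
  also have "\<dots> = (\<integral>\<^sup>+x. ennreal (A / V) * indicator (ball x0 r) x
          + ennreal (A / V) * (ennreal ((\<bar>b x - c0\<bar> / A) ^ 4) * indicator (ball x0 r) x) \<partial>lborel)
          + (\<integral>\<^sup>+x. ennreal (A * V) * ennreal ((a x)\<^sup>2) \<partial>lborel)"
    by (intro nn_integral_add) measurable
  also have "(\<integral>\<^sup>+x. ennreal (A / V) * indicator (ball x0 r) x
          + ennreal (A / V) * (ennreal ((\<bar>b x - c0\<bar> / A) ^ 4) * indicator (ball x0 r) x) \<partial>lborel)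
      = (\<integral>\<^sup>+x. ennreal (A / V) * indicator (ball x0 r) x \<partial>lborel)
          + (\<integral>\<^sup>+x. ennreal (A / V) * (ennreal ((\<bar>b x - c0\<bar> / A) ^ 4) * indicator (ball x0 r) x) \<partial>lborel)"
    by (intro nn_integral_add) measurable
  also have "\<dots> + (\<integral>\<^sup>+x. ennreal (A * V) * ennreal ((a x)\<^sup>2) \<partial>lborel) \<le> (ennreal A + ennreal (C4 * A)) + ennreal A"
    using V_pos A ball_volume[of "A / V"] weighted_L2[of "A * V"] weighted_L4[of "A / V"]
    by (intro add_mono) (auto simp: field_simps)
  also have "\<dots> = ennreal ((2 + C4) * A)"
    using A C4 by (simp add: algebra_simps flip: ennreal_plus)
  finally show ?thesis .
qed

text \<open>The same normalisation as for the \<open>L^1\<close> bound; the power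
  \<open>(A / V) powr (4 / 3)\<close> on the right is cancelled later, when this bound meets the
  boundedness of \<open>T\<close>.\<close>

lemma product_L43:
  "(\<integral>\<^sup>+x. ennreal (\<bar>(b x - c0) * a x\<bar> powr (4 / 3)) \<partial>lborel) \<le> ennreal ((A / V) powr (4 / 3) * ((C4 + 1) * V))"
proof -
  let ?k = "(A / V) powr (4 / 3)"
  have "(\<integral>\<^sup>+x. ennreal (\<bar>(b x - c0) * a x\<bar> powr (4 / 3)) \<partial>lborel)
      \<le> (\<integral>\<^sup>+x. ennreal ?k * (ennreal ((\<bar>b x - c0\<bar> / A) ^ 4) * indicator (ball x0 r) x) + ennreal (?k * V\<^sup>2) * ennreal ((a x)\<^sup>2) \<partial>lborel)"
  proof (intro nn_integral_mono)
    fix x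
    show "ennreal (\<bar>(b x - c0) * a x\<bar> powr (4 / 3))
        \<le> ennreal ?k * (ennreal ((\<bar>b x - c0\<bar> / A) ^ 4) * indicator (ball x0 r) x) + ennreal (?k * V\<^sup>2) * ennreal ((a x)\<^sup>2)"
    proof (cases "x \<in> ball x0 r")
      case True
      define s where "s = \<bar>b x - c0\<bar> / A"
      define t where "t = \<bar>a x\<bar> * V"
      have st: "0 \<le> s" "0 \<le> t" using A V_pos by (auto simp: s_def t_def)
      have "\<bar>(b x - c0) * a x\<bar> = A / V * (s * t)"
        using A V_pos by (simp add: s_def t_def abs_mult)
      then have "\<bar>(b x - c0) * a x\<bar> powr (4 / 3) = ?k * (s * t) powr (4 / 3)"
        using st A V_pos by (simp only: powr_mult)
      also have "\<dots> \<le> ?k * (s ^ 4 + t\<^sup>2)"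
        by (intro mult_left_mono powr_four_thirds_mult_le st) auto
      also have "\<dots> = ?k * s ^ 4 + ?k * V\<^sup>2 * (a x)\<^sup>2"
        by (simp add: t_def power_mult_distrib distrib_left)
      finally have "\<bar>(b x - c0) * a x\<bar> powr (4 / 3) \<le> ?k * s ^ 4 + ?k * V\<^sup>2 * (a x)\<^sup>2" .
      then have "ennreal (\<bar>(b x - c0) * a x\<bar> powr (4 / 3)) \<le> ennreal (?k * s ^ 4 + ?k * V\<^sup>2 * (a x)\<^sup>2)"
        by (rule ennreal_leI)
      also have "\<dots> = ennreal ?k * ennreal (s ^ 4) + ennreal (?k * V\<^sup>2) * ennreal ((a x)\<^sup>2)"
        using st by (simp add: ennreal_plus flip: ennreal_mult)
      finally show ?thesis using True by (simp add: s_def)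
    qed (simp add: supp)
  qed
  also have "\<dots> = (\<integral>\<^sup>+x. ennreal ?k * (ennreal ((\<bar>b x - c0\<bar> / A) ^ 4) * indicator (ball x0 r) x) \<partial>lborel)
      + (\<integral>\<^sup>+x. ennreal (?k * V\<^sup>2) * ennreal ((a x)\<^sup>2) \<partial>lborel)"
    by (intro nn_integral_add) measurable
  also have "\<dots> \<le> ennreal (?k * (C4 * V)) + ennreal (?k * V)"
    using weighted_L4[of ?k] weighted_L2[of "?k * V\<^sup>2"] V_pos
    by (intro add_mono) (auto simp: power2_eq_square)
  also have "\<dots> = ennreal (?k * ((C4 + 1) * V))"
    using C4 V_pos by (simp add: algebra_simps flip: ennreal_plus)
  finally show ?thesis .
qed

lemma product_Lp: "(\<lambda>x. (b x - c0) * a x) \<in> Lp (4 / 3)"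
  using le_less_trans[OF product_L43 ennreal_less_top] by (simp add: Lp_iff)

lemma atom_Lp: "a \<in> Lp (4 / 3)"
proof -
  have "(\<integral>\<^sup>+x. ennreal (\<bar>a x\<bar> powr (4 / 3)) \<partial>lborel) \<le> (\<integral>\<^sup>+x. ennreal 1 * indicator (ball x0 r) x + ennreal 1 * ennreal ((a x)\<^sup>2) \<partial>lborel)"
  proof (intro nn_integral_mono)
    fix x
    show "ennreal (\<bar>a x\<bar> powr (4 / 3)) \<le> ennreal 1 * indicator (ball x0 r) x + ennreal 1 * ennreal ((a x)\<^sup>2)"
    proof (cases "x \<in> ball x0 r")
      case True
      have "\<bar>a x\<bar> powr (4 / 3) \<le> 1 + (a x)\<^sup>2"
        using powr_four_thirds_mult_le[of 1 "\<bar>a x\<bar>"] by simp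
      then have "ennreal (\<bar>a x\<bar> powr (4 / 3)) \<le> ennreal (1 + (a x)\<^sup>2)" by (rule ennreal_leI)
      also have "\<dots> = ennreal 1 + ennreal ((a x)\<^sup>2)" by (rule ennreal_plus) auto
      finally show ?thesis using True by simp
    qed (simp add: supp)
  qed
  also have "\<dots> = (\<integral>\<^sup>+x. ennreal 1 * indicator (ball x0 r) x \<partial>lborel) + (\<integral>\<^sup>+x. ennreal 1 * ennreal ((a x)\<^sup>2) \<partial>lborel)"
    by (intro nn_integral_add) measurable
  also have "\<dots> < \<infinity>"
    using ball_volume[of 1] le_less_trans[OF weighted_L2[of 1] ennreal_less_top] by simp
  finally show ?thesis by (simp add: Lp_iff)
qed

lemma atom_L2: "a \<in> Lp 2"
proof -
  have "(\<integral>\<^sup>+x. ennreal (\<bar>a x\<bar> powr 2) \<partial>lborel) = (\<integral>\<^sup>+x. ennreal ((a x)\<^sup>2) \<partial>lborel)"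
  proof (intro nn_integral_cong)
    fix x
    show "ennreal (\<bar>a x\<bar> powr 2) = ennreal ((a x)\<^sup>2)" by (cases "a x = 0") auto
  qed
  also have "\<dots> < \<infinity>" using le_less_trans[OF L2 ennreal_less_top] by simp
  finally show ?thesis by (simp add: Lp_iff)
qed

end

section \<open>Near and far estimates for the operator\<close>

locale inhom_operator = kernel_operator T K "4 / 3" D C0
  for T :: "('a::euclidean_space \<Rightarrow> real) \<Rightarrow> 'a \<Rightarrow> real" and K :: "'a \<Rightarrow> 'a \<Rightarrow> real" and D C0 :: real +
  fixes D2 \<delta> \<epsilon> :: real
  assumes D: "0 \<le> D" and D2: "0 \<le> D2" and \<delta>: "0 < \<delta>" and \<epsilon>: "0 < \<epsilon>"
    and T_L2: "f \<in> Lp 2 \<Longrightarrow> (\<integral>\<^sup>+x. ennreal ((T f x)\<^sup>2) \<partial>lborel) \<le> ennreal D2 * (\<integral>\<^sup>+x. ennreal ((f x)\<^sup>2) \<partial>lborel)"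
    and K_decay: "x \<noteq> y \<Longrightarrow>
      \<bar>K x y\<bar> \<le> C0 * min (dist x y powr - real DIM('a)) (dist x y powr (- real DIM('a) - \<epsilon>))"
    and K_hoelder: "x \<noteq> y \<Longrightarrow> 2 * dist y z \<le> dist x y \<Longrightarrow>
      \<bar>K x y - K x z\<bar> \<le> C0 * dist y z powr \<delta> * dist x y powr (- real DIM('a) - \<delta>)"
begin

text \<open>Writing \<open>K x y\<close> as \<open>K x x0\<close> plus a difference separates
  \<open>\<integral> f\<close> from \<open>\<integral> \<bar>f\<bar>\<close>. The distance
  \<open>2 * r\<close> is what the Hoelder condition asks of points \<open>y\<close> in the
  ball.\<close>

lemma kernel_integral_bound:
  assumes f: "integrable lborel f" and supp: "\<And>y. y \<notin> ball x0 r \<Longrightarrow> f y = 0"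
    and r: "0 < r" and x: "2 * r \<le> dist x x0"
  shows "\<bar>\<integral>y. K x y * f y \<partial>lborel\<bar> \<le>
    C0 * (r powr \<delta> * dist x x0 powr (- real DIM('a) - \<delta>)) * (\<integral>y. \<bar>f y\<bar> \<partial>lborel)
    + C0 * min (dist x x0 powr - real DIM('a)) (dist x x0 powr (- real DIM('a) - \<epsilon>)) * \<bar>\<integral>y. f y \<partial>lborel\<bar>"
proof -
  define w where "w = C0 * (r powr \<delta> * dist x x0 powr (- real DIM('a) - \<delta>))"
  have [measurable]: "f \<in> borel_measurable borel" using f by auto
  have "x \<noteq> x0" using x r by auto
  have w0: "0 \<le> w" using C0 by (simp add: w_def)
  have diff: "\<bar>(K x y - K x x0) * f y\<bar> \<le> w * \<bar>f y\<bar>" for y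
  proof (cases "y \<in> ball x0 r")
    case True
    then have "\<bar>K x x0 - K x y\<bar> \<le> C0 * dist x0 y powr \<delta> * dist x x0 powr (- real DIM('a) - \<delta>)"
      using \<open>x \<noteq> x0\<close> x by (intro K_hoelder) auto
    also have "\<dots> \<le> C0 * r powr \<delta> * dist x x0 powr (- real DIM('a) - \<delta>)"
      using True C0 \<delta> by (intro mult_right_mono mult_left_mono powr_mono2) auto
    finally have "\<bar>K x y - K x x0\<bar> \<le> w" by (simp add: w_def abs_minus_commute mult.assoc)
    then show ?thesis by (simp add: abs_mult mult_right_mono)
  qed (simp add: supp)
  have int: "integrable lborel (\<lambda>y. (K x y - K x x0) * f y)"
    by (rule Bochner_Integration.integrable_bound[of _ "\<lambda>y. w * \<bar>f y\<bar>"])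
      (use f diff w0 in auto)
  have "(\<integral>y. K x y * f y \<partial>lborel) = (\<integral>y. (K x y - K x x0) * f y + K x x0 * f y \<partial>lborel)"
    by (intro Bochner_Integration.integral_cong) (auto simp: algebra_simps)
  also have "\<dots> = (\<integral>y. (K x y - K x x0) * f y \<partial>lborel) + K x x0 * (\<integral>y. f y \<partial>lborel)"
    using int f by simp
  finally have "\<bar>\<integral>y. K x y * f y \<partial>lborel\<bar> \<le> \<bar>\<integral>y. (K x y - K x x0) * f y \<partial>lborel\<bar> + \<bar>K x x0\<bar> * \<bar>\<integral>y. f y \<partial>lborel\<bar>"
    by (simp add: abs_mult[symmetric])
  also have "\<bar>\<integral>y. (K x y - K x x0) * f y \<partial>lborel\<bar> \<le> (\<integral>y. \<bar>(K x y - K x x0) * f y\<bar> \<partial>lborel)"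
    by (rule integral_abs_bound)
  also have "\<dots> \<le> (\<integral>y. w * \<bar>f y\<bar> \<partial>lborel)"
    using int f diff by (intro integral_mono) auto
  also have "\<dots> = w * (\<integral>y. \<bar>f y\<bar> \<partial>lborel)" by simp
  also have "\<bar>K x x0\<bar> * \<bar>\<integral>y. f y \<partial>lborel\<bar> \<le> C0 * min (dist x x0 powr - real DIM('a)) (dist x x0 powr (- real DIM('a) - \<epsilon>)) * \<bar>\<integral>y. f y \<partial>lborel\<bar>"
    by (intro mult_right_mono K_decay \<open>x \<noteq> x0\<close>) auto
  finally show ?thesis by (simp add: w_def add_left_mono)
qed

text \<open>The weight \<open>F\<close> lets one argument serve both halves of the commutator: it is
  \<open>\<bar>b - c\<bar>\<close> for the term with \<open>T a\<close>, and 1 for the term with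
  \<open>T\<close> applied to the product.\<close>

lemma far_integral_bound:
  fixes F :: "'a \<Rightarrow> ennreal"
  assumes f: "f \<in> Lp (4 / 3)" and supp: "\<And>y. y \<notin> ball x0 r \<Longrightarrow> f y = 0" and r: "0 < r"
    and [measurable]: "F \<in> borel_measurable borel"
    and N: "(\<integral>\<^sup>+y. ennreal \<bar>f y\<bar> \<partial>lborel) \<le> ennreal N" "0 \<le> N"
    and B1: "(\<integral>\<^sup>+x\<in>- ball x0 r. ennreal (r powr \<delta> * dist x x0 powr (- real DIM('a) - \<delta>)) * F x \<partial>lborel) \<le> ennreal B1" "0 \<le> B1"
    and B2: "(\<integral>\<^sup>+x\<in>- ball x0 r. ennreal (min (dist x x0 powr - real DIM('a)) (dist x x0 powr (- real DIM('a) - \<epsilon>))) * F x \<partial>lborel) \<le> ennreal B2" "0 \<le> B2"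
  shows "(\<integral>\<^sup>+x\<in>- ball x0 (2 * real DIM('a) * r). ennreal \<bar>T f x\<bar> * F x \<partial>lborel)
    \<le> ennreal (C0 * N * B1 + C0 * \<bar>\<integral>y. f y \<partial>lborel\<bar> * B2)"
proof -
  let ?w1 = "\<lambda>x. r powr \<delta> * dist x x0 powr (- real DIM('a) - \<delta>)"
  let ?w2 = "\<lambda>x. min (dist x x0 powr - real DIM('a)) (dist x x0 powr (- real DIM('a) - \<epsilon>))"
  let ?I = "\<bar>\<integral>y. f y \<partial>lborel\<bar>"
  have f_int: "integrable lborel f"
    using supp by (intro Lp_bounded_support_integrable[OF f, of "ball x0 r"]) auto
  have int_N: "(\<integral>y. \<bar>f y\<bar> \<partial>lborel) \<le> N"
    using N by (intro integral_real_bounded)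
  have n1: "1 \<le> real DIM('a)" using DIM_positive[where 'a='a] by linarith
  have pt: "\<bar>\<integral>y. K x y * f y \<partial>lborel\<bar> \<le> C0 * N * ?w1 x + C0 * ?I * ?w2 x"
    if "2 * real DIM('a) * r \<le> dist x x0" for x
  proof -
    have "2 * r \<le> 2 * real DIM('a) * r" using n1 r by simp
    then have "2 * r \<le> dist x x0" using that by linarith
    note kernel_integral_bound[OF f_int supp r this]
    also have "C0 * ?w1 x * (\<integral>y. \<bar>f y\<bar> \<partial>lborel) \<le> C0 * ?w1 x * N"
      using int_N C0 by (intro mult_left_mono) auto
    finally show ?thesis by (simp add: mult_ac)
  qed
  have rep: "AE x in lborel. 2 * real DIM('a) * r \<le> dist x x0 \<longrightarrow> T f x = (\<integral>y. K x y * f y \<partial>lborel)"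
    using supp by (intro kernel_representation[OF f _ r])
  have "(\<integral>\<^sup>+x\<in>- ball x0 (2 * real DIM('a) * r). ennreal \<bar>T f x\<bar> * F x \<partial>lborel)
      \<le> (\<integral>\<^sup>+x. ennreal (C0 * N) * (ennreal (?w1 x) * F x * indicator (- ball x0 r) x)
         + ennreal (C0 * ?I) * (ennreal (?w2 x) * F x * indicator (- ball x0 r) x) \<partial>lborel)"
  proof (rule nn_integral_mono_AE)
    show "AE x in lborel. ennreal \<bar>T f x\<bar> * F x * indicator (- ball x0 (2 * real DIM('a) * r)) x
      \<le> ennreal (C0 * N) * (ennreal (?w1 x) * F x * indicator (- ball x0 r) x)
         + ennreal (C0 * ?I) * (ennreal (?w2 x) * F x * indicator (- ball x0 r) x)"
      using rep
    proof eventually_elim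
      case (elim x)
      show ?case
      proof (cases "2 * real DIM('a) * r \<le> dist x x0")
        case True
        have "1 * r \<le> 2 * real DIM('a) * r" using n1 r by (intro mult_right_mono) linarith+
        then have far: "r \<le> dist x x0" using True by linarith
        have "ennreal \<bar>T f x\<bar> \<le> ennreal (C0 * N * ?w1 x + C0 * ?I * ?w2 x)"
          using elim True pt[OF True] by (intro ennreal_leI) simp
        also have "\<dots> = ennreal (C0 * N) * ennreal (?w1 x) + ennreal (C0 * ?I) * ennreal (?w2 x)"
          using C0 N(2) by (subst ennreal_plus) (auto simp: ennreal_mult)
        finally have "ennreal \<bar>T f x\<bar> * F x \<le> (ennreal (C0 * N) * ennreal (?w1 x) + ennreal (C0 * ?I) * ennreal (?w2 x)) * F x"
          by (rule mult_right_mono) simp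
        then show ?thesis using True far by (simp add: dist_commute distrib_right mult.assoc)
      qed (simp add: dist_commute)
    qed
  qed
  also have "\<dots> = ennreal (C0 * N) * (\<integral>\<^sup>+x\<in>- ball x0 r. ennreal (?w1 x) * F x \<partial>lborel)
      + ennreal (C0 * ?I) * (\<integral>\<^sup>+x\<in>- ball x0 r. ennreal (?w2 x) * F x \<partial>lborel)"
    by (subst nn_integral_add) (auto simp: nn_integral_cmult)
  also have "\<dots> \<le> ennreal (C0 * N) * ennreal B1 + ennreal (C0 * ?I) * ennreal B2"
    by (intro add_mono mult_left_mono B1 B2) auto
  also have "\<dots> = ennreal (C0 * N * B1 + C0 * ?I * B2)"
    using C0 N(2) B1(2) B2(2) by (subst ennreal_plus) (auto simp: ennreal_mult)
  finally show ?thesis .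
qed

end

text \<open>The near region is an enlarged ball, while the constant subtracted from \<open>b\<close>
  remains that of the original ball; this pays for the mismatch.\<close>

lemma osc_power4_scale:
  fixes b :: "'a::euclidean_space \<Rightarrow> real"
  assumes osc: "osc_bound b c A" and A: "0 < A" and C4: "0 \<le> C4" and r: "0 < r" and s: "1 \<le> s"
    and JN: "\<And>x r. 0 < r \<Longrightarrow> (\<integral>\<^sup>+y\<in>ball x r. ennreal ((\<bar>b y - c x r\<bar> / A) ^ 4) \<partial>lborel) \<le> ennreal (C4 * vol TYPE('a) r)"
  shows "(\<integral>\<^sup>+y\<in>ball x (s * r). ennreal ((\<bar>b y - c x r\<bar> / A) ^ 4) \<partial>lborel)
    \<le> ennreal ((8 * C4 + 8 * (1 + s ^ DIM('a)) ^ 4) * s ^ DIM('a) * vol TYPE('a) r)"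
proof -
  note [measurable] = osc_boundD(1)[OF osc]
  have sr: "0 < s * r" using r s by simp
  have e: "\<bar>b y / A - t / A\<bar> = \<bar>b y - t\<bar> / A" for y t
    using A by (simp add: diff_divide_distrib[symmetric])
  have "\<bar>c x r / A - c x (s * r) / A\<bar> = \<bar>c x (s * r) - c x r\<bar> / A"
    using A by (simp add: diff_divide_distrib[symmetric] abs_minus_commute)
  also have "\<dots> \<le> 1 + s ^ DIM('a)"
    using osc_bound_scale[OF osc _ r s, of x] A by (simp add: field_simps)
  finally have d: "\<bar>c x r / A - c x (s * r) / A\<bar> \<le> 1 + s ^ DIM('a)" .
  have "(\<integral>\<^sup>+y\<in>ball x (s * r). ennreal (\<bar>b y / A - c x r / A\<bar> ^ 4) \<partial>lborel)
      \<le> ennreal ((8 * C4 + 8 * (1 + s ^ DIM('a)) ^ 4) * vol TYPE('a) (s * r))"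
  proof (rule ball_power4_const_change[OF _ sr C4 _ d])
    show "(\<integral>\<^sup>+y\<in>ball x (s * r). ennreal (\<bar>b y / A - c x (s * r) / A\<bar> ^ 4) \<partial>lborel) \<le> ennreal (C4 * vol TYPE('a) (s * r))"
      unfolding e by (rule JN[OF sr])
  qed measurable
  then show ?thesis by (simp only: e vol_mult mult.assoc)
qed

context inhom_operator
begin

text \<open>The Young argument of \<open>product_L1\<close> with \<open>T a\<close> in place of
  \<open>a\<close>: the three terms give \<open>s ^ DIM('a)\<close> from the volume,
  \<open>C5\<close> from the fourth moment and \<open>D2\<close> from the \<open>L^2\<close> bound
  of \<open>T\<close>.\<close>

lemma near_bound_atom:
  fixes a b :: "'a \<Rightarrow> real"
  assumes atom: "ball_atom a b x0 r A c0 C4 V" and s: "1 \<le> s" and C5: "0 \<le> C5"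
    and near: "(\<integral>\<^sup>+x\<in>ball x0 (s * r). ennreal ((\<bar>b x - c0\<bar> / A) ^ 4) \<partial>lborel) \<le> ennreal (C5 * V)"
  shows "(\<integral>\<^sup>+x\<in>ball x0 (s * r). ennreal \<bar>T a x\<bar> * ennreal \<bar>b x - c0\<bar> \<partial>lborel) \<le> ennreal ((s ^ DIM('a) + C5 + D2) * A)"
proof -
  interpret ball_atom a b x0 r A c0 C4 V by fact
  have [measurable]: "T a \<in> borel_measurable borel" by (rule Lp_measurable[OF T_Lp[OF atom_Lp]])
  have sr: "0 < s * r" using r s by simp
  let ?B = "ball x0 (s * r)"
  have "(\<integral>\<^sup>+x\<in>?B. ennreal \<bar>T a x\<bar> * ennreal \<bar>b x - c0\<bar> \<partial>lborel)
      \<le> (\<integral>\<^sup>+x. (ennreal (A / V) * indicator ?B x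
          + ennreal (A / V) * (ennreal ((\<bar>b x - c0\<bar> / A) ^ 4) * indicator ?B x))
          + ennreal (A * V) * ennreal ((T a x)\<^sup>2) \<partial>lborel)"
  proof (intro nn_integral_mono)
    fix x
    show "ennreal \<bar>T a x\<bar> * ennreal \<bar>b x - c0\<bar> * indicator ?B x \<le> (ennreal (A / V) * indicator ?B x
          + ennreal (A / V) * (ennreal ((\<bar>b x - c0\<bar> / A) ^ 4) * indicator ?B x))
          + ennreal (A * V) * ennreal ((T a x)\<^sup>2)"
    proof (cases "x \<in> ?B")
      case True
      define \<alpha> where "\<alpha> = \<bar>b x - c0\<bar> / A"
      define t where "t = \<bar>T a x\<bar> * V"
      have st: "0 \<le> \<alpha>" "0 \<le> t" using A V_pos by (auto simp: \<alpha>_def t_def)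
      have "\<alpha> * t \<le> \<alpha>\<^sup>2 + t\<^sup>2" using zero_le_power2[of "\<alpha> - t"] st
          mult_nonneg_nonneg[OF st] unfolding power2_diff by linarith
      also have "\<alpha>\<^sup>2 \<le> 1 + (\<alpha>\<^sup>2) ^ Suc 1" by (intro le_one_plus_power) auto
      finally have "A / V * (\<alpha> * t) \<le> A / V * (1 + \<alpha> ^ 4 + t\<^sup>2)"
        using A V_pos by (intro mult_left_mono) auto
      also have "A / V * (\<alpha> * t) = \<bar>T a x\<bar> * \<bar>b x - c0\<bar>"
        using A V_pos by (simp add: \<alpha>_def t_def abs_mult)
      also have "A / V * (1 + \<alpha> ^ 4 + t\<^sup>2) = A / V + A / V * \<alpha> ^ 4 + A * V * (T a x)\<^sup>2"
        using A V_pos by (simp add: t_def power_mult_distrib field_simps power2_eq_square)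
      finally show ?thesis
        using True V_pos A by (simp add: ennreal_leI \<alpha>_def flip: ennreal_plus ennreal_mult)
    qed simp
  qed
  also have "\<dots> = (\<integral>\<^sup>+x. ennreal (A / V) * indicator ?B x
          + ennreal (A / V) * (ennreal ((\<bar>b x - c0\<bar> / A) ^ 4) * indicator ?B x) \<partial>lborel)
          + (\<integral>\<^sup>+x. ennreal (A * V) * ennreal ((T a x)\<^sup>2) \<partial>lborel)"
    by (intro nn_integral_add) measurable
  also have "(\<integral>\<^sup>+x. ennreal (A / V) * indicator ?B x
          + ennreal (A / V) * (ennreal ((\<bar>b x - c0\<bar> / A) ^ 4) * indicator ?B x) \<partial>lborel)
      = (\<integral>\<^sup>+x. ennreal (A / V) * indicator ?B x \<partial>lborel)
          + (\<integral>\<^sup>+x. ennreal (A / V) * (ennreal ((\<bar>b x - c0\<bar> / A) ^ 4) * indicator ?B x) \<partial>lborel)"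
    by (intro nn_integral_add) measurable
  also have "\<dots> + (\<integral>\<^sup>+x. ennreal (A * V) * ennreal ((T a x)\<^sup>2) \<partial>lborel)
      \<le> (ennreal (s ^ DIM('a) * A) + ennreal (C5 * A)) + ennreal (D2 * A)"
  proof (intro add_mono)
    show "(\<integral>\<^sup>+x. ennreal (A / V) * indicator ?B x \<partial>lborel) \<le> ennreal (s ^ DIM('a) * A)"
      using nn_integral_ball_const[OF sr, of "A / V" x0, unfolded vol_mult, folded V] A V_pos by (simp add: mult.commute)
    have "(\<integral>\<^sup>+x. ennreal (A / V) * (ennreal ((\<bar>b x - c0\<bar> / A) ^ 4) * indicator ?B x) \<partial>lborel)
        = ennreal (A / V) * (\<integral>\<^sup>+x\<in>?B. ennreal ((\<bar>b x - c0\<bar> / A) ^ 4) \<partial>lborel)"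
      by (intro nn_integral_cmult) measurable
    also have "\<dots> \<le> ennreal (A / V) * ennreal (C5 * V)" by (intro mult_left_mono near) auto
    also have "\<dots> = ennreal (C5 * A)" using A V_pos C5 by (simp add: mult.commute flip: ennreal_mult)
    finally show "(\<integral>\<^sup>+x. ennreal (A / V) * (ennreal ((\<bar>b x - c0\<bar> / A) ^ 4) * indicator ?B x) \<partial>lborel) \<le> ennreal (C5 * A)" .
    have "(\<integral>\<^sup>+x. ennreal (A * V) * ennreal ((T a x)\<^sup>2) \<partial>lborel) = ennreal (A * V) * (\<integral>\<^sup>+x. ennreal ((T a x)\<^sup>2) \<partial>lborel)"
      by (intro nn_integral_cmult) measurable
    also have "\<dots> \<le> ennreal (A * V) * (ennreal D2 * ennreal (1 / V))"
      by (intro mult_left_mono order_trans[OF T_L2[OF atom_L2]] L2) auto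
    also have "\<dots> = ennreal (D2 * A)"
      using A V_pos D2 by (simp add: mult.commute flip: ennreal_mult)
    finally show "(\<integral>\<^sup>+x. ennreal (A * V) * ennreal ((T a x)\<^sup>2) \<partial>lborel) \<le> ennreal (D2 * A)" .
  qed
  also have "\<dots> = ennreal ((s ^ DIM('a) + C5 + D2) * A)"
    using A C5 D2 s by (simp add: algebra_simps flip: ennreal_plus)
  finally show ?thesis .
qed

lemma near_bound_product:
  fixes a b :: "'a \<Rightarrow> real"
  assumes atom: "ball_atom a b x0 r A c0 C4 V" and s: "1 \<le> s"
  shows "(\<integral>\<^sup>+x\<in>ball x0 (s * r). ennreal \<bar>T (\<lambda>y. (b y - c0) * a y) x\<bar> \<partial>lborel) \<le> ennreal ((s ^ DIM('a) + D * (C4 + 1)) * A)"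
proof -
  interpret ball_atom a b x0 r A c0 C4 V by fact
  define h where "h = T (\<lambda>y. (b y - c0) * a y)"
  have [measurable]: "h \<in> borel_measurable borel"
    unfolding h_def by (rule Lp_measurable[OF T_Lp[OF product_Lp]])
  have sr: "0 < s * r" using r s by simp
  let ?B = "ball x0 (s * r)"
  \<comment> \<open>This comes from \<open>t \<le> 1 + t powr (4 / 3)\<close> at
    \<open>t = \<bar>h x\<bar> * V / A\<close>, multiplied by \<open>A / V\<close>. Its power of
    \<open>V / A\<close> cancels the one in \<open>product_L43\<close>.\<close>
  let ?k = "A / V * (V / A) powr (4 / 3)"
  have "(\<integral>\<^sup>+x\<in>?B. ennreal \<bar>h x\<bar> \<partial>lborel) \<le> (\<integral>\<^sup>+x. ennreal (A / V) * indicator ?B x + ennreal ?k * ennreal (\<bar>h x\<bar> powr (4 / 3)) \<partial>lborel)"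
  proof (intro nn_integral_mono)
    fix x
    have "\<bar>h x\<bar> * (V / A) \<le> 1 + (\<bar>h x\<bar> * (V / A)) powr (4 / 3)"
      using A V_pos by (intro le_one_plus_powr) auto
    then have "A / V * (\<bar>h x\<bar> * (V / A)) \<le> A / V * (1 + (\<bar>h x\<bar> * (V / A)) powr (4 / 3))"
      using A V_pos by (intro mult_left_mono) auto
    also have "A / V * (\<bar>h x\<bar> * (V / A)) = \<bar>h x\<bar>" using A V_pos by simp
    also have "(\<bar>h x\<bar> * (V / A)) powr (4 / 3) = \<bar>h x\<bar> powr (4 / 3) * (V / A) powr (4 / 3)"
      using A V_pos by (intro powr_mult)
    finally have "\<bar>h x\<bar> \<le> A / V + ?k * \<bar>h x\<bar> powr (4 / 3)" by (simp add: distrib_left mult_ac)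
    then have "ennreal \<bar>h x\<bar> \<le> ennreal (A / V + ?k * \<bar>h x\<bar> powr (4 / 3))" by (rule ennreal_leI)
    also have "\<dots> = ennreal (A / V) + ennreal ?k * ennreal (\<bar>h x\<bar> powr (4 / 3))"
      using A V_pos by (subst ennreal_plus) (auto simp flip: ennreal_mult)
    finally show "ennreal \<bar>h x\<bar> * indicator ?B x \<le> ennreal (A / V) * indicator ?B x + ennreal ?k * ennreal (\<bar>h x\<bar> powr (4 / 3))"
      by (auto split: split_indicator)
  qed
  also have "\<dots> = (\<integral>\<^sup>+x. ennreal (A / V) * indicator ?B x \<partial>lborel) + ennreal ?k * (\<integral>\<^sup>+x. ennreal (\<bar>h x\<bar> powr (4 / 3)) \<partial>lborel)"
    by (subst nn_integral_add) (auto simp: nn_integral_cmult)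
  also have "\<dots> \<le> ennreal (s ^ DIM('a) * A) + ennreal ?k * (ennreal D * ennreal ((A / V) powr (4 / 3) * ((C4 + 1) * V)))"
  proof (intro add_mono mult_left_mono)
    show "(\<integral>\<^sup>+x. ennreal (A / V) * indicator ?B x \<partial>lborel) \<le> ennreal (s ^ DIM('a) * A)"
      using nn_integral_ball_const[OF sr, of "A / V" x0, unfolded vol_mult, folded V] A V_pos by (simp add: mult.commute)
    show "(\<integral>\<^sup>+x. ennreal (\<bar>h x\<bar> powr (4 / 3)) \<partial>lborel) \<le> ennreal D * ennreal ((A / V) powr (4 / 3) * ((C4 + 1) * V))"
      unfolding h_def by (rule order_trans[OF T_bound[OF product_Lp]]) (intro mult_left_mono product_L43, simp)
  qed simp
  also have "ennreal ?k * (ennreal D * ennreal ((A / V) powr (4 / 3) * ((C4 + 1) * V))) = ennreal (D * (C4 + 1) * A)"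
  proof -
    have "(V / A) powr (4 / 3) * (A / V) powr (4 / 3) = 1"
      using A V_pos by (simp flip: powr_mult)
    moreover have "A / V * u * (D * (w * ((C4 + 1) * V))) = A / V * (D * ((C4 + 1) * V)) * (u * w)" for u w
      by (simp only: mult_ac)
    ultimately have "?k * (D * ((A / V) powr (4 / 3) * ((C4 + 1) * V))) = A / V * (D * ((C4 + 1) * V))"
      by simp
    also have "\<dots> = D * (C4 + 1) * A" using V_pos by simp
    finally show ?thesis using A V_pos D C4 by (simp flip: ennreal_mult)
  qed
  also have "ennreal (s ^ DIM('a) * A) + ennreal (D * (C4 + 1) * A) = ennreal ((s ^ DIM('a) + D * (C4 + 1)) * A)"
    using A C4 D s by (simp add: distrib_right)
  finally show ?thesis by (simp add: h_def)
qed

text \<open>Oscillation growth together with the \<open>m\<close> shells below radius 1 costs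
  \<open>(m + 2) ^ 2\<close>, the case \<open>e = 1\<close>; the hypothesis on
  \<open>\<integral> a\<close> repays it. The full family \<open>c\<close> appears because larger
  balls bring in their own constants.\<close>

lemma far_bound_atom:
  fixes a b :: "'a \<Rightarrow> real"
  assumes atom: "ball_atom a b x0 r A (c x0 r) C4 V" and osc: "osc_bound b c A"
    and m: "1 \<le> 2 ^ m * r" and I: "\<bar>\<integral>x. a x \<partial>lborel\<bar> * (real m + 2)\<^sup>2 \<le> \<kappa>"
  defines "U \<equiv> 2 ^ DIM('a) * unit_ball_vol (real DIM('a))"
  shows "(\<integral>\<^sup>+x\<in>- ball x0 (2 * real DIM('a) * r). ennreal \<bar>T a x\<bar> * ennreal \<bar>b x - c x0 r\<bar> \<partial>lborel)
    \<le> ennreal (C0 * (1 + 2 ^ DIM('a)) * U * (2 * dyadic_tail \<delta> + \<kappa> * (1 + dyadic_tail \<epsilon>)) * A)"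
proof -
  interpret ball_atom a b x0 r A "c x0 r" C4 V by fact
  define L where "L = (1 + 2 ^ DIM('a)) * A"
  have L: "0 \<le> L" using A by (simp add: L_def)
  have U: "0 \<le> U" by (simp add: U_def unit_ball_vol_nonneg)
  note tails = dyadic_tail_nonneg[OF \<delta>] dyadic_tail_nonneg[OF \<epsilon>]
  let ?F = "\<lambda>x. ennreal \<bar>b x - c x0 r\<bar>"
  have F: "(\<integral>\<^sup>+x\<in>ball x0 (2 ^ (j + 1) * r). ?F x \<partial>lborel) \<le> ennreal ((real j + 2) * L * vol TYPE('a) (2 ^ (j + 1) * r))" for j
    using osc_bound_dyadic[OF osc _ r, of x0 "j + 1"] A by (simp add: L_def add.commute)
  have "(\<integral>\<^sup>+x\<in>- ball x0 (2 * real DIM('a) * r). ennreal \<bar>T a x\<bar> * ?F x \<partial>lborel)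
      \<le> ennreal (C0 * 2 * (L * (U * dyadic_tail \<delta>)) + C0 * \<bar>\<integral>x. a x \<partial>lborel\<bar> * (L * (U * (1 + dyadic_tail \<epsilon>)) * (real m + 2) ^ (1 + 1)))"
  proof (rule far_integral_bound[OF atom_Lp supp r _ atom_L1])
    show "(\<integral>\<^sup>+x\<in>- ball x0 r. ennreal (r powr \<delta> * dist x x0 powr (- real DIM('a) - \<delta>)) * ?F x \<partial>lborel) \<le> ennreal (L * (U * dyadic_tail \<delta>))"
      unfolding U_def by (rule outside_ball_hoelder_weight[OF _ r L \<delta> F]) measurable
    show "(\<integral>\<^sup>+x\<in>- ball x0 r. ennreal (min (dist x x0 powr - real DIM('a)) (dist x x0 powr (- real DIM('a) - \<epsilon>))) * ?F x \<partial>lborel)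
        \<le> ennreal (L * (U * (1 + dyadic_tail \<epsilon>)) * (real m + 2) ^ (1 + 1))"
      unfolding U_def by (rule outside_ball_decay_weight[OF _ r L \<epsilon> _ m]) (use F in simp_all)
  qed (use L U tails in auto)
  also have "\<dots> \<le> ennreal (C0 * (1 + 2 ^ DIM('a)) * U * (2 * dyadic_tail \<delta> + \<kappa> * (1 + dyadic_tail \<epsilon>)) * A)"
  proof (rule ennreal_leI)
    have "C0 * \<bar>\<integral>x. a x \<partial>lborel\<bar> * (L * (U * (1 + dyadic_tail \<epsilon>)) * (real m + 2) ^ (1 + 1))
        = C0 * L * U * (1 + dyadic_tail \<epsilon>) * (\<bar>\<integral>x. a x \<partial>lborel\<bar> * (real m + 2)\<^sup>2)"
      by (simp add: power2_eq_square)
    also have "\<dots> \<le> C0 * L * U * (1 + dyadic_tail \<epsilon>) * \<kappa>"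
      using C0 L U tails by (intro mult_left_mono I mult_nonneg_nonneg) auto
    finally show "C0 * 2 * (L * (U * dyadic_tail \<delta>)) + C0 * \<bar>\<integral>x. a x \<partial>lborel\<bar> * (L * (U * (1 + dyadic_tail \<epsilon>)) * (real m + 2) ^ (1 + 1))
        \<le> C0 * (1 + 2 ^ DIM('a)) * U * (2 * dyadic_tail \<delta> + \<kappa> * (1 + dyadic_tail \<epsilon>)) * A"
      unfolding L_def by (simp add: algebra_simps)
  qed
  finally show ?thesis .
qed

text \<open>Here \<open>b\<close> sits inside \<open>T\<close>, so the outer weight is 1 and only
  the number of shells is paid: one factor \<open>m + 2\<close>, the case
  \<open>e = 0\<close>.\<close>

lemma far_bound_product:
  fixes a b :: "'a \<Rightarrow> real"
  assumes atom: "ball_atom a b x0 r A c0 C4 V"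
    and m: "1 \<le> 2 ^ m * r" and I: "\<bar>\<integral>x. (b x - c0) * a x \<partial>lborel\<bar> * (real m + 2) \<le> \<kappa> * A"
  defines "U \<equiv> 2 ^ DIM('a) * unit_ball_vol (real DIM('a))"
  shows "(\<integral>\<^sup>+x\<in>- ball x0 (2 * real DIM('a) * r). ennreal \<bar>T (\<lambda>y. (b y - c0) * a y) x\<bar> \<partial>lborel)
    \<le> ennreal (C0 * U * ((2 + C4) * dyadic_tail \<delta> + \<kappa> * (1 + dyadic_tail \<epsilon>)) * A)"
proof -
  interpret ball_atom a b x0 r A c0 C4 V by fact
  have U: "0 \<le> U" by (simp add: U_def unit_ball_vol_nonneg)
  note tails = dyadic_tail_nonneg[OF \<delta>] dyadic_tail_nonneg[OF \<epsilon>]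
  have F: "(\<integral>\<^sup>+x\<in>ball x0 (2 ^ (j + 1) * r). 1 \<partial>lborel) = ennreal (vol TYPE('a) (2 ^ (j + 1) * r))" for j
    using nn_integral_ball_const[of "2 ^ (j + 1) * r" 1 x0] r by simp
  have F': "emeasure lborel (ball x0 (2 * 2 ^ j * r)) = ennreal (vol TYPE('a) (2 * 2 ^ j * r))" for j
    using r by (intro emeasure_lborel_ball) simp
  have v0: "0 \<le> vol TYPE('a) (2 ^ (j + 1) * r)" for j
    using r by (intro less_imp_le vol_pos) simp
  have "(\<integral>\<^sup>+x\<in>- ball x0 (2 * real DIM('a) * r). ennreal \<bar>T (\<lambda>y. (b y - c0) * a y) x\<bar> * 1 \<partial>lborel)
      \<le> ennreal (C0 * ((2 + C4) * A) * (1 * (U * dyadic_tail \<delta>)) + C0 * \<bar>\<integral>x. (b x - c0) * a x \<partial>lborel\<bar> * (1 * (U * (1 + dyadic_tail \<epsilon>)) * (real m + 2) ^ (0 + 1)))"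
  proof (rule far_integral_bound[OF product_Lp _ r _ product_L1])
    show "(\<integral>\<^sup>+x\<in>- ball x0 r. ennreal (r powr \<delta> * dist x x0 powr (- real DIM('a) - \<delta>)) * 1 \<partial>lborel) \<le> ennreal (1 * (U * dyadic_tail \<delta>))"
      unfolding U_def
    proof (rule outside_ball_hoelder_weight[OF _ r _ \<delta>])
      show "(\<integral>\<^sup>+x\<in>ball x0 (2 ^ (j + 1) * r). 1 \<partial>lborel) \<le> ennreal ((real j + 2) * 1 * vol TYPE('a) (2 ^ (j + 1) * r))" for j
        unfolding F using v0[of j] by (intro ennreal_leI) (simp add: algebra_simps)
    qed auto
    show "(\<integral>\<^sup>+x\<in>- ball x0 r. ennreal (min (dist x x0 powr - real DIM('a)) (dist x x0 powr (- real DIM('a) - \<epsilon>))) * 1 \<partial>lborel)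
        \<le> ennreal (1 * (U * (1 + dyadic_tail \<epsilon>)) * (real m + 2) ^ (0 + 1))"
      unfolding U_def by (rule outside_ball_decay_weight[OF _ r _ \<epsilon> _ m]) (simp_all add: F')
  qed (use U tails A C4 supp in auto)
  also have "\<dots> \<le> ennreal (C0 * U * ((2 + C4) * dyadic_tail \<delta> + \<kappa> * (1 + dyadic_tail \<epsilon>)) * A)"
  proof (rule ennreal_leI)
    have "C0 * \<bar>\<integral>x. (b x - c0) * a x \<partial>lborel\<bar> * (1 * (U * (1 + dyadic_tail \<epsilon>)) * (real m + 2) ^ (0 + 1))
        = C0 * U * (1 + dyadic_tail \<epsilon>) * (\<bar>\<integral>x. (b x - c0) * a x \<partial>lborel\<bar> * (real m + 2))"
      by simp
    also have "\<dots> \<le> C0 * U * (1 + dyadic_tail \<epsilon>) * (\<kappa> * A)"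
      using C0 U tails by (intro mult_left_mono I mult_nonneg_nonneg) auto
    finally show "C0 * ((2 + C4) * A) * (1 * (U * dyadic_tail \<delta>)) + C0 * \<bar>\<integral>x. (b x - c0) * a x \<partial>lborel\<bar> * (1 * (U * (1 + dyadic_tail \<epsilon>)) * (real m + 2) ^ (0 + 1))
        \<le> C0 * U * ((2 + C4) * dyadic_tail \<delta> + \<kappa> * (1 + dyadic_tail \<epsilon>)) * A"
      by (simp add: algebra_simps)
  qed
  finally show ?thesis by simp
qed

text \<open>Linearity is applied to \<open>b * a = c0 * a + (b - c0) * a\<close>. Both summands lie
  in \<open>Lp (4 / 3)\<close>, whereas \<open>b * a\<close> is not known to be in
  \<open>Lp 2\<close>.\<close>

lemma commutator_split:
  fixes a b :: "'a \<Rightarrow> real"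
  assumes "ball_atom a b x0 r A c0 C4 V"
  shows "(\<lambda>x. b x * a x) \<in> Lp (4 / 3)"
    and "commutator b T a \<in> borel_measurable borel"
    and "AE x in lborel. commutator b T a x = T a x * (b x - c0) - T (\<lambda>y. (b y - c0) * a y) x"
proof -
  interpret ball_atom a b x0 r A c0 C4 V by fact
  have eq: "(\<lambda>x. c0 * a x + (b x - c0) * a x) = (\<lambda>x. b x * a x)"
    by (auto simp: algebra_simps)
  show ba: "(\<lambda>x. b x * a x) \<in> Lp (4 / 3)"
    using Lp_add[OF Lp_cmult[OF atom_Lp, of c0] product_Lp] by (simp add: eq)
  note [measurable] = Lp_measurable[OF T_Lp[OF atom_Lp]] Lp_measurable[OF T_Lp[OF ba]]
  show "commutator b T a \<in> borel_measurable borel"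
    unfolding commutator_def by measurable
  show "AE x in lborel. commutator b T a x = T a x * (b x - c0) - T (\<lambda>y. (b y - c0) * a y) x"
    using T_linear[OF atom_Lp product_Lp, of c0] unfolding eq commutator_def
    by eventually_elim (simp add: algebra_simps)
qed

theorem commutator_atom_bound:
  assumes C4: "0 \<le> C4" and \<kappa>: "0 \<le> \<kappa>"
  obtains M where "0 \<le> M"
    "\<And>(b::'a \<Rightarrow> real) c A a x0 r m. osc_bound b c A \<Longrightarrow>
       (\<And>x r. 0 < r \<Longrightarrow> (\<integral>\<^sup>+y\<in>ball x r. ennreal ((\<bar>b y - c x r\<bar> / A) ^ 4) \<partial>lborel) \<le> ennreal (C4 * vol TYPE('a) r)) \<Longrightarrow>
       ball_atom a b x0 r A (c x0 r) C4 (vol TYPE('a) r) \<Longrightarrow> 1 \<le> 2 ^ m * r \<Longrightarrow>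
       \<bar>\<integral>x. a x \<partial>lborel\<bar> * (real m + 2)\<^sup>2 \<le> \<kappa> \<Longrightarrow>
       \<bar>\<integral>x. (b x - c x0 r) * a x \<partial>lborel\<bar> * (real m + 2) \<le> \<kappa> * A \<Longrightarrow>
       (\<integral>\<^sup>+x. ennreal \<bar>commutator b T a x\<bar> \<partial>lborel) \<le> ennreal (M * A)"
proof -
  \<comment> \<open>The dividing radius \<open>s * r\<close> is the one from which on
    \<open>kernel_representation\<close> applies. \<open>M1\<close> and \<open>M2\<close> bound the
    term with \<open>T a\<close> near and far, \<open>M3\<close> and \<open>M4\<close> the term with
    the product; none of them depends on \<open>b\<close>, \<open>a\<close>, \<open>r\<close> or
    \<open>m\<close>.\<close>
  define s where "s = 2 * real DIM('a)"
  define C5 where "C5 = (8 * C4 + 8 * (1 + s ^ DIM('a)) ^ 4) * s ^ DIM('a)"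
  define U where "U = 2 ^ DIM('a) * unit_ball_vol (real DIM('a))"
  define M1 where "M1 = s ^ DIM('a) + C5 + D2"
  define M2 where "M2 = C0 * (1 + 2 ^ DIM('a)) * U * (2 * dyadic_tail \<delta> + \<kappa> * (1 + dyadic_tail \<epsilon>))"
  define M3 where "M3 = s ^ DIM('a) + D * (C4 + 1)"
  define M4 where "M4 = C0 * U * ((2 + C4) * dyadic_tail \<delta> + \<kappa> * (1 + dyadic_tail \<epsilon>))"
  have s1: "1 \<le> s" using DIM_positive[where 'a='a] unfolding s_def by linarith
  have U: "0 \<le> U" by (simp add: U_def unit_ball_vol_nonneg)
  have C5: "0 \<le> C5" using s1 C4 by (simp add: C5_def)
  note tails = dyadic_tail_nonneg[OF \<delta>] dyadic_tail_nonneg[OF \<epsilon>]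
  have M0: "0 \<le> M1" "0 \<le> M2" "0 \<le> M3" "0 \<le> M4"
    using s1 C4 C5 \<kappa> U tails C0 D D2 by (simp_all add: M1_def M2_def M3_def M4_def)
  show thesis
  proof (rule that[of "M1 + M2 + M3 + M4"])
    fix b :: "'a \<Rightarrow> real" and c :: "'a \<Rightarrow> real \<Rightarrow> real" and A :: real and a :: "'a \<Rightarrow> real" and x0 :: 'a and r :: real and m :: nat
    assume osc: "osc_bound b c A"
      and JN: "\<And>x r. 0 < r \<Longrightarrow> (\<integral>\<^sup>+y\<in>ball x r. ennreal ((\<bar>b y - c x r\<bar> / A) ^ 4) \<partial>lborel) \<le> ennreal (C4 * vol TYPE('a) r)"
      and atom: "ball_atom a b x0 r A (c x0 r) C4 (vol TYPE('a) r)" and m: "1 \<le> 2 ^ m * r"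
      and I1: "\<bar>\<integral>x. a x \<partial>lborel\<bar> * (real m + 2)\<^sup>2 \<le> \<kappa>"
      and I2: "\<bar>\<integral>x. (b x - c x0 r) * a x \<partial>lborel\<bar> * (real m + 2) \<le> \<kappa> * A"
    interpret ball_atom a b x0 r A "c x0 r" C4 "vol TYPE('a) r" by fact
    let ?g = "\<lambda>y. (b y - c x0 r) * a y"
    note [measurable] = Lp_measurable[OF T_Lp[OF atom_Lp]] Lp_measurable[OF T_Lp[OF product_Lp]]
    have "(\<integral>\<^sup>+x. ennreal \<bar>commutator b T a x\<bar> \<partial>lborel)
        \<le> (\<integral>\<^sup>+x. ennreal \<bar>T a x\<bar> * ennreal \<bar>b x - c x0 r\<bar> + ennreal \<bar>T ?g x\<bar> \<partial>lborel)"
    proof (rule nn_integral_mono_AE)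
      show "AE x in lborel. ennreal \<bar>commutator b T a x\<bar> \<le> ennreal \<bar>T a x\<bar> * ennreal \<bar>b x - c x0 r\<bar> + ennreal \<bar>T ?g x\<bar>"
        using commutator_split(3)[OF atom]
      proof eventually_elim
        case (elim x)
        have "\<bar>commutator b T a x\<bar> \<le> \<bar>T a x\<bar> * \<bar>b x - c x0 r\<bar> + \<bar>T ?g x\<bar>"
          unfolding elim abs_mult[symmetric] by (rule abs_triangle_ineq4)
        then show ?case by (simp add: ennreal_leI flip: ennreal_plus ennreal_mult)
      qed
    qed
    also have "\<dots> = (\<integral>\<^sup>+x. ennreal \<bar>T a x\<bar> * ennreal \<bar>b x - c x0 r\<bar> \<partial>lborel) + (\<integral>\<^sup>+x. ennreal \<bar>T ?g x\<bar> \<partial>lborel)"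
      by (intro nn_integral_add) measurable
    also have "(\<integral>\<^sup>+x. ennreal \<bar>T a x\<bar> * ennreal \<bar>b x - c x0 r\<bar> \<partial>lborel)
        = (\<integral>\<^sup>+x\<in>ball x0 (s * r). ennreal \<bar>T a x\<bar> * ennreal \<bar>b x - c x0 r\<bar> \<partial>lborel)
        + (\<integral>\<^sup>+x\<in>- ball x0 (s * r). ennreal \<bar>T a x\<bar> * ennreal \<bar>b x - c x0 r\<bar> \<partial>lborel)"
      by (intro nn_integral_ball_split) measurable
    also have "(\<integral>\<^sup>+x. ennreal \<bar>T ?g x\<bar> \<partial>lborel)
        = (\<integral>\<^sup>+x\<in>ball x0 (s * r). ennreal \<bar>T ?g x\<bar> \<partial>lborel) + (\<integral>\<^sup>+x\<in>- ball x0 (s * r). ennreal \<bar>T ?g x\<bar> \<partial>lborel)"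
      by (intro nn_integral_ball_split) measurable
    also have "(\<integral>\<^sup>+x\<in>ball x0 (s * r). ennreal \<bar>T a x\<bar> * ennreal \<bar>b x - c x0 r\<bar> \<partial>lborel)
        + (\<integral>\<^sup>+x\<in>- ball x0 (s * r). ennreal \<bar>T a x\<bar> * ennreal \<bar>b x - c x0 r\<bar> \<partial>lborel)
        + ((\<integral>\<^sup>+x\<in>ball x0 (s * r). ennreal \<bar>T ?g x\<bar> \<partial>lborel) + (\<integral>\<^sup>+x\<in>- ball x0 (s * r). ennreal \<bar>T ?g x\<bar> \<partial>lborel))
        \<le> ennreal (M1 * A) + ennreal (M2 * A) + (ennreal (M3 * A) + ennreal (M4 * A))"
    proof (intro add_mono)
      show "(\<integral>\<^sup>+x\<in>ball x0 (s * r). ennreal \<bar>T a x\<bar> * ennreal \<bar>b x - c x0 r\<bar> \<partial>lborel) \<le> ennreal (M1 * A)"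
        unfolding M1_def using osc_power4_scale[OF osc A C4 r s1 JN]
        by (intro near_bound_atom[OF atom s1 C5]) (simp add: C5_def)
      show "(\<integral>\<^sup>+x\<in>- ball x0 (s * r). ennreal \<bar>T a x\<bar> * ennreal \<bar>b x - c x0 r\<bar> \<partial>lborel) \<le> ennreal (M2 * A)"
        unfolding M2_def s_def U_def by (rule far_bound_atom[OF atom osc m I1])
      show "(\<integral>\<^sup>+x\<in>ball x0 (s * r). ennreal \<bar>T ?g x\<bar> \<partial>lborel) \<le> ennreal (M3 * A)"
        unfolding M3_def by (rule near_bound_product[OF atom s1])
      show "(\<integral>\<^sup>+x\<in>- ball x0 (s * r). ennreal \<bar>T ?g x\<bar> \<partial>lborel) \<le> ennreal (M4 * A)"
        unfolding M4_def s_def U_def by (rule far_bound_product[OF atom m I2])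
    qed
    also have "\<dots> = ennreal ((M1 + M2 + M3 + M4) * A)"
      using M0 A by (simp add: distrib_right add.assoc flip: ennreal_plus)
    finally show "(\<integral>\<^sup>+x. ennreal \<bar>commutator b T a x\<bar> \<partial>lborel) \<le> ennreal ((M1 + M2 + M3 + M4) * A)" .
  qed (use M0 in simp)
qed

end

section \<open>Local BMO and approximate atoms\<close>

lemma bmo_set_integrable:
  assumes "b \<in> bmo" "0 < r"
  shows "set_integrable lborel (ball x r) (\<lambda>y. \<bar>b y - t\<bar>)"
proof -
  have "set_integrable lborel (ball x r) b" using assms by (auto simp: bmo_def)
  moreover have "set_integrable lborel (ball x r) (\<lambda>y. t)"
    unfolding set_integrable_def using emeasure_bounded_finite[of "ball x r"] by simp
  ultimately have "set_integrable lborel (ball x r) (\<lambda>y. b y - t)" by (rule set_integral_diff)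
  then show ?thesis by (rule set_integrable_abs)
qed

lemma ball_avg_le_bmo_norm:
  fixes x :: "'a::euclidean_space"
  assumes "b \<in> bmo" "0 < r"
  shows "ball_avg (\<lambda>y. \<bar>b y - cB b x r\<bar>) x r \<le> bmo_norm b"
proof -
  let ?f = "\<lambda>(x::'a, r). ball_avg (\<lambda>y. \<bar>b y - cB b x r\<bar>) x r"
  have "bdd_above {ball_avg (\<lambda>y. \<bar>b y - cB b x r\<bar>) x r | x r. 0 < r}"
    using assms by (simp add: bmo_def)
  also have "{ball_avg (\<lambda>y. \<bar>b y - cB b x r\<bar>) x r | x r. 0 < r} = ?f ` (UNIV \<times> {0<..})"
    by (auto simp: image_def)
  finally have "?f (x, r) \<le> (SUP p\<in>UNIV \<times> {0<..}. ?f p)"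
    using assms by (intro cSUP_upper) auto
  then show ?thesis by (simp add: bmo_norm_def)
qed

lemma bmo_norm_nonneg:
  fixes b :: "'a::euclidean_space \<Rightarrow> real"
  assumes "b \<in> bmo"
  shows "0 \<le> bmo_norm b"
proof -
  have "0 \<le> ball_avg (\<lambda>y. \<bar>b y - cB b (0::'a) 1\<bar>) 0 1"
    unfolding ball_avg_def set_lebesgue_integral_def by (intro divide_nonneg_nonneg integral_nonneg_AE) auto
  also have "\<dots> \<le> bmo_norm b" using assms by (intro ball_avg_le_bmo_norm) auto
  finally show ?thesis .
qed

text \<open>A Bochner integral of a non-integrable function is 0 by default; local integrability,
  part of \<open>bmo\<close>, is what makes the averages agree with nonnegative integrals.\<close>

lemma bmo_osc_bound:
  fixes b :: "'a::euclidean_space \<Rightarrow> real"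
  assumes "b \<in> bmo" "bmo_norm b \<le> A"
  shows "osc_bound b (cB b) A"
  unfolding osc_bound_def
proof (intro conjI allI impI)
  show "b \<in> borel_measurable borel" using assms by (simp add: bmo_def)
  fix x :: 'a and r :: real assume r: "0 < r"
  let ?f = "\<lambda>y. indicator (ball x r) y *\<^sub>R \<bar>b y - cB b x r\<bar>"
  have int: "integrable lborel ?f"
    using bmo_set_integrable[OF assms(1) r] by (simp add: set_integrable_def)
  have "(\<integral>\<^sup>+y\<in>ball x r. ennreal \<bar>b y - cB b x r\<bar> \<partial>lborel) = (\<integral>\<^sup>+y. ennreal (?f y) \<partial>lborel)"
    by (intro nn_integral_cong) (auto split: split_indicator)
  also have "\<dots> = ennreal (\<integral>y. ?f y \<partial>lborel)"
    by (intro nn_integral_eq_integral int) auto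
  also have "(\<integral>y. ?f y \<partial>lborel) = ball_avg (\<lambda>y. \<bar>b y - cB b x r\<bar>) x r * vol TYPE('a) r"
    using vol_pos[OF r, where 'a='a]
    by (simp add: ball_avg_def set_lebesgue_integral_def measure_lborel_ball[OF r])
  also have "\<dots> \<le> A * vol TYPE('a) r"
    using ball_avg_le_bmo_norm[OF assms(1) r, of x] assms(2) vol_pos[OF r, where 'a='a]
    by (intro mult_right_mono) auto
  finally show "(\<integral>\<^sup>+y\<in>ball x r. ennreal \<bar>b y - cB b x r\<bar> \<partial>lborel) \<le> ennreal (A * vol TYPE('a) r)"
    by (simp add: ennreal_leI)
qed

text \<open>The second cancellation condition is measured by \<open>bmo2_norm\<close>, the final
  estimate by \<open>bmo_norm\<close>. The fourth moments bridge the two through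
  \<open>t ^ 2 \<le> 1 + t ^ 4\<close>.\<close>

lemma bmo2_norm_le:
  fixes b :: "'a::euclidean_space \<Rightarrow> real"
  assumes "b \<in> borel_measurable borel" "0 < A" "0 \<le> C4"
    and JN: "\<And>x r. 0 < r \<Longrightarrow> (\<integral>\<^sup>+y\<in>ball x r. ennreal ((\<bar>b y - cB b x r\<bar> / A) ^ 4) \<partial>lborel) \<le> ennreal (C4 * vol TYPE('a) r)"
  shows "bmo2_norm b \<le> (1 + C4) * A"
proof -
  note [measurable] = assms(1)
  have "sqrt (ball_avg (\<lambda>y. (b y - cB b x r)\<^sup>2) x r) \<le> (1 + C4) * A" if r: "0 < r" for x :: 'a and r
  proof -
    let ?V = "vol TYPE('a) r"
    have V: "0 < ?V" using r by (rule vol_pos)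
    have "(\<integral>\<^sup>+y. ennreal (indicator (ball x r) y *\<^sub>R (b y - cB b x r)\<^sup>2) \<partial>lborel)
        \<le> (\<integral>\<^sup>+y. ennreal (A\<^sup>2) * indicator (ball x r) y + ennreal (A\<^sup>2) * (ennreal ((\<bar>b y - cB b x r\<bar> / A) ^ 4) * indicator (ball x r) y) \<partial>lborel)"
    proof (intro nn_integral_mono)
      fix y
      define \<alpha> where "\<alpha> = \<bar>b y - cB b x r\<bar> / A"
      have "\<alpha>\<^sup>2 \<le> 1 + (\<alpha>\<^sup>2) ^ Suc 1" by (intro le_one_plus_power) auto
      then have "A\<^sup>2 * \<alpha>\<^sup>2 \<le> A\<^sup>2 * (1 + \<alpha> ^ 4)" by (intro mult_left_mono) auto
      moreover have "A\<^sup>2 * \<alpha>\<^sup>2 = (b y - cB b x r)\<^sup>2"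
        using assms(2) by (simp add: \<alpha>_def power_divide)
      ultimately have "ennreal ((b y - cB b x r)\<^sup>2) \<le> ennreal (A\<^sup>2 + A\<^sup>2 * \<alpha> ^ 4)"
        by (intro ennreal_leI) (simp add: distrib_left)
      also have "\<dots> = ennreal (A\<^sup>2) + ennreal (A\<^sup>2) * ennreal (\<alpha> ^ 4)"
        using assms(2) by (subst ennreal_plus) (auto simp: \<alpha>_def simp flip: ennreal_mult)
      finally show "ennreal (indicator (ball x r) y *\<^sub>R (b y - cB b x r)\<^sup>2)
          \<le> ennreal (A\<^sup>2) * indicator (ball x r) y + ennreal (A\<^sup>2) * (ennreal ((\<bar>b y - cB b x r\<bar> / A) ^ 4) * indicator (ball x r) y)"
        by (auto simp: \<alpha>_def split: split_indicator)
    qed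
    also have "\<dots> = ennreal (A\<^sup>2 * ?V) + ennreal (A\<^sup>2) * (\<integral>\<^sup>+y\<in>ball x r. ennreal ((\<bar>b y - cB b x r\<bar> / A) ^ 4) \<partial>lborel)"
      using nn_integral_ball_const[OF r, of "A\<^sup>2" x]
      by (subst nn_integral_add) (auto simp: nn_integral_cmult)
    also have "\<dots> \<le> ennreal (A\<^sup>2 * ?V) + ennreal (A\<^sup>2) * ennreal (C4 * ?V)"
      by (intro add_left_mono mult_left_mono JN r) auto
    also have "\<dots> = ennreal ((1 + C4) * A\<^sup>2 * ?V)"
      using V assms(3) by (simp add: algebra_simps flip: ennreal_mult ennreal_plus)
    finally have "(\<integral>y. indicator (ball x r) y *\<^sub>R (b y - cB b x r)\<^sup>2 \<partial>lborel) \<le> (1 + C4) * A\<^sup>2 * ?V"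
      using V assms(3) by (intro integral_real_bounded) auto
    then have "ball_avg (\<lambda>y. (b y - cB b x r)\<^sup>2) x r \<le> (1 + C4) * A\<^sup>2"
      using V by (simp add: ball_avg_def set_lebesgue_integral_def measure_lborel_ball[OF r] divide_le_eq)
    also have "\<dots> \<le> (1 + C4)\<^sup>2 * A\<^sup>2"
      using assms(3) by (intro mult_right_mono) (auto simp: power2_eq_square algebra_simps)
    also have "\<dots> = ((1 + C4) * A)\<^sup>2" by (simp add: power_mult_distrib)
    finally have "sqrt (ball_avg (\<lambda>y. (b y - cB b x r)\<^sup>2) x r) \<le> sqrt (((1 + C4) * A)\<^sup>2)" by (rule real_sqrt_le_mono)
    also have "\<dots> = (1 + C4) * A" using assms by simp
    finally show ?thesis .
  qed
  then show ?thesis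
    unfolding bmo2_norm_def by (intro cSUP_least) auto
qed

text \<open>\<open>m\<close> is the binary logarithm of \<open>1 / r\<close>, rounded up, or 0 for
  large balls: the number of doublings after which the radius is at least 1.\<close>

lemma dyadic_exponent_exists:
  assumes "0 < (r::real)"
  obtains m :: nat where "1 \<le> 2 ^ m * r" "1 \<le> r \<Longrightarrow> m = 0" "r < 1 \<Longrightarrow> real m + 2 \<le> 6 * ln (1 + 1 / r)"
proof (cases "1 \<le> r")
  case True
  then show ?thesis using that[of 0] by simp
next
  case False
  define m where "m = nat \<lceil>log 2 (1 / r)\<rceil>"
  have l0: "0 < log 2 (1 / r)" using assms False by (simp add: field_simps)
  have ml: "log 2 (1 / r) \<le> real m" "real m \<le> log 2 (1 / r) + 1"
    using l0 unfolding m_def by linarith+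
  have "1 / r = 2 powr log 2 (1 / r)" using assms by simp
  also have "\<dots> \<le> 2 powr real m" using ml by (intro powr_mono) auto
  also have "\<dots> = 2 ^ m" by (simp add: powr_realpow)
  finally have m1: "1 \<le> 2 ^ m * r" using assms by (simp add: field_simps)
  define l where "l = ln (1 + 1 / r)"
  have ln2: "2 / 3 \<le> ln (2::real)" by (rule ln2_ge_two_thirds)
  have "ln 2 \<le> l" unfolding l_def using assms False by (subst ln_le_cancel_iff) (auto simp: field_simps)
  have "ln (1 / r) \<le> l" unfolding l_def using assms by (subst ln_le_cancel_iff) (auto simp: field_simps add_pos_pos)
  have "log 2 (1 / r) * ln 2 = ln (1 / r)" by (simp add: log_def)
  then have "log 2 (1 / r) * (2 / 3) \<le> l"
    using mult_left_mono[OF ln2, of "log 2 (1 / r)"] l0 \<open>ln (1 / r) \<le> l\<close> by linarith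
  \<comment> \<open>The binary logarithm is at most \<open>3 / 2 * l\<close>, and the remaining
    summand 3 is at most \<open>9 / 2 * l\<close> because \<open>l \<ge> ln 2 \<ge> 2 / 3\<close>;
    together these give 6.\<close>
  then have "real m + 2 \<le> 6 * l" using ml(2) ln2 \<open>ln 2 \<le> l\<close> by linarith
  then show ?thesis using that[of m] m1 False by (simp add: l_def)
qed

text \<open>Translates powers of \<open>ln (1 + 1 / r)\<close> into powers of \<open>m + 2\<close>.
  The constant \<open>48 + 6 * C4\<close> is chosen to dominate all four bounds of the case
  distinction.\<close>

lemma approx_atom_ball_atom:
  fixes a b :: "'a::euclidean_space \<Rightarrow> real"
  assumes b: "b \<in> borel_measurable borel" and A: "0 < A" and C4: "0 \<le> C4"
    and JN: "\<And>x r. 0 < r \<Longrightarrow> (\<integral>\<^sup>+y\<in>ball x r. ennreal ((\<bar>b y - cB b x r\<bar> / A) ^ 4) \<partial>lborel) \<le> ennreal (C4 * vol TYPE('a) r)"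
    and a: "approx_atom b a"
  obtains x0 r m where "ball_atom a b x0 r A (cB b x0 r) C4 (vol TYPE('a) r)" "1 \<le> 2 ^ m * r"
    "\<bar>\<integral>x. a x \<partial>lborel\<bar> * (real m + 2)\<^sup>2 \<le> 48 + 6 * C4"
    "\<bar>\<integral>x. (b x - cB b x0 r) * a x \<partial>lborel\<bar> * (real m + 2) \<le> (48 + 6 * C4) * A"
proof -
  obtain x0 r where r: "0 < r" and meas: "a \<in> borel_measurable lborel" and supp: "\<forall>x. x \<notin> ball x0 r \<longrightarrow> a x = 0"
    and int: "integrable lborel (\<lambda>x. (a x)\<^sup>2)"
    and L2: "sqrt (\<integral>x. (a x)\<^sup>2 \<partial>lborel) \<le> measure lborel (ball x0 r) powr (-1/2)"
    and I1: "\<bar>\<integral>x. a x \<partial>lborel\<bar> \<le> (ln (1 + 1 / r)) powr (-2)"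
    and I2: "\<bar>\<integral>x. a x * (b x - cB b x0 r) \<partial>lborel\<bar> \<le> bmo2_norm b * (ln (1 + 1 / r)) powr (-1)"
    using a unfolding approx_atom_def by (elim exE conjE) (rule that)
  let ?V = "vol TYPE('a) r"
  have V: "0 < ?V" using r by (rule vol_pos)
  have "(\<integral>\<^sup>+x. ennreal ((a x)\<^sup>2) \<partial>lborel) = ennreal (\<integral>x. (a x)\<^sup>2 \<partial>lborel)"
    by (intro nn_integral_eq_integral int) auto
  also have "\<dots> \<le> ennreal (1 / ?V)"
  proof (rule ennreal_leI)
    have nonneg: "0 \<le> (\<integral>x. (a x)\<^sup>2 \<partial>lborel)" by (intro integral_nonneg_AE) auto
    then have "(\<integral>x. (a x)\<^sup>2 \<partial>lborel) = (sqrt (\<integral>x. (a x)\<^sup>2 \<partial>lborel))\<^sup>2" by simp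
    also have "\<dots> \<le> (?V powr (-1/2))\<^sup>2"
      using L2 nonneg by (intro power_mono) (auto simp: measure_lborel_ball[OF r])
    also have "\<dots> = ?V powr (-1/2 + -1/2)" by (simp add: power2_eq_square powr_add[symmetric])
    also have "\<dots> = 1 / ?V" using V by (simp add: powr_minus_divide)
    finally show "(\<integral>x. (a x)\<^sup>2 \<partial>lborel) \<le> 1 / ?V" .
  qed
  finally have L2': "(\<integral>\<^sup>+x. ennreal ((a x)\<^sup>2) \<partial>lborel) \<le> ennreal (1 / ?V)" .
  have atom: "ball_atom a b x0 r A (cB b x0 r) C4 ?V"
    by unfold_locales (use r A C4 meas b supp L2' JN[OF r] in auto)
  interpret ball_atom a b x0 r A "cB b x0 r" C4 ?V by (rule atom)
  obtain m where m: "1 \<le> 2 ^ m * r" "1 \<le> r \<Longrightarrow> m = 0" "r < 1 \<Longrightarrow> real m + 2 \<le> 6 * ln (1 + 1 / r)"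
    using dyadic_exponent_exists[OF r] by blast
  have abs_le: "\<bar>\<integral>x. f x \<partial>lborel\<bar> \<le> N" if "(\<integral>\<^sup>+x. ennreal \<bar>f x\<bar> \<partial>lborel) \<le> ennreal N" "0 \<le> N" for f :: "'a \<Rightarrow> real" and N
    using integral_abs_bound[of lborel f] integral_real_bounded[OF that(2,1)] by linarith
  have "bmo2_norm b \<le> (1 + C4) * A" by (rule bmo2_norm_le[OF b A C4 JN])
  have comm: "(\<integral>x. a x * (b x - cB b x0 r) \<partial>lborel) = (\<integral>x. (b x - cB b x0 r) * a x \<partial>lborel)"
    by (simp add: mult.commute)
  have "\<bar>\<integral>x. a x \<partial>lborel\<bar> * (real m + 2)\<^sup>2 \<le> 48 + 6 * C4
      \<and> \<bar>\<integral>x. (b x - cB b x0 r) * a x \<partial>lborel\<bar> * (real m + 2) \<le> (48 + 6 * C4) * A"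
  proof (cases "1 \<le> r")
    \<comment> \<open>For large \<open>r\<close> the logarithm is small and the cancellation
      conditions carry little information, but \<open>m = 0\<close>, so the plain \<open>L^1\<close>
      bounds suffice.\<close>
    case True
    have "\<bar>\<integral>x. (b x - cB b x0 r) * a x \<partial>lborel\<bar> \<le> (2 + C4) * A"
      using A C4 by (intro abs_le product_L1) auto
    then have "\<bar>\<integral>x. (b x - cB b x0 r) * a x \<partial>lborel\<bar> * 2 \<le> (2 + C4) * A * 2" by simp
    also have "\<dots> \<le> (48 + 6 * C4) * A" using A C4 by (simp add: algebra_simps)
    finally show ?thesis using True m(2) abs_le[OF atom_L1] C4 by simp
  next
    case False
    define l where "l = ln (1 + 1 / r)"
    have l: "0 < l" unfolding l_def using r by (intro ln_gt_zero) simp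
    have ml: "real m + 2 \<le> 6 * l" using m(3) False by (simp add: l_def)
    have "\<bar>\<integral>x. a x \<partial>lborel\<bar> * (real m + 2)\<^sup>2 \<le> l powr (-2) * (6 * l)\<^sup>2"
      using I1 ml by (intro mult_mono power_mono) (auto simp: l_def)
    also have "\<dots> = 36" using l by (simp add: powr_minus power_mult_distrib)
    finally have 1: "\<bar>\<integral>x. a x \<partial>lborel\<bar> * (real m + 2)\<^sup>2 \<le> 36" .
    have "\<bar>\<integral>x. (b x - cB b x0 r) * a x \<partial>lborel\<bar> \<le> (1 + C4) * A * l powr (-1)"
      using I2 mult_right_mono[OF \<open>bmo2_norm b \<le> (1 + C4) * A\<close>, of "l powr (-1)"] by (simp add: comm l_def)
    then have "\<bar>\<integral>x. (b x - cB b x0 r) * a x \<partial>lborel\<bar> * (real m + 2) \<le> (1 + C4) * A * l powr (-1) * (6 * l)"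
      using ml A C4 by (intro mult_mono) auto
    also have "\<dots> = 6 * (1 + C4) * A" using l by (simp add: powr_minus_divide)
    also have "\<dots> \<le> (48 + 6 * C4) * A" using A C4 by (simp add: algebra_simps)
    finally show ?thesis using 1 C4 by simp
  qed
  then show thesis using that[OF atom m(1)] by blast
qed

section \<open>From the singular integral hypotheses to the locale, and finite combinations\<close>

lemma Lp_bounded_nn_integral:
  fixes T :: "('a::euclidean_space \<Rightarrow> real) \<Rightarrow> 'a \<Rightarrow> real"
  assumes p: "0 < p" and bd: "\<exists>C. \<forall>f\<in>Lp p. T f \<in> Lp p \<and> Lp_norm p (T f) \<le> C * Lp_norm p f"
  obtains D where "0 \<le> D" "\<And>f. f \<in> Lp p \<Longrightarrow> T f \<in> Lp p"
    "\<And>f. f \<in> Lp p \<Longrightarrow> (\<integral>\<^sup>+x. ennreal (\<bar>T f x\<bar> powr p) \<partial>lborel) \<le> ennreal D * (\<integral>\<^sup>+x. ennreal (\<bar>f x\<bar> powr p) \<partial>lborel)"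
proof -
  obtain C where C: "\<And>f. f \<in> Lp p \<Longrightarrow> T f \<in> Lp p" "\<And>f. f \<in> Lp p \<Longrightarrow> Lp_norm p (T f) \<le> C * Lp_norm p f"
    using bd by blast
  have nn: "(\<integral>\<^sup>+x. ennreal (\<bar>f x\<bar> powr p) \<partial>lborel) = ennreal (\<integral>x. \<bar>f x\<bar> powr p \<partial>lborel)"
    if "f \<in> Lp p" for f :: "'a \<Rightarrow> real"
    using that by (intro nn_integral_eq_integral) (auto simp: Lp_def)
  have i0: "0 \<le> (\<integral>x. \<bar>f x\<bar> powr p \<partial>lborel)" for f :: "'a \<Rightarrow> real"
    by (intro integral_nonneg_AE) auto
  show thesis
  \<comment> \<open>The constant in the hypothesis carries no sign, so it is replaced by its
    positive part before powers are taken.\<close>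
  proof (rule that[of "max C 0 powr p"])
    fix f :: "'a \<Rightarrow> real" assume f: "f \<in> Lp p"
    let ?I = "\<integral>x. \<bar>f x\<bar> powr p \<partial>lborel" and ?J = "\<integral>x. \<bar>T f x\<bar> powr p \<partial>lborel"
    have "?J powr (1 / p) \<le> C * ?I powr (1 / p)" using C(2)[OF f] by (simp add: Lp_norm_def)
    also have "\<dots> \<le> max C 0 * ?I powr (1 / p)" by (intro mult_right_mono) auto
    finally have "(?J powr (1 / p)) powr p \<le> (max C 0 * ?I powr (1 / p)) powr p"
      using p by (intro powr_mono2) auto
    then have "?J \<le> max C 0 powr p * ?I"
      using p i0[of f] i0[of "T f"] by (simp add: powr_mult powr_powr)
    then have "ennreal ?J \<le> ennreal (max C 0 powr p) * ennreal ?I"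
      using i0[of f] by (simp add: ennreal_leI flip: ennreal_mult)
    then show "(\<integral>\<^sup>+x. ennreal (\<bar>T f x\<bar> powr p) \<partial>lborel) \<le> ennreal (max C 0 powr p) * (\<integral>\<^sup>+x. ennreal (\<bar>f x\<bar> powr p) \<partial>lborel)"
      by (simp add: nn[OF f] nn[OF C(1)[OF f]])
  qed (use C(1) in auto)
qed

lemma inhom_SIO_inhom_operator:
  fixes T :: "('a::euclidean_space \<Rightarrow> real) \<Rightarrow> 'a \<Rightarrow> real"
  assumes "inhom_SIO T K \<delta>"
  obtains D C0 D2 \<epsilon> where "inhom_operator T K D C0 D2 \<delta> \<epsilon>"
proof -
  note S1 = assms[unfolded inhom_SIO_def, THEN conjunct2, THEN conjunct2]
  note S2 = S1[THEN conjunct2] and S3 = S1[THEN conjunct2, THEN conjunct2]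
  note S4 = S3[THEN conjunct2, THEN conjunct2]
  have bd: "\<exists>C. \<forall>f\<in>Lp p. T f \<in> Lp p \<and> Lp_norm p (T f) \<le> C * Lp_norm p f" if "1 < p" for p
    using S1[THEN conjunct1] that by blast
  obtain D where D: "0 \<le> D" "\<And>f. f \<in> Lp (4 / 3) \<Longrightarrow> T f \<in> Lp (4 / 3)"
    "\<And>f. f \<in> Lp (4 / 3) \<Longrightarrow> (\<integral>\<^sup>+x. ennreal (\<bar>T f x\<bar> powr (4 / 3)) \<partial>lborel) \<le> ennreal D * (\<integral>\<^sup>+x. ennreal (\<bar>f x\<bar> powr (4 / 3)) \<partial>lborel)"
    using Lp_bounded_nn_integral[OF _ bd, of "4 / 3"] by auto
  have one_less_two: "1 < (2::real)" by simp
  obtain D2 where D2: "0 \<le> D2"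
    "\<And>f. f \<in> Lp 2 \<Longrightarrow> (\<integral>\<^sup>+x. ennreal (\<bar>T f x\<bar> powr 2) \<partial>lborel) \<le> ennreal D2 * (\<integral>\<^sup>+x. ennreal (\<bar>f x\<bar> powr 2) \<partial>lborel)"
    by (rule Lp_bounded_nn_integral[OF zero_less_numeral bd[OF one_less_two]]) (rule that)
  have sq: "\<bar>t\<bar> powr 2 = t\<^sup>2" for t :: real by (cases "t = 0") auto
  obtain \<epsilon> C0 where C0: "0 < \<epsilon>" "0 < C0"
    "\<forall>x y. x \<noteq> y \<longrightarrow> \<bar>K x y\<bar> \<le> C0 * min (dist x y powr - real DIM('a)) (dist x y powr (- real DIM('a) - \<epsilon>))"
    "\<forall>x y z. x \<noteq> y \<longrightarrow> 2 * dist y z \<le> dist x y \<longrightarrow>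
       \<bar>K x y - K x z\<bar> + \<bar>K y x - K z x\<bar> \<le> C0 * dist y z powr \<delta> * dist x y powr (- real DIM('a) - \<delta>)"
    using S4[THEN conjunct1] by (elim exE conjE) (rule that)
  have "inhom_operator T K D C0 D2 \<delta> \<epsilon>"
  proof unfold_locales
    show "AE x in lborel. T (\<lambda>y. c * f y + g y) x = c * T f x + T g x" if "f \<in> Lp (4 / 3)" "g \<in> Lp (4 / 3)" for f g c
    proof -
      have "(4 / 3 :: real) \<in> {1<..}" by simp
      then have "f \<in> (\<Union>p\<in>{1<..}. Lp p)" "g \<in> (\<Union>p\<in>{1<..}. Lp p)" using that by blast+
      then show ?thesis using S2[THEN conjunct1] by blast
    qed
    show "(\<lambda>(x, y). K x y) \<in> borel_measurable (lborel \<Otimes>\<^sub>M lborel)" by (rule S3[THEN conjunct1])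
    show "T f x = (\<integral>y. K x y * f y \<partial>lborel)" if "f \<in> Cc_inf" "x \<notin> fsupp f" for f x
      using S4[THEN conjunct2] that by blast
    show "\<bar>K x y\<bar> \<le> C0 * dist x y powr - real DIM('a)" if "x \<noteq> y" for x y
    proof -
      have "\<bar>K x y\<bar> \<le> C0 * min (dist x y powr - real DIM('a)) (dist x y powr (- real DIM('a) - \<epsilon>))"
        using C0(3) that by blast
      also have "\<dots> \<le> C0 * dist x y powr - real DIM('a)"
        using C0(2) by (intro mult_left_mono) auto
      finally show ?thesis .
    qed
    show "\<bar>K x y - K x z\<bar> \<le> C0 * dist y z powr \<delta> * dist x y powr (- real DIM('a) - \<delta>)"
      if "x \<noteq> y" "2 * dist y z \<le> dist x y" for x y z
    proof -
      have "\<bar>K x y - K x z\<bar> + \<bar>K y x - K z x\<bar> \<le> C0 * dist y z powr \<delta> * dist x y powr (- real DIM('a) - \<delta>)"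
        using C0(4) that by blast
      then show ?thesis by linarith
    qed
    show "0 < \<delta>" by (rule assms[unfolded inhom_SIO_def, THEN conjunct1])
  qed (use D D2 C0 in \<open>auto simp: sq\<close>)
  then show thesis by (rule that)
qed

lemma (in kernel_operator) commutator_lincomb:
  assumes "f \<in> Lp p" "(\<lambda>x. b x * f x) \<in> Lp p" "g \<in> Lp p" "(\<lambda>x. b x * g x) \<in> Lp p"
  shows "AE x in lborel. commutator b T (\<lambda>x. c * f x + g x) x = c * commutator b T f x + commutator b T g x"
proof -
  have eq: "(\<lambda>x. c * (b x * f x) + b x * g x) = (\<lambda>x. b x * (c * f x + g x))"
    by (simp add: algebra_simps)
  show ?thesis
    using T_linear[OF assms(1,3), of c] T_linear[OF assms(2,4), of c] unfolding eq commutator_def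
    by eventually_elim (simp add: algebra_simps)
qed

text \<open>Membership of both \<open>f\<close> and \<open>b * f\<close> in \<open>Lp p\<close> is
  carried through the induction, because \<open>T\<close> is linear only on such functions and the
  commutator applies it to both.\<close>

lemma (in kernel_operator) commutator_finite_combination:
  assumes N: "0 \<le> N"
    and atoms: "\<forall>(\<gamma>, a) \<in> set ps. a \<in> Lp p \<and> (\<lambda>x. b x * a x) \<in> Lp p \<and> b \<in> borel_measurable borel \<and>
      (\<integral>\<^sup>+x. ennreal \<bar>commutator b T a x\<bar> \<partial>lborel) \<le> ennreal N"
  defines "f \<equiv> \<lambda>x. \<Sum>(\<gamma>, a)\<leftarrow>ps. \<gamma> * a x"
  shows "f \<in> Lp p \<and> (\<lambda>x. b x * f x) \<in> Lp p \<and>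
    (\<integral>\<^sup>+x. ennreal \<bar>commutator b T f x\<bar> \<partial>lborel) \<le> ennreal (N * (\<Sum>(\<gamma>, a)\<leftarrow>ps. \<bar>\<gamma>\<bar>))"
  using atoms unfolding f_def
proof (induction ps)
  case Nil
  have zero: "(\<lambda>x. 0) \<in> Lp p" by (simp add: Lp_iff)
  \<comment> \<open>For the empty list, \<open>T\<close> of the zero function equals twice itself
    almost everywhere, hence vanishes.\<close>
  have "AE x in lborel. commutator b T (\<lambda>x. 0) x = 0"
    using T_linear[OF zero zero, of 1] by eventually_elim (simp add: commutator_def)
  then have "(\<integral>\<^sup>+x. ennreal \<bar>commutator b T (\<lambda>x. 0) x\<bar> \<partial>lborel) = (\<integral>\<^sup>+x. 0 \<partial>(lborel :: 'a measure))"
    by (intro nn_integral_cong_AE) auto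
  then show ?case using zero by simp
next
  case (Cons q ps)
  obtain \<gamma> a where q: "q = (\<gamma>, a)" by fastforce
  let ?f = "\<lambda>x. \<Sum>(\<gamma>, a)\<leftarrow>ps. \<gamma> * a x" and ?S = "\<Sum>(\<gamma>, a)\<leftarrow>ps. \<bar>\<gamma>\<bar>"
  have a: "a \<in> Lp p" "(\<lambda>x. b x * a x) \<in> Lp p" "(\<integral>\<^sup>+x. ennreal \<bar>commutator b T a x\<bar> \<partial>lborel) \<le> ennreal N"
    and b [measurable]: "b \<in> borel_measurable borel"
    using Cons.prems by (auto simp: q)
  have IH: "?f \<in> Lp p" "(\<lambda>x. b x * ?f x) \<in> Lp p"
    "(\<integral>\<^sup>+x. ennreal \<bar>commutator b T ?f x\<bar> \<partial>lborel) \<le> ennreal (N * ?S)"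
    using Cons by auto
  have S0: "0 \<le> ?S" by (intro sum_list_nonneg) auto
  have L: "(\<lambda>x. \<gamma> * a x + ?f x) \<in> Lp p"
    using p by (intro Lp_add Lp_cmult a IH) auto
  have "(\<lambda>x. \<gamma> * (b x * a x) + b x * ?f x) \<in> Lp p"
    using p by (intro Lp_add Lp_cmult a IH) auto
  then have Lb: "(\<lambda>x. b x * (\<gamma> * a x + ?f x)) \<in> Lp p" by (simp add: distrib_left mult.left_commute)
  have [measurable]: "commutator b T h \<in> borel_measurable borel" if "h \<in> Lp p" "(\<lambda>x. b x * h x) \<in> Lp p" for h
    using Lp_measurable[OF T_Lp[OF that(1)]] Lp_measurable[OF T_Lp[OF that(2)]] b
    unfolding commutator_def by measurable
  have ma [measurable]: "commutator b T a \<in> borel_measurable borel" "commutator b T ?f \<in> borel_measurable borel"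
    using a IH by auto
  have "(\<integral>\<^sup>+x. ennreal \<bar>commutator b T (\<lambda>x. \<gamma> * a x + ?f x) x\<bar> \<partial>lborel)
      \<le> (\<integral>\<^sup>+x. ennreal \<bar>\<gamma>\<bar> * ennreal \<bar>commutator b T a x\<bar> + ennreal \<bar>commutator b T ?f x\<bar> \<partial>lborel)"
  proof (rule nn_integral_mono_AE)
    show "AE x in lborel. ennreal \<bar>commutator b T (\<lambda>x. \<gamma> * a x + ?f x) x\<bar>
        \<le> ennreal \<bar>\<gamma>\<bar> * ennreal \<bar>commutator b T a x\<bar> + ennreal \<bar>commutator b T ?f x\<bar>"
      using commutator_lincomb[OF a(1,2) IH(1,2), of \<gamma>]
    proof eventually_elim
      case (elim x)
      have "\<bar>commutator b T (\<lambda>x. \<gamma> * a x + ?f x) x\<bar> \<le> \<bar>\<gamma>\<bar> * \<bar>commutator b T a x\<bar> + \<bar>commutator b T ?f x\<bar>"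
        unfolding elim abs_mult[symmetric] by (rule abs_triangle_ineq)
      then show ?case by (simp add: ennreal_leI flip: ennreal_plus ennreal_mult)
    qed
  qed
  also have "\<dots> = ennreal \<bar>\<gamma>\<bar> * (\<integral>\<^sup>+x. ennreal \<bar>commutator b T a x\<bar> \<partial>lborel) + (\<integral>\<^sup>+x. ennreal \<bar>commutator b T ?f x\<bar> \<partial>lborel)"
    using ma by (simp add: nn_integral_add nn_integral_cmult)
  also have "\<dots> \<le> ennreal \<bar>\<gamma>\<bar> * ennreal N + ennreal (N * ?S)"
    by (intro add_mono mult_left_mono a IH) auto
  also have "\<dots> = ennreal (N * (\<bar>\<gamma>\<bar> + ?S))"
    using N S0 by (simp add: distrib_left mult.commute flip: ennreal_mult ennreal_plus)
  finally show ?case using L Lb by (simp add: q)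
qed

theorem mainTheorem13:
  fixes T :: "('a::euclidean_space \<Rightarrow> real) \<Rightarrow> ('a \<Rightarrow> real)"
    and K :: "'a \<Rightarrow> 'a \<Rightarrow> real" and \<delta> :: real
  assumes "inhom_SIO T K \<delta>"
  shows "\<exists>C. (\<forall>b \<in> bmo. \<forall>a. approx_atom b a \<longrightarrow>
              commutator b T a \<in> borel_measurable lborel \<and>
              integrable lborel (commutator b T a) \<and>
              L1_norm (commutator b T a) \<le> C * bmo_norm b) \<and>
            (\<forall>b \<in> bmo. \<forall>f. atom_reps b f \<noteq> {} \<longrightarrow>
              L1_norm (commutator b T f)
                \<le> C * bmo_norm b * (INF ps \<in> atom_reps b f. \<Sum>(\<gamma>, a) \<leftarrow> ps. \<bar>\<gamma>\<bar>))"
proof -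
  obtain D C0 D2 \<epsilon> where "inhom_operator T K D C0 D2 \<delta> \<epsilon>"
    using inhom_SIO_inhom_operator[OF assms] by blast
  then interpret inhom_operator T K D C0 D2 \<delta> \<epsilon> .
  obtain C4 :: real where C4: "0 \<le> C4" and JN: "\<And>(b::'a \<Rightarrow> real) c A x r. osc_bound b c A \<Longrightarrow> 0 < A \<Longrightarrow> 0 < r \<Longrightarrow>
      (\<integral>\<^sup>+y\<in>ball x r. ennreal ((\<bar>b y - c x r\<bar> / A) ^ 4) \<partial>lborel) \<le> ennreal (C4 * vol TYPE('a) r)"
    using john_nirenberg[where 'a='a] by blast
  have "0 \<le> 48 + 6 * C4" using C4 by simp
  from commutator_atom_bound[OF C4 this] obtain M where M: "0 \<le> M"
    "\<And>(b::'a \<Rightarrow> real) c A a x0 r m. osc_bound b c A \<Longrightarrow>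
       (\<And>x r. 0 < r \<Longrightarrow> (\<integral>\<^sup>+y\<in>ball x r. ennreal ((\<bar>b y - c x r\<bar> / A) ^ 4) \<partial>lborel) \<le> ennreal (C4 * vol TYPE('a) r)) \<Longrightarrow>
       ball_atom a b x0 r A (c x0 r) C4 (vol TYPE('a) r) \<Longrightarrow> 1 \<le> 2 ^ m * r \<Longrightarrow>
       \<bar>\<integral>x. a x \<partial>lborel\<bar> * (real m + 2)\<^sup>2 \<le> 48 + 6 * C4 \<Longrightarrow>
       \<bar>\<integral>x. (b x - c x0 r) * a x \<partial>lborel\<bar> * (real m + 2) \<le> (48 + 6 * C4) * A \<Longrightarrow>
       (\<integral>\<^sup>+x. ennreal \<bar>commutator b T a x\<bar> \<partial>lborel) \<le> ennreal (M * A)"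
    by blast
  have atom_A: "a \<in> Lp (4 / 3) \<and> (\<lambda>x. b x * a x) \<in> Lp (4 / 3) \<and> commutator b T a \<in> borel_measurable borel \<and>
      (\<integral>\<^sup>+x. ennreal \<bar>commutator b T a x\<bar> \<partial>lborel) \<le> ennreal (M * A)"
    if b: "b \<in> bmo" and a: "approx_atom b a" and A: "0 < A" "bmo_norm b \<le> A" for a b :: "'a \<Rightarrow> real" and A
  proof -
    have osc: "osc_bound b (cB b) A" by (rule bmo_osc_bound[OF b A(2)])
    note jn = JN[OF osc A(1)]
    obtain x0 r m where *: "ball_atom a b x0 r A (cB b x0 r) C4 (vol TYPE('a) r)" "1 \<le> 2 ^ m * r"
      "\<bar>\<integral>x. a x \<partial>lborel\<bar> * (real m + 2)\<^sup>2 \<le> 48 + 6 * C4"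
      "\<bar>\<integral>x. (b x - cB b x0 r) * a x \<partial>lborel\<bar> * (real m + 2) \<le> (48 + 6 * C4) * A"
      using approx_atom_ball_atom[OF osc_boundD(1)[OF osc] A(1) C4 jn a] by blast
    show ?thesis
      using M(2)[OF osc jn *] commutator_split[OF *(1)] ball_atom.atom_Lp[OF *(1)] by blast
  qed
  have atom_bound: "a \<in> Lp (4 / 3) \<and> (\<lambda>x. b x * a x) \<in> Lp (4 / 3) \<and> commutator b T a \<in> borel_measurable borel \<and>
      (\<integral>\<^sup>+x. ennreal \<bar>commutator b T a x\<bar> \<partial>lborel) \<le> ennreal (M * bmo_norm b)"
    if b: "b \<in> bmo" and a: "approx_atom b a" for a b :: "'a \<Rightarrow> real"
  proof -
    have "(\<integral>\<^sup>+x. ennreal \<bar>commutator b T a x\<bar> \<partial>lborel) \<le> ennreal (M * (bmo_norm b + 1 / real (Suc n)))" for n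
      \<comment> \<open>The bound for positive \<open>A\<close> is used at
        \<open>A = bmo_norm b + 1 / (n + 1)\<close>; letting \<open>n\<close> grow reaches the norm
        itself, including the case of norm 0, in which division by \<open>A\<close> would
        fail.\<close>
      using bmo_norm_nonneg[OF b] by (intro atom_A[THEN conjunct2, THEN conjunct2, THEN conjunct2] b a) (auto intro: add_nonneg_pos)
    moreover have "(\<lambda>n. ennreal (M * (bmo_norm b + 1 / real (Suc n)))) \<longlonglongrightarrow> ennreal (M * (bmo_norm b + 0))"
      by (intro tendsto_intros LIMSEQ_Suc[OF lim_1_over_n])
    ultimately have "(\<integral>\<^sup>+x. ennreal \<bar>commutator b T a x\<bar> \<partial>lborel) \<le> ennreal (M * (bmo_norm b + 0))"
      by (intro LIMSEQ_le_const) auto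
    moreover have "0 < bmo_norm b + 1" using bmo_norm_nonneg[OF b] by simp
    ultimately show ?thesis using atom_A[OF b a, of "bmo_norm b + 1"] by simp
  qed
  show ?thesis
  proof (intro exI[of _ M] conjI ballI allI impI)
    fix b a :: "'a \<Rightarrow> real" assume b: "b \<in> bmo" and a: "approx_atom b a"
    note * = atom_bound[OF b a]
    show "commutator b T a \<in> borel_measurable lborel" using * by simp
    then show "integrable lborel (commutator b T a)"
      using * le_less_trans[OF _ ennreal_less_top] by (intro integrableI_bounded) auto
    show "L1_norm (commutator b T a) \<le> M * bmo_norm b"
      unfolding L1_norm_def using * M(1) bmo_norm_nonneg[OF b] by (intro integral_real_bounded) auto
  next
    fix b f :: "'a \<Rightarrow> real" assume b: "b \<in> bmo" and f: "atom_reps b f \<noteq> {}"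
    define N where "N = M * bmo_norm b"
    have N: "0 \<le> N" using M(1) bmo_norm_nonneg[OF b] by (simp add: N_def)
    have rep: "L1_norm (commutator b T f) \<le> N * (\<Sum>(\<gamma>, a)\<leftarrow>ps. \<bar>\<gamma>\<bar>)" if ps: "ps \<in> atom_reps b f" for ps
    proof -
      have f_eq: "f = (\<lambda>x. \<Sum>(\<gamma>, a)\<leftarrow>ps. \<gamma> * a x)" and atoms: "\<forall>(\<gamma>, a)\<in>set ps. approx_atom b a"
        using ps by (auto simp: atom_reps_def)
      have "(\<integral>\<^sup>+x. ennreal \<bar>commutator b T f x\<bar> \<partial>lborel) \<le> ennreal (N * (\<Sum>(\<gamma>, a)\<leftarrow>ps. \<bar>\<gamma>\<bar>))"
        unfolding f_eq using atoms atom_bound[OF b] b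
        by (intro commutator_finite_combination[OF N, THEN conjunct2, THEN conjunct2]) (auto simp: N_def bmo_def)
      then show ?thesis
        unfolding L1_norm_def using N
        by (intro integral_real_bounded mult_nonneg_nonneg sum_list_nonneg) auto
    qed
    show "L1_norm (commutator b T f) \<le> M * bmo_norm b * (INF ps\<in>atom_reps b f. \<Sum>(\<gamma>, a)\<leftarrow>ps. \<bar>\<gamma>\<bar>)"
    \<comment> \<open>For \<open>N > 0\<close> one divides by \<open>N\<close> and compares with the
      infimum. For \<open>N = 0\<close> any single representation already forces the
      \<open>L^1\<close> norm to be at most 0.\<close>
    proof (cases "N = 0")
      case True
      then show ?thesis using f rep by (auto simp: N_def)
    next
      case False
      then have "0 < N" using N by simp
      then have "L1_norm (commutator b T f) / N \<le> (INF ps\<in>atom_reps b f. \<Sum>(\<gamma>, a)\<leftarrow>ps. \<bar>\<gamma>\<bar>)"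
        using rep by (intro cINF_greatest f) (simp add: divide_le_eq mult.commute)
      then show ?thesis using \<open>0 < N\<close> by (simp add: N_def[symmetric] divide_le_eq mult.commute)
    qed
  qed
qed

end
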